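(* Let $n\ge1$ be an integer, $\Omega\subset\mathbb{R}^n$ a measurable set and $\frac12<s<1$. For $x\in\mathbb{R}^n$ and $w\in\mathbb{S}^{n-1}$ let $A_{x,w}=\{t\in\mathbb{R}:\ x+tw\in\Omega\}$. Suppose there exists $\Sigma\subset\mathbb{S}^{n-1}$ with $\mathcal{H}^{n-1}(\Sigma)>0$ such that the sets $A_{x,w}$, $w\in\Sigma$, $x\in\mathbb{R}^n$, satisfy uniformly the one-dimensional finite ball condition, that is, $$m:=\sup\{\operatorname{length}(I):\ I\text{ an interval},\ I\subset A_{x,w},\ w\in\Sigma,\ x\in\mathbb{R}^n\}<\infty.$$ Then the regional fractional Poincaré inequality holds in $\Omega$ (i.e. $P^1_{n,s}(\Omega)>0$); more precisely, $$P^1_{n,s}(\Omega)\ \ge\ \frac{C_{n,s}}{2\,C_{1,s}}\,\mathcal{H}^{n-1}(\Sigma)\,\frac{P^1_{1,s}((0,1))}{m^{2s}}.$$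
   Context: $\mathbb{S}^{n-1}\subset\mathbb{R}^n$ is the unit sphere and $\mathcal{H}^{n-1}$ is $(n-1)$-dimensional Hausdorff measure. For an integer $n\ge1$ and $0<s<1$ set $C_{n,s}=\dfrac{s\,2^{2s}\,\Gamma\left(\frac{n+2s}{2}\right)}{\pi^{n/2}\,\Gamma(1-s)}$. For $\Omega\subset\mathbb{R}^n$ let $[u]_{s,2,\Omega}=\left(\frac{C_{n,s}}{2}\int_\Omega\int_\Omega\frac{|u(x)-u(y)|^2}{|x-y|^{n+2s}}\,dx\,dy\right)^{1/2}$, let $C_c^\infty(\Omega)$ be the smooth functions on $\mathbb{R}^n$ whose support is compact and contained in $\Omega$, and let $W^{s,2}_0(\Omega)$ be the closure of $C_c^\infty(\Omega)$ in the norm $\left(\|u\|_{L^2(\Omega)}^2+[u]_{s,2,\Omega}^2\right)^{1/2}$. Define $$P^1_{n,s}(\Omega)=\inf_{u\in W^{s,2}_0(\Omega),\,u\ne0}\frac{[u]_{s,2,\Omega}^2}{\int_\Omega u^2},$$ with the convention that the infimum over the empty set is $+\infty$. *)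

theory Defs
  imports "HOL-Analysis.Analysis"
begin

text \<open>
  Throughout, \<open>\<real>\<^sup>n\<close> is a Euclidean space \<open>'a\<close> with \<open>n = DIM('a)\<close>. The one-dimensional quantities are
  the same constants at type \<^typ>\<open>real\<close>. Integrals and extremal values that may be infinite are
  taken in \<^typ>\<open>ennreal\<close>, where the infimum of the empty set is \<open>\<infinity>\<close>.
\<close>

definition frac_const :: "nat \<Rightarrow> real \<Rightarrow> real" where
  "frac_const n s =
     s * 2 powr (2 * s) * Gamma ((real n + 2 * s) / 2) / (pi powr (real n / 2) * Gamma (1 - s))"

section \<open>Hausdorff measure\<close>

text \<open>
  The \<open>d\<close>-dimensional Hausdorff outer measure, in the normalisation for which it agrees with
  Lebesgue measure on \<open>\<real>\<^sup>d\<close> and with surface area on \<open>d\<close>-dimensional submanifolds. For \<open>d = 0\<close> the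
  convention \<open>0\<^sup>0 = 1\<close> for nonempty sets yields counting measure; the empty set always has size \<open>0\<close>.
  Boundedness of the covering sets is demanded explicitly because \<^const>\<open>diameter\<close> is not
  meaningful on unbounded sets.
\<close>

definition hausdorff_size :: "nat \<Rightarrow> 'a::metric_space set \<Rightarrow> ennreal" where
  "hausdorff_size d C =
     (if C = {} then 0 else ennreal (unit_ball_vol (real d) * (diameter C / 2) ^ d))"

definition hausdorff_content :: "nat \<Rightarrow> real \<Rightarrow> 'a::metric_space set \<Rightarrow> ennreal" where
  "hausdorff_content d \<delta> A =
     (INF C \<in> {C :: nat \<Rightarrow> 'a set. A \<subseteq> (\<Union>i. C i) \<and> (\<forall>i. bounded (C i) \<and> diameter (C i) \<le> \<delta>)}.
        \<Sum>i. hausdorff_size d (C i))"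

definition hausdorff_measure :: "nat \<Rightarrow> 'a::metric_space set \<Rightarrow> ennreal" where
  "hausdorff_measure d A = (SUP \<delta> \<in> {0<..}. hausdorff_content d \<delta> A)"

section \<open>Smooth functions of compact support\<close>

text \<open>\<open>C\<^sup>k\<close> functions: all iterated partial derivatives up to order \<open>k\<close> exist and are continuous.\<close>

fun k_times_cont_diff :: "nat \<Rightarrow> ('a::euclidean_space \<Rightarrow> real) \<Rightarrow> bool" where
  "k_times_cont_diff 0 f \<longleftrightarrow> continuous_on UNIV f"
| "k_times_cont_diff (Suc k) f \<longleftrightarrow>
     f differentiable_on UNIV \<and>
     (\<forall>b\<in>Basis. k_times_cont_diff k (\<lambda>x. frechet_derivative f (at x) b))"

definition test_functions :: "'a::euclidean_space set \<Rightarrow> ('a \<Rightarrow> real) set" where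
  "test_functions \<Omega> =
     {\<phi>. (\<forall>k. k_times_cont_diff k \<phi>) \<and>
         compact (closure {x. \<phi> x \<noteq> 0}) \<and> closure {x. \<phi> x \<noteq> 0} \<subseteq> \<Omega>}"

section \<open>Regional fractional Sobolev spaces\<close>

text \<open>
  The squares of the \<open>L\<^sup>2\<close> norm, of the regional Gagliardo seminorm \<open>[u]\<^sub>s\<^sub>,\<^sub>2\<^sub>,\<^sub>\<Omega>\<close>, and of the resulting
  Sobolev norm. On the diagonal \<open>x = y\<close> the integrand is \<open>0\<close>.
\<close>

definition L2_norm_sq :: "'a::euclidean_space set \<Rightarrow> ('a \<Rightarrow> real) \<Rightarrow> ennreal" where
  "L2_norm_sq \<Omega> u = (\<integral>\<^sup>+x. ennreal ((u x)\<^sup>2) \<partial>lebesgue_on \<Omega>)"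

definition gagliardo_sq :: "real \<Rightarrow> 'a::euclidean_space set \<Rightarrow> ('a \<Rightarrow> real) \<Rightarrow> ennreal" where
  "gagliardo_sq s \<Omega> u =
     ennreal (frac_const DIM('a) s / 2) *
     (\<integral>\<^sup>+y. (\<integral>\<^sup>+x. ennreal (\<bar>u x - u y\<bar>\<^sup>2 / norm (x - y) powr (real DIM('a) + 2 * s))
        \<partial>lebesgue_on \<Omega>) \<partial>lebesgue_on \<Omega>)"

definition sobolev_norm_sq :: "real \<Rightarrow> 'a::euclidean_space set \<Rightarrow> ('a \<Rightarrow> real) \<Rightarrow> ennreal" where
  "sobolev_norm_sq s \<Omega> u = L2_norm_sq \<Omega> u + gagliardo_sq s \<Omega> u"

text \<open>
  The closure of the test functions. Elements are represented by functions rather than by classes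
  modulo equality almost everywhere on \<open>\<Omega>\<close>; values outside \<open>\<Omega>\<close> are irrelevant.
\<close>

definition sobolev_0 :: "real \<Rightarrow> 'a::euclidean_space set \<Rightarrow> ('a \<Rightarrow> real) set" where
  "sobolev_0 s \<Omega> =
     {u \<in> borel_measurable (lebesgue_on \<Omega>).
        sobolev_norm_sq s \<Omega> u < \<infinity> \<and>
        (\<exists>\<phi>. (\<forall>k::nat. \<phi> k \<in> test_functions \<Omega>) \<and>
             (\<lambda>k. sobolev_norm_sq s \<Omega> (\<lambda>x. u x - \<phi> k x)) \<longlonglongrightarrow> 0)}"

text \<open>Accordingly, \<open>u \<noteq> 0\<close> means that \<open>u\<close> is not almost everywhere zero on \<open>\<Omega>\<close>.\<close>

definition poincare_const :: "real \<Rightarrow> 'a::euclidean_space set \<Rightarrow> ennreal" where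
  "poincare_const s \<Omega> =
     (INF u \<in> {u \<in> sobolev_0 s \<Omega>. \<not> (AE x in lebesgue_on \<Omega>. u x = 0)}.
        gagliardo_sq s \<Omega> u / L2_norm_sq \<Omega> u)"

definition line_section :: "'a::euclidean_space set \<Rightarrow> 'a \<Rightarrow> 'a \<Rightarrow> real set" where
  "line_section \<Omega> x w = {t. x + t *\<^sub>R w \<in> \<Omega>}"

end

theory Submission
  imports Defs
begin

text \<open>
  Integrating over differences \<open>x - y\<close> in polar coordinates and then along parallel lines expresses
  the Gagliardo energy of a test function \<open>\<phi>\<close> through one-dimensional energies of its restrictions
  to lines. Each restriction is smooth and lives on the open set where it does not vanish; if the
  direction lies in the given set, the components of that set are intervals of length at most \<open>m\<close>,
  at whose end points the restriction is \<open>0\<close>, and the rescaled one-dimensional inequality applies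
  to each of them. Interactions between different components only help. The directions enter
  through the volume of a cone, which is bounded below by Hausdorff measure. The lower bound extends
  from test functions to their closure, and positivity of the one-dimensional constant for
  \<open>s > 1/2\<close> follows by comparing mean squares over dyadic intervals shrinking to the end point \<open>0\<close>.
\<close>

section \<open>Hausdorff measure of subsets of the sphere\<close>

text \<open>Measurability shapes the argument. \<open>\<Omega>\<close> is only Lebesgue measurable,
  so individual line sections of it may fail to be measurable; each test function is therefore
  treated on its own open nonvanishing set, which lies in \<open>\<Omega>\<close> and carries at
  most the energy over \<open>\<Omega>\<close>. Directions are averaged without a surface measure: a
  vector \<open>z\<close> with \<open>1 < norm z < 2\<close> stands for the direction
  \<open>z /\<^sub>R norm z\<close>. The price is the factor \<open>shell_const\<close>, which
  occurs both in the energy identity and in the bound for Hausdorff measure, and cancels. The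
  constant has three sources. The polar Jacobian \<open>l ^ (n - 1)\<close> turns the kernel
  exponent \<open>n + 2 s\<close> into \<open>1 + 2 s\<close>, so the one-dimensional energy appears
  with its own normalisation and leaves the quotient of the two \<open>frac_const\<close>. Polar
  coordinates use only \<open>l > 0\<close>, while a line energy counts both orders of a pair of
  points; hence the 2 in the denominator. Scaling an interval of length at most \<open>m\<close> to
  the unit interval gives the power of \<open>m\<close>.\<close>

lemma nn_integral_ball_slices:
  fixes r c :: real
  assumes "0 \<le> r"
  shows "(\<integral>\<^sup>+t. indicator {c - r..c + r} t *
            ennreal (unit_ball_vol (real d) * sqrt (r\<^sup>2 - (t - c)\<^sup>2) ^ d) \<partial>lborel)
         = ennreal (unit_ball_vol (real (Suc d)) * r ^ Suc d)"
proof (cases "r = 0")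
  case True
  have "(\<integral>\<^sup>+t. ennreal (unit_ball_vol (real d) * sqrt (- (t - c)\<^sup>2) ^ d) * indicator {c} t \<partial>lborel) = 0"
    by (subst nn_integral_indicator_singleton) auto
  then show ?thesis using True by (simp add: mult.commute)
next
  case False
  with assms have assms: "0 < r" by simp
  have "(\<integral>\<^sup>+t. indicator {c - r..c + r} t *
            ennreal (unit_ball_vol (real d) * sqrt (r\<^sup>2 - (t - c)\<^sup>2) ^ d) \<partial>lborel)
     = ennreal \<bar>r\<bar> * (\<integral>\<^sup>+x. indicator {c - r..c + r} (c + r * x) *
            ennreal (unit_ball_vol (real d) * sqrt (r\<^sup>2 - (c + r * x - c)\<^sup>2) ^ d) \<partial>lborel)"
    by (rule nn_integral_real_affine) (use assms in auto)
  also have "(\<integral>\<^sup>+x. indicator {c - r..c + r} (c + r * x) *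
            ennreal (unit_ball_vol (real d) * sqrt (r\<^sup>2 - (c + r * x - c)\<^sup>2) ^ d) \<partial>lborel)
    = (\<integral>\<^sup>+x. ennreal (unit_ball_vol (real d) * r ^ d) *
            ennreal (indicator {-1..1} x * sqrt (1 - x\<^sup>2) ^ d) \<partial>lborel)"
  proof (intro nn_integral_cong)
    fix x :: real
    have 1: "c - r \<le> c + r * x \<longleftrightarrow> -1 \<le> x" "c + r * x \<le> c + r \<longleftrightarrow> x \<le> 1"
      using assms mult_le_cancel_left_pos[of r "-1" x] mult_le_cancel_left_pos[of r x 1] by auto
    have "r\<^sup>2 - (c + r * x - c)\<^sup>2 = r\<^sup>2 * (1 - x\<^sup>2)"
      by (simp add: power2_eq_square algebra_simps)
    then have "sqrt (r\<^sup>2 - (c + r * x - c)\<^sup>2) = r * sqrt (1 - x\<^sup>2)"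
      using assms by (simp add: real_sqrt_mult)
    then show "indicator {c - r..c + r} (c + r * x) *
            ennreal (unit_ball_vol (real d) * sqrt (r\<^sup>2 - (c + r * x - c)\<^sup>2) ^ d)
      = ennreal (unit_ball_vol (real d) * r ^ d) * ennreal (indicator {-1..1} x * sqrt (1 - x\<^sup>2) ^ d)"
      using assms 1 by (auto simp: indicator_def power_mult_distrib ennreal_mult'[symmetric] mult_ac)
  qed
  also have "\<dots> = ennreal (unit_ball_vol (real d) * r ^ d) * ennreal (Beta (1 / 2) (real d / 2 + 1))"
    by (subst nn_integral_cmult) (auto simp: emeasure_cball_aux_integral)
  also have "ennreal \<bar>r\<bar> * (ennreal (unit_ball_vol (real d) * r ^ d) * ennreal (Beta (1 / 2) (real d / 2 + 1)))
     = ennreal (unit_ball_vol (real d) * Beta (1 / 2) (real d / 2 + 1) * r ^ Suc d)"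
    using assms by (simp add: ennreal_mult'[symmetric] mult_ac)
  \<comment> \<open>The slice integral of the unit ball is a Beta value, and by
    \<open>Gamma (1/2) = sqrt pi\<close> it is the quotient of the volumes of consecutive unit
    balls.\<close>
  also have "unit_ball_vol (real d) * Beta (1 / 2) (real d / 2 + 1) = unit_ball_vol (real (Suc d))"
    by (auto simp: unit_ball_vol_def Beta_def Gamma_eq_zero_iff field_simps
          Gamma_one_half_real powr_half_sqrt [symmetric] powr_add [symmetric])
  finally show ?thesis .
qed

text \<open>By the law of cosines, with \<open>R = norm a\<close>, the squared chord equals
  \<open>((dist a x)^2 - (\<rho> - R)^2) / (\<rho> R)\<close>. With \<open>r\<close> in place of
  \<open>dist a x\<close> the numerator is the squared radius of a hyperplane slice of the ball, the
  quantity integrated in \<open>nn_integral_ball_slices\<close>.\<close>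

lemma sphere_Int_cball_chord:
  fixes a x :: "'a::euclidean_space"
  assumes "norm x = \<rho>" "0 < \<rho>" "a \<noteq> 0" "dist a x \<le> r"
  shows "(dist (x /\<^sub>R \<rho>) (a /\<^sub>R norm a))\<^sup>2 \<le> (r\<^sup>2 - (\<rho> - norm a)\<^sup>2) / (\<rho> * norm a)"
proof -
  define R where "R = norm a"
  have R: "R > 0" using assms by (simp add: R_def)
  have d1: "(dist a x)\<^sup>2 = R\<^sup>2 + \<rho>\<^sup>2 - 2 * (a \<bullet> x)"
    unfolding assms(1)[symmetric] by (simp add: dist_norm R_def power2_norm_eq_inner inner_diff inner_commute)
  have "(dist a x)\<^sup>2 \<le> r\<^sup>2" using assms by (simp add: power_mono)
  then have le: "R\<^sup>2 + \<rho>\<^sup>2 - 2 * (a \<bullet> x) \<le> r\<^sup>2" using d1 by simp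
  have n1: "norm (x /\<^sub>R \<rho>) = 1" "norm (a /\<^sub>R R) = 1" using assms R by (auto simp: R_def)
  have "(dist (x /\<^sub>R \<rho>) (a /\<^sub>R R))\<^sup>2 = (norm (x /\<^sub>R \<rho>))\<^sup>2 + (norm (a /\<^sub>R R))\<^sup>2 - 2 * ((x /\<^sub>R \<rho>) \<bullet> (a /\<^sub>R R))"
    unfolding dist_norm power2_norm_eq_inner by (simp add: inner_diff inner_commute algebra_simps)
  also have "\<dots> = 2 - 2 * (a \<bullet> x) / (\<rho> * R)"
    unfolding n1 by (simp add: inner_commute divide_simps)
  also have "\<dots> = (2 * (\<rho> * R) - 2 * (a \<bullet> x)) / (\<rho> * R)"
    using R assms by (simp add: diff_divide_distrib)
  also have "\<dots> \<le> (r\<^sup>2 - (\<rho> - R)\<^sup>2) / (\<rho> * R)"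
    using R assms le by (intro divide_right_mono) (auto simp: power2_eq_square algebra_simps)
  finally show ?thesis by (simp add: R_def)
qed

section \<open>Covers by balls of controlled total volume\<close>

text \<open>Vitali's covering lemma selects disjoint balls inside a small open set around
  \<open>N\<close> whose fivefold enlargements cover \<open>N\<close>. The enlargement costs
  \<open>5 ^ DIM('a)\<close>, which is absorbed by taking the open set that much smaller.\<close>

lemma ball_cover_of_negligible:
  fixes N :: "'a::euclidean_space set"
  assumes N: "negligible N" and "0 < \<delta>" "0 < \<epsilon>"
  obtains D :: "('a \<times> real) set" where "countable D" "\<forall>p\<in>D. 0 < snd p \<and> snd p < \<delta>"
    "N \<subseteq> (\<Union>p\<in>D. ball (fst p) (snd p))"
    "(\<integral>\<^sup>+p. emeasure lborel (ball (fst p) (snd p)) \<partial>count_space D) \<le> ennreal \<epsilon>"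
proof -
  define n where "n = DIM('a)"
  have "N \<in> sets lebesgue" using N by (simp add: negligible_imp_sets)
  moreover have "0 < \<epsilon> / 5 ^ n" using assms by simp
  ultimately obtain T where T: "open T" "N \<subseteq> T" "emeasure lebesgue (T - N) < ennreal (\<epsilon> / 5 ^ n)"
    by (rule sets_lebesgue_outer_open)
  have TL: "T \<in> sets lebesgue" using T(1) by simp
  have "emeasure lebesgue T \<le> emeasure lebesgue (T - N) + emeasure lebesgue N"
    using emeasure_subadditive[of "T - N" lebesgue N] T TL \<open>N \<in> sets lebesgue\<close>
    by (simp add: Un_absorb2 sets.Diff del: emeasure_completion)
  also have "emeasure lebesgue N = 0" using N by (metis negligible_iff_emeasure0 negligible_imp_sets)
  finally have eT: "emeasure lborel T \<le> ennreal (\<epsilon> / 5 ^ n)" using T by simp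
  define K where "K = {p::'a \<times> real. 0 < snd p \<and> snd p < \<delta> / 5 \<and> ball (fst p) (snd p) \<subseteq> T}"
  have "N \<subseteq> (\<Union>p\<in>K. ball (fst p) (snd p))"
  proof
    fix x assume "x \<in> N"
    then obtain e where e: "e > 0" "ball x e \<subseteq> T" using T open_contains_ball by (metis subsetD)
    have "(x, min e (\<delta>/6)) \<in> K" using e assms by (auto simp: K_def)
    then show "x \<in> (\<Union>p\<in>K. ball (fst p) (snd p))" using e assms by (force intro!: bexI[of _ "(x, min e (\<delta>/6))"])
  qed
  moreover have "\<And>p. p \<in> K \<Longrightarrow> 0 < snd p \<and> snd p \<le> \<delta> / 5" by (auto simp: K_def)
  ultimately obtain C where C: "countable C" "C \<subseteq> K"
     "pairwise (\<lambda>i j. disjnt (ball (fst i) (snd i)) (ball (fst j) (snd j))) C"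
     "N \<subseteq> (\<Union>i\<in>C. ball (fst i) (5 * snd i))"
    by (rule Vitali_covering_lemma_balls)
  define D where "D = (\<lambda>p. (fst p, 5 * snd p)) ` C"
  have inj: "inj_on (\<lambda>p. (fst p, 5 * snd p)) C" by (auto simp: inj_on_def prod_eq_iff)
  show thesis
  proof (rule that[of D])
    show "countable D" using C by (simp add: D_def)
    show "\<forall>p\<in>D. 0 < snd p \<and> snd p < \<delta>" using C by (auto simp: D_def K_def)
    show "N \<subseteq> (\<Union>p\<in>D. ball (fst p) (snd p))" using C by (auto simp: D_def)
    have "(\<integral>\<^sup>+p. emeasure lborel (ball (fst p) (snd p)) \<partial>count_space D)
      = (\<integral>\<^sup>+p. emeasure lborel (ball (fst p) (5 * snd p)) \<partial>count_space C)"
      using nn_integral_bij_count_space[OF inj_on_imp_bij_betw[OF inj], of "\<lambda>p. emeasure lborel (ball (fst p) (snd p))"]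
      by (simp add: D_def)
    also have "\<dots> = (\<integral>\<^sup>+p. ennreal (5 ^ n) * emeasure lborel (ball (fst p) (snd p)) \<partial>count_space C)"
      using C by (intro nn_integral_cong)
        (auto simp: K_def emeasure_ball n_def power_mult_distrib ennreal_mult'[symmetric] mult_ac dest!: subsetD)
    also have "\<dots> = ennreal (5 ^ n) * (\<integral>\<^sup>+p. emeasure lborel (ball (fst p) (snd p)) \<partial>count_space C)"
      by (intro nn_integral_cmult) auto
    also have "(\<integral>\<^sup>+p. emeasure lborel (ball (fst p) (snd p)) \<partial>count_space C)
        = emeasure lborel (\<Union>p\<in>C. ball (fst p) (snd p))"
      using C by (intro emeasure_UN_countable[symmetric])
        (auto simp: disjoint_family_on_def pairwise_def disjnt_def)
    also have "\<dots> \<le> emeasure lborel T" using C T by (intro emeasure_mono) (auto simp: K_def)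
    also note eT
    also have "ennreal (5 ^ n) * ennreal (\<epsilon> / 5 ^ n) = ennreal \<epsilon>"
      using assms by (simp add: ennreal_mult'[symmetric])
    finally show "(\<integral>\<^sup>+p. emeasure lborel (ball (fst p) (snd p)) \<partial>count_space D) \<le> ennreal \<epsilon>"
      by (simp add: mult_left_mono)
  qed
qed

text \<open>A sharp constant forbids enlarging the balls that carry the bulk of \<open>A\<close>.
  Vitali's covering theorem exhausts \<open>A\<close> up to a null set by disjoint balls inside an
  open set of almost the same measure; only the null remainder is left to
  \<open>ball_cover_of_negligible\<close>.\<close>

lemma ball_cover:
  fixes A :: "'a::euclidean_space set"
  assumes A: "A \<in> sets lebesgue" and "0 < \<delta>" "0 < \<epsilon>"
  obtains D :: "('a \<times> real) set" where "countable D" "\<forall>p\<in>D. 0 < snd p \<and> snd p < \<delta>"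
    "A \<subseteq> (\<Union>p\<in>D. ball (fst p) (snd p))"
    "(\<integral>\<^sup>+p. emeasure lborel (ball (fst p) (snd p)) \<partial>count_space D) \<le> emeasure lebesgue A + ennreal \<epsilon>"
proof -
  have "0 < \<epsilon> / 2" using assms by simp
  with A obtain T where T: "open T" "A \<subseteq> T" "emeasure lebesgue (T - A) < ennreal (\<epsilon> / 2)"
    by (rule sets_lebesgue_outer_open)
  have TL: "T \<in> sets lebesgue" using T(1) by simp
  have "emeasure lebesgue T \<le> emeasure lebesgue A + emeasure lebesgue (T - A)"
    using emeasure_subadditive[of A lebesgue "T - A"] T TL A
    by (simp add: Un_absorb1 sets.Diff del: emeasure_completion)
  also have "\<dots> \<le> emeasure lebesgue A + ennreal (\<epsilon> / 2)" using T by (intro add_mono) auto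
  finally have eT: "emeasure lborel T \<le> emeasure lebesgue A + ennreal (\<epsilon> / 2)" using T by simp
  define K where "K = {p::'a \<times> real. 0 < snd p \<and> snd p < \<delta> \<and> ball (fst p) (snd p) \<subseteq> T}"
  have "\<exists>i. i \<in> K \<and> x \<in> ball (fst i) (snd i) \<and> snd i < d" if "x \<in> A" "0 < d" for x d
  proof -
    obtain e where e: "e > 0" "ball x e \<subseteq> T" using T open_contains_ball \<open>x \<in> A\<close> by (metis subsetD)
    have "(x, min e (min (\<delta>/2) (d/2))) \<in> K" using e assms that by (auto simp: K_def)
    then show ?thesis using e assms that by (force intro!: exI[of _ "(x, min e (min (\<delta>/2) (d/2)))"])
  qed
  then obtain C where C: "countable C" "C \<subseteq> K"
     "pairwise (\<lambda>i j. disjnt (ball (fst i) (snd i)) (ball (fst j) (snd j))) C"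
     "negligible (A - (\<Union>i\<in>C. ball (fst i) (snd i)))"
    by (rule Vitali_covering_theorem_balls)
  from C(4) \<open>0 < \<delta>\<close> \<open>0 < \<epsilon> / 2\<close>
  obtain D where D: "countable D" "\<forall>p\<in>D. 0 < snd p \<and> snd p < \<delta>"
    "A - (\<Union>i\<in>C. ball (fst i) (snd i)) \<subseteq> (\<Union>p\<in>D. ball (fst p) (snd p))"
    "(\<integral>\<^sup>+p. emeasure lborel (ball (fst p) (snd p)) \<partial>count_space D) \<le> ennreal (\<epsilon>/2)"
    by (rule ball_cover_of_negligible)
  let ?f = "\<lambda>p::'a \<times> real. emeasure lborel (ball (fst p) (snd p))"
  show thesis
  proof (rule that[of "C \<union> D"])
    show "countable (C \<union> D)" using C D by simp
    show "\<forall>p\<in>C \<union> D. 0 < snd p \<and> snd p < \<delta>" using C D by (auto simp: K_def)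
    show "A \<subseteq> (\<Union>p\<in>C \<union> D. ball (fst p) (snd p))" using D(3) by auto
    have "nn_integral (count_space (C \<union> D)) ?f
       = (\<integral>\<^sup>+p. ?f p * indicator (C \<union> D) p \<partial>count_space UNIV)"
      by (simp add: nn_integral_count_space_indicator)
    also have "\<dots> \<le> (\<integral>\<^sup>+p. ?f p * indicator C p + ?f p * indicator D p \<partial>count_space UNIV)"
      by (intro nn_integral_mono) (auto simp: indicator_def)
    also have "\<dots> = nn_integral (count_space C) ?f + nn_integral (count_space D) ?f"
      by (simp add: nn_integral_add nn_integral_count_space_indicator)
    also have "nn_integral (count_space C) ?f = emeasure lborel (\<Union>p\<in>C. ball (fst p) (snd p))"
      using C by (intro emeasure_UN_countable[symmetric])
        (auto simp: disjoint_family_on_def pairwise_def disjnt_def)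
    also have "\<dots> \<le> emeasure lborel T" using C T by (intro emeasure_mono) (auto simp: K_def)
    also note eT
    also have "emeasure lebesgue A + ennreal (\<epsilon> / 2) + nn_integral (count_space D) ?f \<le>
       emeasure lebesgue A + ennreal (\<epsilon> / 2) + ennreal (\<epsilon>/2)"
      using D by (intro add_mono) auto
    also have "\<dots> = emeasure lebesgue A + ennreal \<epsilon>"
      using assms by (simp add: add.assoc ennreal_plus[symmetric])
    finally show "nn_integral (count_space (C \<union> D)) ?f \<le> emeasure lebesgue A + ennreal \<epsilon>"
      by (simp add: add_right_mono)
  qed
qed


lemma ball_cover_sequence:
  fixes A :: "'a::euclidean_space set"
  assumes A: "A \<in> sets lebesgue" and "0 < \<delta>" "0 < \<epsilon>"
  obtains a :: "nat \<Rightarrow> 'a" and r :: "nat \<Rightarrow> real" where "\<And>i. 0 \<le> r i" "\<And>i. r i < \<delta>"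
    "A \<subseteq> (\<Union>i. ball (a i) (r i))"
    "(\<Sum>i. emeasure lborel (ball (a i) (r i))) \<le> emeasure lebesgue A + ennreal \<epsilon>"
proof -
  obtain D :: "('a \<times> real) set" where D: "countable D" "\<forall>p\<in>D. 0 < snd p \<and> snd p < \<delta>"
    "A \<subseteq> (\<Union>p\<in>D. ball (fst p) (snd p))"
    "(\<integral>\<^sup>+p. emeasure lborel (ball (fst p) (snd p)) \<partial>count_space D) \<le> emeasure lebesgue A + ennreal \<epsilon>"
    using assms by (rule ball_cover)
  define I where "I = to_nat_on D ` D"
  define a where "a i = fst (from_nat_into D i)" for i
  \<comment> \<open>Indices that enumerate no ball receive radius 0, hence the empty ball, because
    covers in \<open>hausdorff_content\<close> are indexed by all natural numbers.\<close>
  define r where "r i = (if i \<in> I then snd (from_nat_into D i) else 0)" for i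
  have bij: "bij_betw (to_nat_on D) D I"
    using inj_on_to_nat_on[OF D(1)] by (simp add: I_def bij_betw_def)
  have r: "0 \<le> r i" "r i < \<delta>" for i
    using D \<open>0 < \<delta>\<close> by (auto simp: r_def I_def less_imp_le)
  have cov: "A \<subseteq> (\<Union>i. ball (a i) (r i))"
  proof
    fix x assume "x \<in> A"
    then obtain p where p: "p \<in> D" "x \<in> ball (fst p) (snd p)" using D by blast
    then have "x \<in> ball (a (to_nat_on D p)) (r (to_nat_on D p))"
      using D by (simp add: a_def r_def I_def)
    then show "x \<in> (\<Union>i. ball (a i) (r i))" by blast
  qed
  have "(\<Sum>i. emeasure lborel (ball (a i) (r i))) = (\<integral>\<^sup>+i. emeasure lborel (ball (a i) (r i)) \<partial>count_space UNIV)"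
    by (simp add: nn_integral_count_space_nat)
  also have "\<dots> = (\<integral>\<^sup>+i. emeasure lborel (ball (a i) (r i)) \<partial>count_space I)"
    by (simp add: nn_integral_count_space_indicator) (intro nn_integral_cong, auto simp: r_def indicator_def)
  also have "\<dots> = (\<integral>\<^sup>+p. emeasure lborel (ball (a (to_nat_on D p)) (r (to_nat_on D p))) \<partial>count_space D)"
    by (rule nn_integral_bij_count_space[OF bij, symmetric])
  also have "\<dots> = (\<integral>\<^sup>+p. emeasure lborel (ball (fst p) (snd p)) \<partial>count_space D)"
    using D by (intro nn_integral_cong) (simp add: a_def r_def I_def)
  finally show thesis using that[of r a] r cov D(4) by simp
qed

section \<open>Comparison of Hausdorff measure with the volume of a cone\<close>

text \<open>Radii above 1 make division by the radius contract distances, so balls of small radius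
  project to small subsets of the unit sphere.\<close>

definition cone_shell :: "'a::euclidean_space set \<Rightarrow> 'a set" where
  "cone_shell A = {z. 1 < norm z \<and> norm z < 2 \<and> z /\<^sub>R norm z \<in> A}"

text \<open>The radial factor of polar coordinates: for \<open>d = n - 1\<close> it is the ratio
  between the volume of \<open>cone_shell A\<close> and the surface area of
  \<open>A\<close>.\<close>

definition shell_const :: "nat \<Rightarrow> ennreal" where
  "shell_const d = (\<integral>\<^sup>+t. indicator {1<..<2} t * ennreal (t ^ d) \<partial>lborel)"

text \<open>
  The section of a ball of radius \<open>r\<close> by a sphere of radius \<open>\<rho>\<close> has, after rescaling to the unit
  sphere and up to a factor close to \<open>1\<close>, at most the diameter of the section of the ball by a
  hyperplane at distance \<open>\<bar>\<rho> - norm a\<bar>\<close> from its centre. Integrating over \<open>\<rho>\<close> therefore recovers the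
  volume of the ball, so that a cover of a cone by balls of small total volume yields, for some
  \<open>\<rho>\<close>, an efficient cover of its trace on the sphere. This gives the sharp constant without the
  isodiametric inequality.
\<close>

lemma hausdorff_size_sphere_section:
  fixes a :: "'a::euclidean_space"
  assumes \<rho>: "1 < \<rho>" and r: "0 \<le> r" "r < \<delta>" and \<delta>: "0 < \<delta>" "\<delta> < 1"
  defines "C \<equiv> (\<lambda>x. x /\<^sub>R \<rho>) ` (ball a r \<inter> sphere 0 \<rho>)"
  shows "bounded C" and "diameter C \<le> 2 * \<delta>"
    and "ennreal (\<rho> ^ d) * hausdorff_size d C \<le> ennreal ((1 / (1 - \<delta>)) ^ d) *
       (indicator {norm a - r..norm a + r} \<rho> * ennreal (unit_ball_vol (real d) * sqrt (r\<^sup>2 - (\<rho> - norm a)\<^sup>2) ^ d))"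
proof -
  have "C \<subseteq> cball 0 1" using \<rho> by (auto simp: C_def)
  then show "bounded C" using bounded_cball bounded_subset by blast
  show "diameter C \<le> 2 * \<delta>"
  proof (rule diameter_le)
    show "C \<noteq> {} \<or> 0 \<le> 2 * \<delta>" using \<delta> by simp
    fix u v assume "u \<in> C" "v \<in> C"
    obtain x where x: "u = x /\<^sub>R \<rho>" "dist a x < r"
      using \<open>u \<in> C\<close> unfolding C_def by (force elim: imageE)
    obtain y where y: "v = y /\<^sub>R \<rho>" "dist a y < r"
      using \<open>v \<in> C\<close> unfolding C_def by (force elim: imageE)
    note xy = x y
    have "norm (u - v) = norm (x - y) / \<rho>"
      using \<rho> unfolding xy scaleR_diff_right[symmetric] by (simp add: divide_inverse mult.commute)
    also have "\<dots> \<le> norm (x - y)" using \<rho> by (simp add: divide_le_eq mult_left_le[of 1] mult_le_cancel_left1)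
    also have "\<dots> \<le> 2 * \<delta>" using xy r dist_triangle3[of x y a] by (simp add: dist_norm)
    finally show "norm (u - v) \<le> 2 * \<delta>" .
  qed
  show "ennreal (\<rho> ^ d) * hausdorff_size d C \<le> ennreal ((1 / (1 - \<delta>)) ^ d) *
       (indicator {norm a - r..norm a + r} \<rho> * ennreal (unit_ball_vol (real d) * sqrt (r\<^sup>2 - (\<rho> - norm a)\<^sup>2) ^ d))"
  proof (cases "C = {}")
    case True then show ?thesis by (simp add: hausdorff_size_def)
  next
    case False
    define R where "R = norm a"
    define Q where "Q = r\<^sup>2 - (\<rho> - R)\<^sup>2"
    \<comment> \<open>By \<open>sphere_Int_cball_chord\<close> all of \<open>C\<close> lies within
      \<open>q\<close> of \<open>a /\<^sub>R R\<close>, so its diameter is at most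
      \<open>2 q\<close>. Moreover \<open>\<rho> q = sqrt (\<rho> / R) sqrt Q\<close>, where
      \<open>sqrt Q\<close> is the slice radius and the first factor is the distortion to be
      controlled.\<close>
    define q where "q = sqrt (Q / (\<rho> * R))"
    from False obtain x where "x \<in> ball a r \<inter> sphere 0 \<rho>" unfolding C_def by blast
    then have x: "norm x = \<rho>" "dist a x < r" by auto
    have ab: "\<bar>\<rho> - R\<bar> \<le> r" using x norm_triangle_ineq3[of x a] by (simp add: R_def dist_norm norm_minus_commute)
    have R: "R > 0" "a \<noteq> 0" using ab \<rho> r \<delta> by (auto simp: R_def)
    \<comment> \<open>As \<open>1 < \<rho>\<close>, the bound
      \<open>|\<rho> - R| <= r < \<delta>\<close> also reads relative to \<open>\<rho>\<close> and
      gives \<open>(1 - \<delta>) \<rho> <= R\<close>.\<close>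
    have "\<delta> * 1 \<le> \<delta> * \<rho>" using \<rho> \<delta> by (intro mult_left_mono) auto
    then have "\<rho> - \<delta> * \<rho> \<le> R" using ab r(2) by linarith
    then have "(1 - \<delta>) * \<rho> \<le> R" by (simp add: left_diff_distrib)
    then have "\<rho> / R \<le> 1 / (1 - \<delta>)" using R \<delta> by (simp add: field_simps)
    also have "\<dots> \<le> (1 / (1 - \<delta>))\<^sup>2" using \<delta> by (intro self_le_power) auto
    finally have "sqrt (\<rho> / R) \<le> 1 / (1 - \<delta>)" using \<delta> \<rho> R by (intro real_le_lsqrt) auto
    moreover have Q0: "0 \<le> Q" using ab r by (simp add: Q_def abs_le_square_iff[symmetric])
    moreover have "\<rho> * q = sqrt (\<rho> / R) * sqrt Q"
    proof -
      have "\<rho> * q = sqrt (\<rho>\<^sup>2) * q" using \<rho> by simp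
      also have "\<dots> = sqrt (\<rho> / R * Q)" unfolding q_def real_sqrt_mult[symmetric] using \<rho> R
        by (simp add: power2_eq_square)
      finally show ?thesis by (simp only: real_sqrt_mult)
    qed
    ultimately have \<rho>q: "\<rho> * q \<le> 1 / (1 - \<delta>) * sqrt Q"
      by (metis mult_right_mono real_sqrt_ge_zero)
    have q0: "0 \<le> q" using Q0 R \<rho> by (simp add: q_def)
    have dq: "dist u (a /\<^sub>R R) \<le> q" if "u \<in> C" for u
    proof -
      obtain y where "u = y /\<^sub>R \<rho>" "norm y = \<rho>" "dist a y < r"
        using \<open>u \<in> C\<close> unfolding C_def by (force elim: imageE)
      then have "(dist u (a /\<^sub>R R))\<^sup>2 \<le> Q / (\<rho> * R)"
        using sphere_Int_cball_chord[of y \<rho> a r] R \<rho> by (simp add: Q_def R_def)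
      then show ?thesis unfolding q_def by (rule real_le_rsqrt)
    qed
    have "diameter C \<le> 2 * q"
    proof (rule diameter_le)
      show "C \<noteq> {} \<or> 0 \<le> 2 * q" using False by simp
      fix u v assume "u \<in> C" "v \<in> C"
      then show "norm (u - v) \<le> 2 * q"
        using dq[of u] dq[of v] dist_triangle2[of u v "a /\<^sub>R R"] by (simp add: dist_norm)
    qed
    then have "(diameter C / 2) ^ d \<le> q ^ d"
      by (intro power_mono) (auto intro: diameter_ge_0 \<open>bounded C\<close>)
    then have "\<rho> ^ d * (diameter C / 2) ^ d \<le> (\<rho> * q) ^ d"
      using \<rho> by (simp add: power_mult_distrib)
    also have "\<dots> \<le> (1 / (1 - \<delta>) * sqrt Q) ^ d"
      using \<rho>q \<rho> q0 by (intro power_mono) auto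
    finally have "\<rho> ^ d * (diameter C / 2) ^ d \<le> (1 / (1 - \<delta>)) ^ d * sqrt Q ^ d"
      by (simp only: power_mult_distrib)
    moreover have "indicator {norm a - r..norm a + r} \<rho> = (1::ennreal)"
      using ab by (auto simp: R_def indicator_def abs_if split: if_splits)
    ultimately show ?thesis
      using False \<rho> \<delta> unfolding hausdorff_size_def Q_def R_def
      by (simp add: ennreal_mult'[symmetric] mult_ac) (intro ennreal_leI mult_left_mono; simp)
  qed
qed

text \<open>No single radius is selected. At every \<open>\<rho>\<close> in \<open>(1, 2)\<close>
  the traces of one ball cover on the sphere of radius \<open>\<rho>\<close>, scaled back, cover
  \<open>A\<close> and so bound its content. Integrating this bound with weight
  \<open>\<rho> ^ d\<close> produces \<open>shell_const\<close> on one side and the ball volumes on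
  the other.\<close>

lemma hausdorff_content_shell_le:
  fixes A :: "'a::euclidean_space set"
  assumes A: "A \<subseteq> sphere 0 1" and K: "cone_shell A \<in> sets lebesgue"
    and \<delta>: "0 < \<delta>" "\<delta> < 1" and "0 < \<epsilon>"
  shows "hausdorff_content (DIM('a) - 1) (2 * \<delta>) A * shell_const (DIM('a) - 1)
     \<le> ennreal ((1 / (1 - \<delta>)) ^ (DIM('a) - 1)) * (emeasure lebesgue (cone_shell A) + ennreal \<epsilon>)"
proof -
  define d where "d = DIM('a) - 1"
  define \<kappa> where "\<kappa> = ennreal ((1 / (1 - \<delta>)) ^ d)"
  have Sd: "Suc d = DIM('a)" by (simp add: d_def)
  obtain a :: "nat \<Rightarrow> 'a" and r where r: "\<And>i. 0 \<le> r i" "\<And>i. r i < \<delta>"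
    and cov: "cone_shell A \<subseteq> (\<Union>i. ball (a i) (r i))"
    and vol: "(\<Sum>i. emeasure lborel (ball (a i) (r i))) \<le> emeasure lebesgue (cone_shell A) + ennreal \<epsilon>"
    using K \<open>0 < \<delta>\<close> \<open>0 < \<epsilon>\<close> by (rule ball_cover_sequence) blast
  define g where "g i \<rho> = indicator {norm (a i) - r i..norm (a i) + r i} \<rho> *
      ennreal (unit_ball_vol (real d) * sqrt ((r i)\<^sup>2 - (\<rho> - norm (a i))\<^sup>2) ^ d)" for i \<rho>
  have [measurable]: "g i \<in> borel_measurable borel" for i
    unfolding g_def by measurable
  have "indicator {1<..<2} \<rho> * ennreal (\<rho> ^ d) * hausdorff_content d (2 * \<delta>) A \<le> (\<Sum>i. \<kappa> * g i \<rho>)" for \<rho>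
  proof (cases "1 < \<rho> \<and> \<rho> < 2")
    case True
    then have \<rho>: "1 < \<rho>" by simp
    define C where "C i = (\<lambda>x. x /\<^sub>R \<rho>) ` (ball (a i) (r i) \<inter> sphere 0 \<rho>)" for i
    have "A \<subseteq> (\<Union>i. C i)"
    proof
      fix w assume w: "w \<in> A"
      then have "norm w = 1" using A by auto
      then have "\<rho> *\<^sub>R w \<in> cone_shell A" using True w by (simp add: cone_shell_def)
      then obtain i where "\<rho> *\<^sub>R w \<in> ball (a i) (r i)" using cov by blast
      then have "(\<rho> *\<^sub>R w) /\<^sub>R \<rho> \<in> C i" unfolding C_def using \<open>norm w = 1\<close> \<rho>
        by (intro imageI) auto
      then show "w \<in> (\<Union>i. C i)" using \<rho> by auto
    qed
    then have "hausdorff_content d (2 * \<delta>) A \<le> (\<Sum>i. hausdorff_size d (C i))"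
      unfolding hausdorff_content_def
      using hausdorff_size_sphere_section(1,2)[OF \<rho> r(1) r(2) \<delta>]
      by (intro INF_lower) (auto simp: C_def)
    then have "ennreal (\<rho> ^ d) * hausdorff_content d (2 * \<delta>) A \<le> (\<Sum>i. ennreal (\<rho> ^ d) * hausdorff_size d (C i))"
      by (simp add: ennreal_suminf_cmult mult_left_mono)
    also have "\<dots> \<le> (\<Sum>i. \<kappa> * g i \<rho>)"
      unfolding C_def \<kappa>_def g_def
      by (intro suminf_le hausdorff_size_sphere_section(3)[OF \<rho> r(1) r(2) \<delta>]) auto
    finally show ?thesis using True by simp
  qed simp
  then have "(\<integral>\<^sup>+\<rho>. indicator {1<..<2} \<rho> * ennreal (\<rho> ^ d) * hausdorff_content d (2 * \<delta>) A \<partial>lborel)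
     \<le> (\<integral>\<^sup>+\<rho>. (\<Sum>i. \<kappa> * g i \<rho>) \<partial>lborel)"
    by (intro nn_integral_mono)
  also have "\<dots> = (\<Sum>i. \<kappa> * (\<integral>\<^sup>+\<rho>. g i \<rho> \<partial>lborel))"
    by (simp add: nn_integral_suminf nn_integral_cmult)
  also have "(\<integral>\<^sup>+\<rho>. g i \<rho> \<partial>lborel) = emeasure lborel (ball (a i) (r i))" for i
    unfolding g_def nn_integral_ball_slices[OF r(1)] Sd using r by (simp add: emeasure_ball)
  then have "(\<Sum>i. \<kappa> * (\<integral>\<^sup>+\<rho>. g i \<rho> \<partial>lborel)) = \<kappa> * (\<Sum>i. emeasure lborel (ball (a i) (r i)))"
    by (simp add: ennreal_suminf_cmult)
  also have "\<dots> \<le> \<kappa> * (emeasure lebesgue (cone_shell A) + ennreal \<epsilon>)"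
    using vol by (rule mult_left_mono) simp
  also have "(\<integral>\<^sup>+\<rho>. indicator {1<..<2} \<rho> * ennreal (\<rho> ^ d) * hausdorff_content d (2 * \<delta>) A \<partial>lborel)
     = shell_const d * hausdorff_content d (2 * \<delta>) A"
    unfolding shell_const_def by (intro nn_integral_multc) auto
  finally show ?thesis
    by (simp add: d_def \<kappa>_def mult.commute)
qed

lemma hausdorff_measure_shell_le:
  fixes A :: "'a::euclidean_space set"
  assumes A: "A \<subseteq> sphere 0 1" and K: "cone_shell A \<in> sets lebesgue"
  shows "hausdorff_measure (DIM('a) - 1) A * shell_const (DIM('a) - 1)
     \<le> emeasure lebesgue (cone_shell A)"
proof -
  define d where "d = DIM('a) - 1"
  define \<mu> where "\<mu> = emeasure lebesgue (cone_shell A)"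
  have "hausdorff_content d \<delta> A * shell_const d \<le> \<mu>" if "0 < \<delta>" for \<delta>
  proof -
    \<comment> \<open>The first bound keeps covers at scale \<open>2 * \<eta> n\<close> admissible
      at scale \<open>\<delta>\<close>; the second gives \<open>\<eta> n < 1\<close> and convergence
      to 0. The same \<open>\<eta> n\<close> serves as scale and as volume error.\<close>
    define \<eta> where "\<eta> n = min (\<delta> / 2) (1 / real (n + 2))" for n :: nat
    have \<eta>: "0 < \<eta> n" "\<eta> n < 1" "2 * \<eta> n \<le> \<delta>" for n
      using \<open>0 < \<delta>\<close> by (auto simp: \<eta>_def min_less_iff_disj)
    have le: "hausdorff_content d \<delta> A * shell_const d
       \<le> ennreal ((1 / (1 - \<eta> n)) ^ d) * (\<mu> + ennreal (\<eta> n))" for n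
    proof -
      have "hausdorff_content d \<delta> A \<le> hausdorff_content d (2 * \<eta> n) A"
        unfolding hausdorff_content_def using \<eta>[of n]
        by (intro INF_superset_mono) (auto intro: order_trans)
      then have "hausdorff_content d \<delta> A * shell_const d \<le> hausdorff_content d (2 * \<eta> n) A * shell_const d"
        by (rule mult_right_mono) simp
      also have "\<dots> \<le> ennreal ((1 / (1 - \<eta> n)) ^ d) * (\<mu> + ennreal (\<eta> n))"
        unfolding d_def \<mu>_def using A K \<eta> by (intro hausdorff_content_shell_le) auto
      finally show ?thesis .
    qed
    have lim0: "\<eta> \<longlonglongrightarrow> 0"
    proof (rule tendsto_sandwich[OF always_eventually always_eventually])
      show "\<forall>n. 0 \<le> \<eta> n" "\<forall>n. \<eta> n \<le> 1 / real (n + 2)" using \<eta> by (auto simp: less_imp_le \<eta>_def)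
      show "(\<lambda>n. 1 / real (n + 2)) \<longlonglongrightarrow> 0"
        using LIMSEQ_ignore_initial_segment[OF lim_1_over_n, of 2] by simp
    qed simp
    have "(\<lambda>n. ennreal ((1 / (1 - \<eta> n)) ^ d) * (\<mu> + ennreal (\<eta> n))) \<longlonglongrightarrow> ennreal ((1 / (1 - 0)) ^ d) * (\<mu> + ennreal 0)"
      by (intro tendsto_mult_ennreal tendsto_add tendsto_ennrealI tendsto_intros lim0) auto
    then have "(\<lambda>n. ennreal ((1 / (1 - \<eta> n)) ^ d) * (\<mu> + ennreal (\<eta> n))) \<longlonglongrightarrow> \<mu>" by simp
    then show ?thesis by (rule LIMSEQ_le_const) (use le in auto)
  qed
  then show ?thesis
    unfolding hausdorff_measure_def d_def \<mu>_def
    by (subst SUP_mult_right_ennreal) (auto intro!: SUP_least)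
qed

section \<open>Integration along rays and lines\<close>

lemma nn_integral_lborel_affine:
  fixes f :: "'a::euclidean_space \<Rightarrow> ennreal"
  assumes [measurable]: "f \<in> borel_measurable borel" and "c \<noteq> 0"
  shows "(\<integral>\<^sup>+x. f x \<partial>lborel) = ennreal (\<bar>c\<bar> ^ DIM('a)) * (\<integral>\<^sup>+x. f (t + c *\<^sub>R x) \<partial>lborel)"
  by (subst lborel_affine[OF assms(2), of t])
     (simp add: nn_integral_density nn_integral_distr nn_integral_cmult)

lemma nn_integral_lborel_translate:
  fixes f :: "'a::euclidean_space \<Rightarrow> ennreal"
  assumes "f \<in> borel_measurable borel"
  shows "(\<integral>\<^sup>+x. f (t + x) \<partial>lborel) = (\<integral>\<^sup>+x. f x \<partial>lborel)"
  using nn_integral_lborel_affine[OF assms, of 1 t] by simp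

lemma nn_integral_lborel_swap:
  fixes f :: "'a::euclidean_space \<Rightarrow> 'b::euclidean_space \<Rightarrow> ennreal"
  assumes "case_prod f \<in> borel_measurable (borel \<Otimes>\<^sub>M borel)"
  shows "(\<integral>\<^sup>+x. \<integral>\<^sup>+y. f x y \<partial>lborel \<partial>lborel) = (\<integral>\<^sup>+y. \<integral>\<^sup>+x. f x y \<partial>lborel \<partial>lborel)"
  by (rule lborel_pair.Fubini'[symmetric]) (use assms in \<open>simp add: lborel_prod[symmetric] cong: measurable_cong_sets\<close>)

lemma shell_const_eq: "shell_const d = ennreal ((2 ^ Suc d - 1) / real (Suc d))"
proof -
  have "shell_const d = (\<integral>\<^sup>+t. ennreal (t ^ d) * indicator {1..2} t \<partial>lborel)"
    unfolding shell_const_def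
  proof (rule nn_integral_cong_AE)
    have "AE t in lborel. t \<notin> {1, 2::real}"
      by (intro AE_not_in countable_imp_null_set_lborel) auto
    then show "AE t in lborel. indicator {1<..<2} t * ennreal (t ^ d) = ennreal (t ^ d) * indicator {1..2} t"
      by eventually_elim (auto simp: indicator_def)
  qed
  also have "\<dots> = ennreal (2 ^ Suc d / real (Suc d) - 1 ^ Suc d / real (Suc d))"
    by (rule nn_integral_FTC_Icc)
       (auto intro!: derivative_eq_intros simp del: power_Suc simp: divide_simps)
  finally show ?thesis by (simp add: diff_divide_distrib)
qed

text \<open>The substitution \<open>t = \<sigma> / l\<close> turns the integral into that of
  \<open>t ^ d\<close> over \<open>(1, 2)\<close>; the proof uses an explicit antiderivative
  instead. That the value does not depend on \<open>\<sigma>\<close> lets the weight leave the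
  integral in \<open>nn_integral_polar_shell\<close>.\<close>

lemma shell_weight:
  fixes \<sigma> :: real
  assumes "0 < \<sigma>"
  shows "(\<integral>\<^sup>+l. indicator {0<..} l * indicator {1<..<2} (\<sigma> / l) * ennreal (\<sigma> ^ Suc d / l ^ Suc (Suc d)) \<partial>lborel)
     = shell_const d"
proof -
  have "(\<integral>\<^sup>+l. indicator {0<..} l * indicator {1<..<2} (\<sigma> / l) * ennreal (\<sigma> ^ Suc d / l ^ Suc (Suc d)) \<partial>lborel)
     = (\<integral>\<^sup>+l. ennreal (\<sigma> ^ Suc d / l ^ Suc (Suc d)) * indicator {\<sigma>/2..\<sigma>} l \<partial>lborel)"
  proof (rule nn_integral_cong_AE)
    have "AE t in lborel. t \<notin> {\<sigma>/2, \<sigma>}"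
      by (intro AE_not_in countable_imp_null_set_lborel) auto
    then show "AE l in lborel. indicator {0<..} l * indicator {1<..<2} (\<sigma> / l) * ennreal (\<sigma> ^ Suc d / l ^ Suc (Suc d))
       = ennreal (\<sigma> ^ Suc d / l ^ Suc (Suc d)) * indicator {\<sigma>/2..\<sigma>} l"
      by eventually_elim (use assms in \<open>auto simp: indicator_def divide_simps\<close>)
  qed
  also have "\<dots> = ennreal ((- (\<sigma> ^ Suc d / (real (Suc d) * \<sigma> ^ Suc d))) - (- (\<sigma> ^ Suc d / (real (Suc d) * (\<sigma>/2) ^ Suc d))))"
  proof (rule nn_integral_FTC_Icc[where F = "\<lambda>l. - (\<sigma> ^ Suc d / (real (Suc d) * l ^ Suc d))"])
    fix l assume l: "l \<in> {\<sigma> / 2..\<sigma>}"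
    then have "l > 0" using assms by simp
    have "((\<lambda>l. - (\<sigma> ^ Suc d / (real (Suc d) * l ^ Suc d))) has_real_derivative
       (\<sigma> ^ Suc d * (real (Suc d) * (real (Suc d) * l ^ d)) / (real (Suc d) * l ^ Suc d)\<^sup>2)) (at l)"
      using \<open>l > 0\<close> by (auto intro!: derivative_eq_intros simp del: power_Suc of_nat_Suc simp: power2_eq_square)
    also have "\<sigma> ^ Suc d * (real (Suc d) * (real (Suc d) * l ^ d)) / (real (Suc d) * l ^ Suc d)\<^sup>2
       = \<sigma> ^ Suc d / l ^ Suc (Suc d)"
      using \<open>l > 0\<close> by (simp add: power2_eq_square divide_simps del: of_nat_Suc)
    finally show "((\<lambda>l. - (\<sigma> ^ Suc d / (real (Suc d) * l ^ Suc d))) has_real_derivative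
       \<sigma> ^ Suc d / l ^ Suc (Suc d)) (at l)" .
    show "0 \<le> \<sigma> ^ Suc d / l ^ Suc (Suc d)" using \<open>l > 0\<close> assms by simp
  qed (use assms in auto)
  also have "(- (\<sigma> ^ Suc d / (real (Suc d) * \<sigma> ^ Suc d))) - (- (\<sigma> ^ Suc d / (real (Suc d) * (\<sigma>/2) ^ Suc d)))
     = (2 ^ Suc d - 1) / real (Suc d)"
    using assms by (simp add: power_divide divide_simps del: of_nat_Suc power_Suc)
  finally show ?thesis by (simp add: shell_const_eq del: of_nat_Suc power_Suc)
qed

text \<open>
  Polar coordinates without surface measure: the direction is averaged over the shell
  \<open>1 < norm z < 2\<close>. Both sides arise by integrating over all dilations of \<open>f\<close>.
\<close>

lemma nn_integral_polar_shell:
  fixes f :: "'a::euclidean_space \<Rightarrow> ennreal"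
  assumes f[measurable]: "f \<in> borel_measurable borel"
  defines "d \<equiv> DIM('a) - 1"
  shows "shell_const d * (\<integral>\<^sup>+z. f z \<partial>lborel) =
    (\<integral>\<^sup>+z. indicator {1<..<2} (norm z) *
        (\<integral>\<^sup>+l. indicator {0<..} l * ennreal (l ^ d) * f (l *\<^sub>R (z /\<^sub>R norm z)) \<partial>lborel) \<partial>lborel)"
proof -
  have Sd: "DIM('a) = Suc d" by (simp add: d_def)
  have inner: "(\<integral>\<^sup>+l. indicator {0<..} l * ennreal (l ^ d) * f (l *\<^sub>R (z /\<^sub>R norm z)) \<partial>lborel)
     = (\<integral>\<^sup>+l. indicator {0<..} l * ennreal (norm z ^ Suc d * l ^ d) * f (l *\<^sub>R z) \<partial>lborel)"
    if "1 < norm z" for z :: 'a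
  proof -
    have "(\<integral>\<^sup>+l. indicator {0<..} l * ennreal (l ^ d) * f (l *\<^sub>R (z /\<^sub>R norm z)) \<partial>lborel)
      = ennreal \<bar>norm z\<bar> * (\<integral>\<^sup>+l. indicator {0<..} (0 + norm z * l) * ennreal ((0 + norm z * l) ^ d) * f ((0 + norm z * l) *\<^sub>R (z /\<^sub>R norm z)) \<partial>lborel)"
      by (rule nn_integral_real_affine) (use that in auto)
    also have "\<dots> = (\<integral>\<^sup>+l. ennreal \<bar>norm z\<bar> * (indicator {0<..} (0 + norm z * l) * ennreal ((0 + norm z * l) ^ d) * f ((0 + norm z * l) *\<^sub>R (z /\<^sub>R norm z))) \<partial>lborel)"
      by (rule nn_integral_cmult[symmetric]) measurable
    also have "\<dots> = (\<integral>\<^sup>+l. indicator {0<..} l * ennreal (norm z ^ Suc d * l ^ d) * f (l *\<^sub>R z) \<partial>lborel)"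
    proof (rule nn_integral_cong)
      fix l :: real
      have e: "(norm z * l) *\<^sub>R (z /\<^sub>R norm z) = l *\<^sub>R z" and "0 < norm z * l \<longleftrightarrow> 0 < l"
        using that by (auto simp: zero_less_mult_iff)
      moreover have "ennreal (norm z) * ennreal ((norm z * l) ^ d) = ennreal (norm z ^ Suc d * l ^ d)" if "0 < l"
        using that by (simp add: ennreal_mult'[symmetric] power_mult_distrib mult_ac)
      ultimately show "ennreal \<bar>norm z\<bar> * (indicator {0<..} (0 + norm z * l) * ennreal ((0 + norm z * l) ^ d) * f ((0 + norm z * l) *\<^sub>R (z /\<^sub>R norm z)))
        = indicator {0<..} l * ennreal (norm z ^ Suc d * l ^ d) * f (l *\<^sub>R z)"
        unfolding add_0 e by (auto simp: indicator_def mult.assoc[symmetric])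
    qed
    finally show ?thesis .
  qed
  have "(\<integral>\<^sup>+z. indicator {1<..<2} (norm z) *
        (\<integral>\<^sup>+l. indicator {0<..} l * ennreal (l ^ d) * f (l *\<^sub>R (z /\<^sub>R norm z)) \<partial>lborel) \<partial>lborel)
     = (\<integral>\<^sup>+z. \<integral>\<^sup>+l. indicator {1<..<2} (norm z) *
        (indicator {0<..} l * ennreal (norm z ^ Suc d * l ^ d) * f (l *\<^sub>R z)) \<partial>lborel \<partial>lborel)"
    by (intro nn_integral_cong, subst nn_integral_cmult) (auto simp: inner simp del: scaleR_scaleR power_Suc split: split_indicator)
  also have "\<dots> = (\<integral>\<^sup>+l. \<integral>\<^sup>+z. indicator {1<..<2} (norm z) *
        (indicator {0<..} l * ennreal (norm z ^ Suc d * l ^ d) * f (l *\<^sub>R z)) \<partial>lborel \<partial>lborel)"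
    by (rule nn_integral_lborel_swap) measurable
  \<comment> \<open>For fixed \<open>l\<close> the dilation \<open>z\<close> to \<open>z / l\<close>
    frees \<open>f\<close> from \<open>l\<close>; what remains of \<open>l\<close> is exactly the
    weight of \<open>shell_weight\<close> at \<open>\<sigma> = norm z\<close>.\<close>
  also have "\<dots> = (\<integral>\<^sup>+l. \<integral>\<^sup>+z. indicator {0<..} l * indicator {1<..<2} (norm z / l) * ennreal (norm z ^ Suc d / l ^ Suc (Suc d)) * f z \<partial>lborel \<partial>lborel)"
  proof (rule nn_integral_cong)
    fix l :: real
    show "(\<integral>\<^sup>+z. indicator {1<..<2} (norm z) *
        (indicator {0<..} l * ennreal (norm z ^ Suc d * l ^ d) * f (l *\<^sub>R z)) \<partial>lborel)
      = (\<integral>\<^sup>+z. indicator {0<..} l * indicator {1<..<2} (norm z / l) * ennreal (norm z ^ Suc d / l ^ Suc (Suc d)) * f z \<partial>lborel)"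
    proof (cases "0 < l")
      case True
      have "(\<integral>\<^sup>+z. indicator {0<..} l * indicator {1<..<2} (norm z / l) * ennreal (norm z ^ Suc d / l ^ Suc (Suc d)) * f z \<partial>lborel)
         = ennreal (\<bar>l\<bar> ^ DIM('a)) * (\<integral>\<^sup>+z. indicator {0<..} l * indicator {1<..<2} (norm (0 + l *\<^sub>R z) / l) * ennreal (norm (0 + l *\<^sub>R z) ^ Suc d / l ^ Suc (Suc d)) * f (0 + l *\<^sub>R z) \<partial>lborel)"
        by (rule nn_integral_lborel_affine) (use True in auto)
      also have "\<dots> = (\<integral>\<^sup>+z. ennreal (\<bar>l\<bar> ^ DIM('a)) * (indicator {0<..} l * indicator {1<..<2} (norm (0 + l *\<^sub>R z) / l) * ennreal (norm (0 + l *\<^sub>R z) ^ Suc d / l ^ Suc (Suc d)) * f (0 + l *\<^sub>R z)) \<partial>lborel)"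
        by (rule nn_integral_cmult[symmetric]) measurable
      also have "\<dots> = (\<integral>\<^sup>+z. indicator {1<..<2} (norm z) *
        (indicator {0<..} l * ennreal (norm z ^ Suc d * l ^ d) * f (l *\<^sub>R z)) \<partial>lborel)"
      proof (rule nn_integral_cong)
        fix z :: 'a
        have "ennreal (l ^ Suc d) * ennreal ((l * norm z) ^ Suc d / l ^ Suc (Suc d)) = ennreal (l ^ Suc d * ((l * norm z) ^ Suc d / l ^ Suc (Suc d)))"
          using True by (intro ennreal_mult[symmetric]) auto
        also have "l ^ Suc d * ((l * norm z) ^ Suc d / l ^ Suc (Suc d)) = norm z ^ Suc d * l ^ d"
          using True by (simp add: power_mult_distrib divide_simps)
        finally have "ennreal (l ^ Suc d) * ennreal ((l * norm z) ^ Suc d / l ^ Suc (Suc d)) = ennreal (norm z ^ Suc d * l ^ d)" .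
        then show "ennreal (\<bar>l\<bar> ^ DIM('a)) * (indicator {0<..} l * indicator {1<..<2} (norm (0 + l *\<^sub>R z) / l) * ennreal (norm (0 + l *\<^sub>R z) ^ Suc d / l ^ Suc (Suc d)) * f (0 + l *\<^sub>R z))
          = indicator {1<..<2} (norm z) *
            (indicator {0<..} l * ennreal (norm z ^ Suc d * l ^ d) * f (l *\<^sub>R z))"
          using True unfolding Sd by (auto simp: indicator_def mult.assoc[symmetric] simp del: power_Suc)
      qed
      finally show ?thesis ..
    qed simp
  qed
  also have "\<dots> = (\<integral>\<^sup>+z. \<integral>\<^sup>+l. indicator {0<..} l * indicator {1<..<2} (norm z / l) * ennreal (norm z ^ Suc d / l ^ Suc (Suc d)) * f z \<partial>lborel \<partial>lborel)"
    by (rule nn_integral_lborel_swap) measurable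
  also have "\<dots> = (\<integral>\<^sup>+z. shell_const d * f z \<partial>lborel)"
  proof (rule nn_integral_cong_AE)
    have "AE z in lborel. z \<notin> {0::'a}"
      by (intro AE_not_in countable_imp_null_set_lborel) auto
    then show "AE z in lborel. (\<integral>\<^sup>+l. indicator {0<..} l * indicator {1<..<2} (norm z / l) * ennreal (norm z ^ Suc d / l ^ Suc (Suc d)) * f z \<partial>lborel) = shell_const d * f z"
    proof eventually_elim
      case (elim z)
      then show ?case using shell_weight[of "norm z" d] by (subst nn_integral_multc) auto
    qed
  qed
  also have "\<dots> = shell_const d * (\<integral>\<^sup>+z. f z \<partial>lborel)"
    by (rule nn_integral_cmult) measurable
  finally show ?thesis ..
qed

text \<open>
  The slab \<open>0 \<le> x \<bullet> w < 1\<close> meets every line of direction \<open>w\<close> in a set of length \<open>1\<close>; it replaces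
  integration over the hyperplane orthogonal to \<open>w\<close>.
\<close>

lemma nn_integral_along_lines:
  fixes g :: "'a::euclidean_space \<Rightarrow> ennreal"
  assumes g[measurable]: "g \<in> borel_measurable borel" and w: "norm w = 1"
  shows "(\<integral>\<^sup>+x. g x \<partial>lborel) =
    (\<integral>\<^sup>+x. indicator {0..<1} (x \<bullet> w) * (\<integral>\<^sup>+t. g (x + t *\<^sub>R w) \<partial>lborel) \<partial>lborel)"
proof -
  have ww: "w \<bullet> w = 1" using w by (simp add: dot_square_norm)
  have "(\<integral>\<^sup>+x. indicator {0..<1} (x \<bullet> w) * (\<integral>\<^sup>+t. g (x + t *\<^sub>R w) \<partial>lborel) \<partial>lborel)
     = (\<integral>\<^sup>+x. \<integral>\<^sup>+t. indicator {0..<1} (x \<bullet> w) * g (x + t *\<^sub>R w) \<partial>lborel \<partial>lborel)"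
    by (intro nn_integral_cong nn_integral_cmult[symmetric]) measurable
  also have "\<dots> = (\<integral>\<^sup>+t. \<integral>\<^sup>+x. indicator {0..<1} (x \<bullet> w) * g (x + t *\<^sub>R w) \<partial>lborel \<partial>lborel)"
    by (rule nn_integral_lborel_swap) measurable
  also have "\<dots> = (\<integral>\<^sup>+t. \<integral>\<^sup>+x. indicator {0..<1} (x \<bullet> w - t) * g x \<partial>lborel \<partial>lborel)"
  proof (rule nn_integral_cong)
    fix t :: real
    have "(\<integral>\<^sup>+x. indicator {0..<1} (x \<bullet> w - t) * g x \<partial>lborel)
      = (\<integral>\<^sup>+x. indicator {0..<1} ((t *\<^sub>R w + x) \<bullet> w - t) * g (t *\<^sub>R w + x) \<partial>lborel)"
      by (rule nn_integral_lborel_translate[symmetric]) measurable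
    then show "(\<integral>\<^sup>+x. indicator {0..<1} (x \<bullet> w) * g (x + t *\<^sub>R w) \<partial>lborel)
      = (\<integral>\<^sup>+x. indicator {0..<1} (x \<bullet> w - t) * g x \<partial>lborel)"
      by (simp add: inner_left_distrib ww add.commute)
  qed
  also have "\<dots> = (\<integral>\<^sup>+x. \<integral>\<^sup>+t. indicator {0..<1} (x \<bullet> w - t) * g x \<partial>lborel \<partial>lborel)"
    by (rule nn_integral_lborel_swap) measurable
  also have "\<dots> = (\<integral>\<^sup>+x. g x \<partial>lborel)"
  proof (rule nn_integral_cong)
    fix x :: 'a
    have "(\<lambda>t. indicator {0..<1} (x \<bullet> w - t)) = (indicator {x \<bullet> w - 1<..x \<bullet> w} :: real \<Rightarrow> ennreal)"
      by (auto simp: indicator_def fun_eq_iff)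
    then show "(\<integral>\<^sup>+t. indicator {0..<1} (x \<bullet> w - t) * g x \<partial>lborel) = g x"
      by (subst nn_integral_multc) auto
  qed
  finally show ?thesis ..
qed

text \<open>Polar coordinates give pairs \<open>(t + l, t)\<close> with \<open>l > 0\<close> only.
  Reflecting \<open>l\<close> and translating \<open>t\<close> identifies the other half with this
  one; here the factor 2 of the final constant arises.\<close>

lemma nn_integral_symmetric_half:
  fixes h :: "real \<Rightarrow> real \<Rightarrow> ennreal"
  assumes h[measurable]: "case_prod h \<in> borel_measurable (borel \<Otimes>\<^sub>M borel)"
    and sym: "\<And>x y. h x y = h y x"
  shows "(\<integral>\<^sup>+t. \<integral>\<^sup>+x. h x t \<partial>lborel \<partial>lborel)
     = 2 * (\<integral>\<^sup>+t. \<integral>\<^sup>+l. indicator {0<..} l * h (t + l) t \<partial>lborel \<partial>lborel)"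
proof -
  have "(\<integral>\<^sup>+t. \<integral>\<^sup>+x. h x t \<partial>lborel \<partial>lborel) = (\<integral>\<^sup>+t. \<integral>\<^sup>+l. h (t + l) t \<partial>lborel \<partial>lborel)"
    by (intro nn_integral_cong nn_integral_lborel_translate[symmetric]) measurable
  also have "\<dots> = (\<integral>\<^sup>+t. (\<integral>\<^sup>+l. indicator {0<..} l * h (t + l) t \<partial>lborel) + (\<integral>\<^sup>+l. indicator {..<0} l * h (t + l) t \<partial>lborel) \<partial>lborel)"
  proof (rule nn_integral_cong)
    fix t :: real
    have "(\<integral>\<^sup>+l. h (t + l) t \<partial>lborel) = (\<integral>\<^sup>+l. indicator {0<..} l * h (t + l) t + indicator {..<0} l * h (t + l) t \<partial>lborel)"
    proof (rule nn_integral_cong_AE)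
      have "AE z in lborel. z \<notin> {0::real}"
        by (intro AE_not_in countable_imp_null_set_lborel) auto
      then show "AE l in lborel. h (t + l) t = indicator {0<..} l * h (t + l) t + indicator {..<0} l * h (t + l) t"
        by eventually_elim (auto simp: indicator_def)
    qed
    also have "\<dots> = (\<integral>\<^sup>+l. indicator {0<..} l * h (t + l) t \<partial>lborel) + (\<integral>\<^sup>+l. indicator {..<0} l * h (t + l) t \<partial>lborel)"
      by (rule nn_integral_add) measurable
    finally show "(\<integral>\<^sup>+l. h (t + l) t \<partial>lborel) = \<dots>" .
  qed
  also have "\<dots> = (\<integral>\<^sup>+t. (\<integral>\<^sup>+l. indicator {0<..} l * h (t + l) t \<partial>lborel) \<partial>lborel) + (\<integral>\<^sup>+t. (\<integral>\<^sup>+l. indicator {..<0} l * h (t + l) t \<partial>lborel) \<partial>lborel)"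
    by (rule nn_integral_add) measurable
  also have "(\<integral>\<^sup>+t. \<integral>\<^sup>+l. indicator {..<0} l * h (t + l) t \<partial>lborel \<partial>lborel)
     = (\<integral>\<^sup>+t. \<integral>\<^sup>+l. indicator {0<..} l * h (t - l) t \<partial>lborel \<partial>lborel)"
  proof (rule nn_integral_cong)
    fix t :: real
    have "(\<integral>\<^sup>+l. indicator {..<0} l * h (t + l) t \<partial>lborel)
      = ennreal \<bar>-1\<bar> * (\<integral>\<^sup>+l. indicator {..<0} (0 + (-1) * l) * h (t + (0 + (-1) * l)) t \<partial>lborel)"
      by (rule nn_integral_real_affine) auto
    then show "(\<integral>\<^sup>+l. indicator {..<0} l * h (t + l) t \<partial>lborel) = (\<integral>\<^sup>+l. indicator {0<..} l * h (t - l) t \<partial>lborel)"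
      by (simp add: indicator_def)
  qed
  also have "\<dots> = (\<integral>\<^sup>+l. \<integral>\<^sup>+t. indicator {0<..} l * h (t - l) t \<partial>lborel \<partial>lborel)"
    by (rule nn_integral_lborel_swap) measurable
  also have "\<dots> = (\<integral>\<^sup>+l. \<integral>\<^sup>+t. indicator {0<..} l * h (t + l) t \<partial>lborel \<partial>lborel)"
  proof (rule nn_integral_cong)
    fix l :: real
    have "(\<integral>\<^sup>+t. indicator {0<..} l * h (t - l) t \<partial>lborel) = (\<integral>\<^sup>+t. indicator {0<..} l * h ((l + t) - l) (l + t) \<partial>lborel)"
      by (rule nn_integral_lborel_translate[symmetric]) measurable
    then show "(\<integral>\<^sup>+t. indicator {0<..} l * h (t - l) t \<partial>lborel) = (\<integral>\<^sup>+t. indicator {0<..} l * h (t + l) t \<partial>lborel)"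
      by (subst (2) sym) (simp add: add.commute)
  qed
  also have "\<dots> = (\<integral>\<^sup>+t. \<integral>\<^sup>+l. indicator {0<..} l * h (t + l) t \<partial>lborel \<partial>lborel)"
    by (rule nn_integral_lborel_swap) measurable
  finally show ?thesis by (simp add: mult_2)
qed

section \<open>Gagliardo energy and its disintegration over lines\<close>

text \<open>The regional double integral without its constant, written over \<open>lborel\<close>
  with indicators, so that translations, dilations and Fubini apply directly on Borel sets.\<close>

definition energy :: "real \<Rightarrow> 'a::euclidean_space set \<Rightarrow> ('a \<Rightarrow> real) \<Rightarrow> ennreal" where
  "energy s U f = (\<integral>\<^sup>+y. \<integral>\<^sup>+x. indicator U x * indicator U y *
     ennreal (\<bar>f x - f y\<bar>\<^sup>2 / norm (x - y) powr (real DIM('a) + 2 * s)) \<partial>lborel \<partial>lborel)"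

lemma nn_integral_lebesgue_on:
  assumes "\<Omega> \<in> sets lebesgue"
  shows "(\<integral>\<^sup>+x. f x \<partial>lebesgue_on \<Omega>) = (\<integral>\<^sup>+x. indicator \<Omega> x * f x \<partial>lborel)"
  using assms by (simp add: nn_integral_restrict_space nn_integral_completion mult.commute)

lemma gagliardo_sq_eq_energy:
  fixes \<Omega> :: "'a::euclidean_space set"
  assumes "\<Omega> \<in> sets lebesgue"
  shows "gagliardo_sq s \<Omega> f = ennreal (frac_const DIM('a) s / 2) * energy s \<Omega> f"
proof -
  have "(\<integral>\<^sup>+x. indicator \<Omega> x * indicator \<Omega> y * g x \<partial>lborel) = indicator \<Omega> y * (\<integral>\<^sup>+x. indicator \<Omega> x * g x \<partial>lborel)"
    for g :: "'a \<Rightarrow> ennreal" and y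
    by (cases "y \<in> \<Omega>") auto
  then show ?thesis
    unfolding gagliardo_sq_def energy_def by (simp add: nn_integral_lebesgue_on[OF assms])
qed

lemma energy_mono: "U \<subseteq> V \<Longrightarrow> energy s U f \<le> energy s V f"
  unfolding energy_def by (intro nn_integral_mono mult_right_mono mult_mono) (auto simp: indicator_def)

text \<open>\<open>H z\<close> collects the pairs of points with difference \<open>z\<close>. Polar
  coordinates in \<open>z\<close> fix a direction, and \<open>nn_integral_along_lines\<close> then
  splits the base point into a point of the slab and a position on its line.\<close>

lemma energy_along_lines:
  fixes f :: "'a::euclidean_space \<Rightarrow> real"
  assumes U[measurable]: "U \<in> sets borel" and f[measurable]: "f \<in> borel_measurable borel"
  defines "d \<equiv> DIM('a) - 1"
  shows "2 * (shell_const d * energy s U f) =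
    (\<integral>\<^sup>+z. indicator {1<..<2} (norm z) * (\<integral>\<^sup>+y. indicator {0..<1} (y \<bullet> (z /\<^sub>R norm z)) *
        energy s (line_section U y (z /\<^sub>R norm z)) (\<lambda>t. f (y + t *\<^sub>R (z /\<^sub>R norm z))) \<partial>lborel) \<partial>lborel)"
proof -
  have Sd: "DIM('a) = Suc d" by (simp add: d_def)
  define F where "F x y = indicator U x * indicator U y *
     ennreal (\<bar>f x - f y\<bar>\<^sup>2 / norm (x - y) powr (real DIM('a) + 2 * s))" for x y
  have F[measurable]: "case_prod F \<in> borel_measurable (borel \<Otimes>\<^sub>M borel)"
    unfolding F_def by measurable
  define H where "H z = (\<integral>\<^sup>+y. F (y + z) y \<partial>lborel)" for z
  have H[measurable]: "H \<in> borel_measurable borel"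
    unfolding H_def by measurable
  have "energy s U f = (\<integral>\<^sup>+y. \<integral>\<^sup>+z. F (y + z) y \<partial>lborel \<partial>lborel)"
    unfolding energy_def F_def[symmetric]
    by (intro nn_integral_cong nn_integral_lborel_translate[symmetric]) measurable
  also have "\<dots> = (\<integral>\<^sup>+z. H z \<partial>lborel)"
    unfolding H_def by (rule nn_integral_lborel_swap) measurable
  finally have eH: "energy s U f = (\<integral>\<^sup>+z. H z \<partial>lborel)" .
  have line: "2 * (\<integral>\<^sup>+l. indicator {0<..} l * ennreal (l ^ d) * H (l *\<^sub>R w) \<partial>lborel)
     = (\<integral>\<^sup>+y. indicator {0..<1} (y \<bullet> w) * energy s (line_section U y w) (\<lambda>t. f (y + t *\<^sub>R w)) \<partial>lborel)"
    if w: "norm w = 1" for w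
  proof -
    define h where "h y x t = indicator (line_section U y w) x * indicator (line_section U y w) t *
       ennreal (\<bar>f (y + x *\<^sub>R w) - f (y + t *\<^sub>R w)\<bar>\<^sup>2 / norm (x - t) powr (real DIM(real) + 2 * s))" for y x t
    have h_alt: "h y x t = indicator U (y + x *\<^sub>R w) * indicator U (y + t *\<^sub>R w) *
       ennreal (\<bar>f (y + x *\<^sub>R w) - f (y + t *\<^sub>R w)\<bar>\<^sup>2 / \<bar>x - t\<bar> powr (1 + 2 * s))" for y x t
      by (simp add: h_def line_section_def indicator_def)
    have hm[measurable (raw)]: "(\<lambda>p. h (g1 p) (g2 p) (g3 p)) \<in> borel_measurable N"
      if [measurable]: "g1 \<in> measurable N borel" "g2 \<in> measurable N borel" "g3 \<in> measurable N borel" for g1 g2 g3 and N :: "'n measure"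
      unfolding h_alt by measurable
    have hm2: "case_prod (h y) \<in> borel_measurable (borel \<Otimes>\<^sub>M borel)" for y
      unfolding h_alt by measurable
    \<comment> \<open>The Jacobian \<open>l ^ d\<close> cancels \<open>d\<close> of the
      \<open>Suc d + 2 s\<close> powers of \<open>l\<close> in the kernel and leaves the
      one-dimensional exponent \<open>1 + 2 s\<close>.\<close>
    have hF: "indicator {0<..} l * ennreal (l ^ d) * F (y + t *\<^sub>R w + l *\<^sub>R w) (y + t *\<^sub>R w)
       = indicator {0<..} l * h y (t + l) t" for y t l
    proof (cases "0 < l")
      case True
      have "l powr (real DIM('a) + 2 * s) = l ^ d * l powr (1 + 2 * s)"
        using True by (simp add: Sd powr_realpow[symmetric] powr_add[symmetric] add_ac)
      then have "ennreal (l ^ d) * ennreal (q / l powr (real DIM('a) + 2 * s)) = ennreal (q / l powr (1 + 2 * s))"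
        if "0 \<le> q" for q
        using True that by (simp add: ennreal_mult'[symmetric] del: ennreal_mult)
      then show ?thesis
        using True w by (simp add: F_def h_alt scaleR_left_distrib add.assoc split: split_indicator)
    qed simp
    have "(\<integral>\<^sup>+l. indicator {0<..} l * ennreal (l ^ d) * H (l *\<^sub>R w) \<partial>lborel)
       = (\<integral>\<^sup>+l. \<integral>\<^sup>+y. indicator {0<..} l * ennreal (l ^ d) * F (y + l *\<^sub>R w) y \<partial>lborel \<partial>lborel)"
      unfolding H_def by (intro nn_integral_cong nn_integral_cmult[symmetric]) measurable
    also have "\<dots> = (\<integral>\<^sup>+l. \<integral>\<^sup>+y. indicator {0..<1} (y \<bullet> w) * (\<integral>\<^sup>+t. indicator {0<..} l * h y (t + l) t \<partial>lborel) \<partial>lborel \<partial>lborel)"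
      unfolding hF[symmetric] by (intro nn_integral_cong nn_integral_along_lines w) measurable
    also have "\<dots> = (\<integral>\<^sup>+y. \<integral>\<^sup>+l. indicator {0..<1} (y \<bullet> w) * (\<integral>\<^sup>+t. indicator {0<..} l * h y (t + l) t \<partial>lborel) \<partial>lborel \<partial>lborel)"
      by (rule nn_integral_lborel_swap) measurable
    also have "\<dots> = (\<integral>\<^sup>+y. indicator {0..<1} (y \<bullet> w) * (\<integral>\<^sup>+t. \<integral>\<^sup>+l. indicator {0<..} l * h y (t + l) t \<partial>lborel \<partial>lborel) \<partial>lborel)"
    proof (rule nn_integral_cong)
      fix y
      have "(\<integral>\<^sup>+l. \<integral>\<^sup>+t. indicator {0<..} l * h y (t + l) t \<partial>lborel \<partial>lborel) = (\<integral>\<^sup>+t. \<integral>\<^sup>+l. indicator {0<..} l * h y (t + l) t \<partial>lborel \<partial>lborel)"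
        by (rule nn_integral_lborel_swap) measurable
      then show "(\<integral>\<^sup>+l. indicator {0..<1} (y \<bullet> w) * (\<integral>\<^sup>+t. indicator {0<..} l * h y (t + l) t \<partial>lborel) \<partial>lborel)
        = indicator {0..<1} (y \<bullet> w) * (\<integral>\<^sup>+t. \<integral>\<^sup>+l. indicator {0<..} l * h y (t + l) t \<partial>lborel \<partial>lborel)"
        by (subst nn_integral_cmult) auto
    qed
    also have "2 * \<dots> = (\<integral>\<^sup>+y. 2 * (indicator {0..<1} (y \<bullet> w) * (\<integral>\<^sup>+t. \<integral>\<^sup>+l. indicator {0<..} l * h y (t + l) t \<partial>lborel \<partial>lborel)) \<partial>lborel)"
      by (rule nn_integral_cmult[symmetric]) measurable
    also have "\<dots> = (\<integral>\<^sup>+y. indicator {0..<1} (y \<bullet> w) * energy s (line_section U y w) (\<lambda>t. f (y + t *\<^sub>R w)) \<partial>lborel)"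
    proof (rule nn_integral_cong)
      fix y
      have "(\<integral>\<^sup>+t. \<integral>\<^sup>+x. h y x t \<partial>lborel \<partial>lborel) = 2 * (\<integral>\<^sup>+t. \<integral>\<^sup>+l. indicator {0<..} l * h y (t + l) t \<partial>lborel \<partial>lborel)"
        by (rule nn_integral_symmetric_half[OF hm2]) (simp add: h_alt abs_minus_commute mult_ac)
      then show "2 * (indicator {0..<1} (y \<bullet> w) * (\<integral>\<^sup>+t. \<integral>\<^sup>+l. indicator {0<..} l * h y (t + l) t \<partial>lborel \<partial>lborel))
         = indicator {0..<1} (y \<bullet> w) * energy s (line_section U y w) (\<lambda>t. f (y + t *\<^sub>R w))"
        unfolding energy_def h_def[symmetric] by (simp add: mult.left_commute)
    qed
    finally show ?thesis .
  qed
  have "2 * (shell_const d * energy s U f)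
    = 2 * (\<integral>\<^sup>+z. indicator {1<..<2} (norm z) *
        (\<integral>\<^sup>+l. indicator {0<..} l * ennreal (l ^ d) * H (l *\<^sub>R (z /\<^sub>R norm z)) \<partial>lborel) \<partial>lborel)"
    unfolding eH d_def using nn_integral_polar_shell[OF H] by simp
  also have "\<dots> = (\<integral>\<^sup>+z. 2 * (indicator {1<..<2} (norm z) *
        (\<integral>\<^sup>+l. indicator {0<..} l * ennreal (l ^ d) * H (l *\<^sub>R (z /\<^sub>R norm z)) \<partial>lborel)) \<partial>lborel)"
    by (rule nn_integral_cmult[symmetric]) measurable
  also have "\<dots> = (\<integral>\<^sup>+z. indicator {1<..<2} (norm z) * (\<integral>\<^sup>+y. indicator {0..<1} (y \<bullet> (z /\<^sub>R norm z)) *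
        energy s (line_section U y (z /\<^sub>R norm z)) (\<lambda>t. f (y + t *\<^sub>R (z /\<^sub>R norm z))) \<partial>lborel) \<partial>lborel)"
  proof (rule nn_integral_cong)
    fix z :: 'a
    show "2 * (indicator {1<..<2} (norm z) *
        (\<integral>\<^sup>+l. indicator {0<..} l * ennreal (l ^ d) * H (l *\<^sub>R (z /\<^sub>R norm z)) \<partial>lborel))
      = indicator {1<..<2} (norm z) * (\<integral>\<^sup>+y. indicator {0..<1} (y \<bullet> (z /\<^sub>R norm z)) *
        energy s (line_section U y (z /\<^sub>R norm z)) (\<lambda>t. f (y + t *\<^sub>R (z /\<^sub>R norm z))) \<partial>lborel)"
    proof (cases "norm z \<in> {1<..<2}")
      case True
      then have "norm (z /\<^sub>R norm z) = 1" by (auto intro!: left_inverse)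
      from line[OF this] show ?thesis using True by simp
    qed simp
  qed
  finally show ?thesis .
qed

section \<open>Smooth functions and truncation\<close>

lemma k_times_cont_diff_SucI:
  fixes f :: "'a::euclidean_space \<Rightarrow> real"
  assumes "\<And>x. (f has_derivative D x) (at x)" "\<And>b. b \<in> Basis \<Longrightarrow> k_times_cont_diff k (\<lambda>x. D x b)"
  shows "k_times_cont_diff (Suc k) f"
proof -
  have "f differentiable_on UNIV"
    using assms(1) by (auto simp: differentiable_on_def differentiable_def)
  moreover have "frechet_derivative f (at x) = D x" for x
    using frechet_derivative_at[OF assms(1)] by simp
  ultimately show ?thesis using assms(2) by simp
qed

lemma k_times_cont_diff_SucD:
  fixes f :: "'a::euclidean_space \<Rightarrow> real"
  assumes "k_times_cont_diff (Suc k) f"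
  shows "(f has_derivative frechet_derivative f (at x)) (at x)"
    and "b \<in> Basis \<Longrightarrow> k_times_cont_diff k (\<lambda>x. frechet_derivative f (at x) b)"
  using assms by (auto simp: differentiable_on_def frechet_derivative_works[symmetric])

lemma k_times_cont_diff_pred: "k_times_cont_diff (Suc k) f \<Longrightarrow> k_times_cont_diff k f"
proof (induction k arbitrary: f)
  case 0
  then show ?case by (auto intro: differentiable_imp_continuous_on)
next
  case (Suc k)
  then show ?case by (auto simp del: k_times_cont_diff.simps(1))
qed

lemma k_times_cont_diff_continuous: "k_times_cont_diff k f \<Longrightarrow> continuous_on UNIV f"
  by (induction k) (auto dest: k_times_cont_diff_pred intro: differentiable_imp_continuous_on)

lemma k_times_cont_diff_const: "k_times_cont_diff k (\<lambda>x. c)"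
proof (induction k arbitrary: c)
  case (Suc k)
  show ?case by (rule k_times_cont_diff_SucI[where D="\<lambda>_ _. 0"]) (use Suc in auto)
qed simp

lemma k_times_cont_diff_add:
  "k_times_cont_diff k f \<Longrightarrow> k_times_cont_diff k g \<Longrightarrow> k_times_cont_diff k (\<lambda>x. f x + g x)"
proof (induction k arbitrary: f g)
  case 0 then show ?case by (auto intro: continuous_intros)
next
  case (Suc k)
  note f = k_times_cont_diff_SucD[OF Suc.prems(1)] and g = k_times_cont_diff_SucD[OF Suc.prems(2)]
  show ?case
    by (rule k_times_cont_diff_SucI[OF has_derivative_add[OF f(1) g(1)]]) (rule Suc.IH[OF f(2) g(2)])
qed

lemma k_times_cont_diff_mult:
  "k_times_cont_diff k f \<Longrightarrow> k_times_cont_diff k g \<Longrightarrow> k_times_cont_diff k (\<lambda>x. f x * g x)"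
proof (induction k arbitrary: f g)
  case 0 then show ?case by (auto intro: continuous_intros)
next
  case (Suc k)
  note f = k_times_cont_diff_SucD[OF Suc.prems(1)] and g = k_times_cont_diff_SucD[OF Suc.prems(2)]
  note pred = Suc.prems[THEN k_times_cont_diff_pred]
  show ?case
    by (rule k_times_cont_diff_SucI[OF has_derivative_mult[OF f(1) g(1)]])
       (rule k_times_cont_diff_add[OF Suc.IH[OF pred(1) g(2)] Suc.IH[OF f(2) pred(2)]])
qed

lemma k_times_cont_diff_sum:
  assumes "finite I" "\<And>i. i \<in> I \<Longrightarrow> k_times_cont_diff k (f i)"
  shows "k_times_cont_diff k (\<lambda>x. \<Sum>i\<in>I. f i x)"
  using assms
  by (induction I rule: finite_induct) (auto intro!: k_times_cont_diff_add simp: k_times_cont_diff_const)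

text \<open>The definition of smoothness knows only derivatives in basis directions; by linearity
  the derivative along \<open>w\<close> is a combination of them with coefficients
  \<open>w \<bullet> i\<close>, and the induction applies to each summand.\<close>

lemma k_times_cont_diff_line:
  fixes f :: "'a::euclidean_space \<Rightarrow> real"
  assumes "k_times_cont_diff k f"
  shows "k_times_cont_diff k (\<lambda>t::real. f (y + t *\<^sub>R w))"
  using assms
proof (induction k arbitrary: f)
  case 0
  then have "continuous_on UNIV f" by simp
  then have "continuous_on UNIV (\<lambda>t::real. f (y + t *\<^sub>R w))"
    by (rule continuous_on_compose2) (auto intro!: continuous_intros)
  then show ?case by simp
next
  case (Suc k)
  let ?D = "\<lambda>x. frechet_derivative f (at x)"
  show ?case
  proof (rule k_times_cont_diff_SucI)
    fix t :: real
    have "((\<lambda>t::real. y + t *\<^sub>R w) has_derivative (\<lambda>h. h *\<^sub>R w)) (at t)"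
      by (auto intro!: derivative_eq_intros)
    then show "((\<lambda>t::real. f (y + t *\<^sub>R w)) has_derivative (\<lambda>h. ?D (y + t *\<^sub>R w) (h *\<^sub>R w))) (at t)"
      by (rule has_derivative_compose) (rule k_times_cont_diff_SucD(1)[OF Suc.prems])
  next
    fix b :: real assume "b \<in> Basis"
    have "?D x (b *\<^sub>R w) = (\<Sum>i\<in>Basis. (b * (w \<bullet> i)) * ?D x i)" for x
    proof -
      have lin: "linear (?D x)"
        using k_times_cont_diff_SucD(1)[OF Suc.prems] by (rule has_derivative_linear)
      have "?D x (b *\<^sub>R w) = ?D x (\<Sum>i\<in>Basis. (b * (w \<bullet> i)) *\<^sub>R i)"
        by (subst euclidean_representation[of w, symmetric]) (simp add: scaleR_sum_right)
      also have "\<dots> = (\<Sum>i\<in>Basis. (b * (w \<bullet> i)) * ?D x i)"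
        by (simp add: linear_sum[OF lin] linear_scale[OF lin])
      finally show ?thesis .
    qed
    then show "k_times_cont_diff k (\<lambda>t. ?D (y + t *\<^sub>R w) (b *\<^sub>R w))"
      by (simp only:) (intro k_times_cont_diff_sum k_times_cont_diff_mult k_times_cont_diff_const Suc.IH
          k_times_cont_diff_SucD(2)[OF Suc.prems]; simp)
  qed
qed

lemma k_times_cont_diff_real_SucI:
  fixes f :: "real \<Rightarrow> real"
  assumes "\<And>x. (f has_real_derivative f' x) (at x)" "k_times_cont_diff k f'"
  shows "k_times_cont_diff (Suc k) f"
  by (rule k_times_cont_diff_SucI[where D="\<lambda>x h. f' x * h"])
     (use assms in \<open>auto simp: has_field_derivative_def\<close>)

lemma k_times_cont_diff_real_SucD:
  fixes f :: "real \<Rightarrow> real"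
  assumes "k_times_cont_diff (Suc k) f"
  shows "(f has_real_derivative deriv f x) (at x)" "k_times_cont_diff k (deriv f)"
proof -
  have D: "(f has_real_derivative frechet_derivative f (at x) 1) (at x)" for x
  proof -
    have d: "(f has_derivative frechet_derivative f (at x)) (at x)"
      by (rule k_times_cont_diff_SucD(1)[OF assms])
    have "frechet_derivative f (at x) h = frechet_derivative f (at x) 1 * h" for h
      using linear_scale[OF has_derivative_linear[OF d], of h 1] by simp
    then have "frechet_derivative f (at x) = (*) (frechet_derivative f (at x) 1)" by (rule ext)
    with d show ?thesis by (metis has_field_derivative_def)
  qed
  then have e: "deriv f x = frechet_derivative f (at x) 1" for x by (rule DERIV_imp_deriv)
  show "(f has_real_derivative deriv f x) (at x)" using D e by simp
  have "deriv f = (\<lambda>x. frechet_derivative f (at x) 1)" using e by (rule ext)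
  then show "k_times_cont_diff k (deriv f)" using k_times_cont_diff_SucD(2)[OF assms, of 1] by simp
qed

lemma k_times_cont_diff_compose:
  fixes g v :: "real \<Rightarrow> real"
  shows "k_times_cont_diff k g \<Longrightarrow> k_times_cont_diff k v \<Longrightarrow> k_times_cont_diff k (\<lambda>x. g (v x))"
proof (induction k arbitrary: g v)
  case 0
  then show ?case using continuous_on_compose2[of UNIV g UNIV v] by simp
next
  case (Suc k)
  show ?case
  proof (rule k_times_cont_diff_real_SucI)
    fix x show "((\<lambda>x. g (v x)) has_real_derivative deriv g (v x) * deriv v x) (at x)"
      by (rule DERIV_chain2[OF k_times_cont_diff_real_SucD(1)[OF Suc.prems(1)] k_times_cont_diff_real_SucD(1)[OF Suc.prems(2)]])
    have "k_times_cont_diff k (\<lambda>x. deriv g (v x))"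
      by (rule Suc.IH[OF k_times_cont_diff_real_SucD(2)[OF Suc.prems(1)] k_times_cont_diff_pred[OF Suc.prems(2)]])
    then show "k_times_cont_diff k (\<lambda>x. deriv g (v x) * deriv v x)"
      by (rule k_times_cont_diff_mult) (rule k_times_cont_diff_real_SucD(2)[OF Suc.prems(2)])
  qed
qed

text \<open>Agreement near \<open>x\<close> persists at all points near \<open>x\<close>, so the
  derivatives agree near \<open>x\<close> as well and the induction proceeds. This serves functions
  defined by cases on overlapping open sets.\<close>

lemma k_times_cont_diff_local:
  fixes f :: "real \<Rightarrow> real"
  assumes "\<And>x. \<exists>g. k_times_cont_diff k g \<and> (\<forall>\<^sub>F y in nhds x. f y = g y)"
  shows "k_times_cont_diff k f"
  using assms
proof (induction k arbitrary: f)
  case 0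
  have "isCont f x" for x
  proof -
    obtain g where g: "k_times_cont_diff 0 g" "\<forall>\<^sub>F y in nhds x. f y = g y" using 0 by blast
    then have "isCont g x" by (simp add: continuous_on_eq_continuous_at)
    then show ?thesis using isCont_cong[OF g(2)] by simp
  qed
  then show ?case by (simp add: continuous_at_imp_continuous_on)
next
  case (Suc k)
  have loc: "\<exists>g. k_times_cont_diff k g \<and> (\<forall>\<^sub>F y in nhds x. deriv f y = g y)" and
    der: "(f has_real_derivative deriv f x) (at x)" for x
  proof -
    obtain g where g: "k_times_cont_diff (Suc k) g" "\<forall>\<^sub>F y in nhds x. f y = g y" using Suc.prems by blast
    have "(f has_real_derivative deriv g x) (at x)"
      using DERIV_cong_ev[OF refl g(2) refl] k_times_cont_diff_real_SucD(1)[OF g(1)] by blast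
    then show "(f has_real_derivative deriv f x) (at x)" by (metis DERIV_imp_deriv)
    have "\<forall>\<^sub>F y in nhds x. \<forall>\<^sub>F z in nhds y. f z = g z"
      using g(2) by (simp add: eventually_eventually)
    then have "\<forall>\<^sub>F y in nhds x. deriv f y = deriv g y"
      by eventually_elim (rule deriv_cong_ev, auto)
    then show "\<exists>g. k_times_cont_diff k g \<and> (\<forall>\<^sub>F y in nhds x. deriv f y = g y)"
      using k_times_cont_diff_real_SucD(2)[OF g(1)] by blast
  qed
  show ?case by (rule k_times_cont_diff_real_SucI[OF der]) (rule Suc.IH[OF loc])
qed

section \<open>Functions flat at 0 and smooth truncation\<close>

lemma poly_mult_exp_minus_tendsto_0: "((\<lambda>x. poly p x * exp (- x)) \<longlongrightarrow> (0::real)) at_top"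
proof -
  have "((\<lambda>x. \<Sum>i\<le>degree p. coeff p i * (x ^ i / exp x)) \<longlongrightarrow> (\<Sum>i\<le>degree p. coeff p i * 0)) at_top"
    by (intro tendsto_intros tendsto_power_div_exp_0)
  then show ?thesis
    by (simp add: poly_altdef sum_distrib_right exp_minus divide_inverse mult.assoc)
qed

text \<open>A class closed under differentiation: with \<open>X = inverse y\<close> the derivative
  of \<open>p(X) exp(-X)\<close> is \<open>X^2 (p - p')(X) exp(-X)\<close>. Induction over all
  polynomials at once thus gives smoothness of every order.\<close>

definition flat :: "real poly \<Rightarrow> real \<Rightarrow> real" where
  "flat p y = (if 0 < y then poly p (inverse y) * exp (- inverse y) else 0)"

lemma flat_tendsto_0: "(flat p \<longlongrightarrow> 0) (at_right 0)"
proof -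
  have "((\<lambda>y. poly p (inverse y) * exp (- inverse y)) \<longlongrightarrow> (0::real)) (at_right 0)"
    by (rule filterlim_compose[OF poly_mult_exp_minus_tendsto_0 filterlim_inverse_at_top_right])
  then show ?thesis
    by (rule Lim_transform_eventually) (auto simp: flat_def eventually_at_right_less intro!: eventually_at_rightI[of 0 1])
qed

lemma DERIV_glue_at_0:
  fixes G G' :: "real \<Rightarrow> real"
  assumes G: "\<And>y. 0 < y \<Longrightarrow> (G has_real_derivative G' y) (at y)"
    and lim: "((\<lambda>y. G y / y) \<longlongrightarrow> 0) (at_right 0)"
  shows "((\<lambda>y. if 0 < y then G y else 0) has_real_derivative (if 0 < y then G' y else 0)) (at y)"
proof -
  consider "0 < y" | "y < 0" | "y = 0" by linarith
  then show ?thesis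
  proof cases
    case 1
    then have "\<forall>\<^sub>F x in nhds y. (if 0 < x then G x else 0) = G x"
      by (intro eventually_nhds_in_open[of "{0<..}", THEN eventually_mono]) auto
    then show ?thesis using DERIV_cong_ev[OF refl _ refl] G[OF 1] 1 by force
  next
    case 2
    then have "\<forall>\<^sub>F x in nhds y. (if 0 < x then G x else 0) = 0"
      by (intro eventually_nhds_in_open[of "{..<0}", THEN eventually_mono]) auto
    then show ?thesis using DERIV_cong_ev[OF refl _ refl, of _ "\<lambda>_. 0" y 0] 2 by force
  next
    case 3
    have "((\<lambda>h. (if 0 < h then G h else 0) / h) \<longlongrightarrow> 0) (at_right 0)"
      using lim by (rule Lim_transform_eventually) (auto intro!: eventually_at_rightI[of 0 1])
    moreover have "((\<lambda>h. (if 0 < h then G h else 0) / h) \<longlongrightarrow> 0) (at_left 0)"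
      by (rule tendsto_eventually) (auto intro!: eventually_at_leftI[of "-1" 0])
    ultimately have "((\<lambda>h. (if 0 < h then G h else 0) / h) \<longlongrightarrow> 0) (at 0)"
      by (simp add: filterlim_at_split)
    then show ?thesis using 3 by (simp add: DERIV_def cong: if_cong)
  qed
qed

lemma flat_DERIV: "(flat p has_real_derivative flat ([:0, 0, 1:] * (p - pderiv p)) y) (at y)"
proof -
  let ?G = "\<lambda>y. poly p (inverse y) * exp (- inverse y)"
  let ?q = "[:0, 0, 1:] * (p - pderiv p)"
  have "((\<lambda>y. if 0 < y then ?G y else 0) has_real_derivative
     (if 0 < y then poly ?q (inverse y) * exp (- inverse y) else 0)) (at y)"
  proof (rule DERIV_glue_at_0)
    fix y :: real assume "0 < y"
    have "(?G has_real_derivative (poly (pderiv p) (inverse y) * (- (inverse y ^ 2)) * exp (- inverse y)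
       + poly p (inverse y) * (exp (- inverse y) * (inverse y ^ 2)))) (at y)"
      using \<open>0 < y\<close> by (auto intro!: derivative_eq_intros DERIV_chain2[OF poly_DERIV] simp: power2_eq_square)
    also have "(poly (pderiv p) (inverse y) * (- (inverse y ^ 2)) * exp (- inverse y)
       + poly p (inverse y) * (exp (- inverse y) * (inverse y ^ 2))) = poly ?q (inverse y) * exp (- inverse y)"
      by (simp add: power2_eq_square algebra_simps)
    finally show "(?G has_real_derivative poly ?q (inverse y) * exp (- inverse y)) (at y)" .
  next
    show "((\<lambda>y. ?G y / y) \<longlongrightarrow> 0) (at_right 0)"
      \<comment> \<open>Division by \<open>y\<close> is multiplication of the polynomial by its
        variable, so the difference quotient at 0 is again of the form \<open>flat\<close>.\<close>
      using flat_tendsto_0[of "[:0,1:] * p"]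
      by (rule Lim_transform_eventually) (auto intro!: eventually_at_rightI[of 0 1] simp: flat_def divide_inverse mult_ac)
  qed
  then show ?thesis unfolding flat_def[abs_def] .
qed

lemma k_times_cont_diff_flat: "k_times_cont_diff k (flat p)"
proof (induction k arbitrary: p)
  case 0
  show ?case using flat_DERIV DERIV_isCont by (fastforce simp: continuous_on_eq_continuous_at)
next
  case (Suc k)
  show ?case by (rule k_times_cont_diff_real_SucI[OF flat_DERIV]) (rule Suc)
qed

text \<open>
  Since \<open>1 + x \<le> exp x\<close>, the derivative of \<open>y * exp (- 1 / y)\<close> lies between \<open>0\<close> and \<open>1\<close>.
\<close>

definition ramp :: "real \<Rightarrow> real" where
  "ramp y = (if 0 < y then y * exp (- inverse y) else 0)"

lemma ramp_DERIV: "(ramp has_real_derivative flat [:1, 1:] y) (at y)"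
proof -
  have "((\<lambda>y. if 0 < y then y * exp (- inverse y) else 0) has_real_derivative
     (if 0 < y then poly [:1, 1:] (inverse y) * exp (- inverse y) else 0)) (at y)"
  proof (rule DERIV_glue_at_0)
    fix y :: real assume "0 < y"
    have "((\<lambda>y. y * exp (- inverse y)) has_real_derivative exp (- inverse y) + y * (exp (- inverse y) * inverse y ^ 2)) (at y)"
      using \<open>0 < y\<close> by (auto intro!: derivative_eq_intros simp: power2_eq_square)
    also have "exp (- inverse y) + y * (exp (- inverse y) * inverse y ^ 2) = poly [:1, 1:] (inverse y) * exp (- inverse y)"
      using \<open>0 < y\<close> by (simp add: power2_eq_square algebra_simps)
    finally show "((\<lambda>y. y * exp (- inverse y)) has_real_derivative poly [:1, 1:] (inverse y) * exp (- inverse y)) (at y)" .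
  next
    show "((\<lambda>y::real. y * exp (- inverse y) / y) \<longlongrightarrow> 0) (at_right 0)"
      using flat_tendsto_0[of 1]
      by (rule Lim_transform_eventually) (auto intro!: eventually_at_rightI[of 0 1] simp: flat_def)
  qed
  then show ?thesis unfolding flat_def ramp_def[abs_def] .
qed

lemma flat_1_1_bounds: "0 \<le> flat [:1, 1:] y" "flat [:1, 1:] y \<le> 1"
proof -
  show "0 \<le> flat [:1, 1:] y" by (auto simp: flat_def)
  have "(1 + inverse y) * exp (- inverse y) \<le> exp (inverse y) * exp (- inverse y)"
    by (intro mult_right_mono exp_ge_add_one_self) auto
  also have "\<dots> = 1" by (simp add: exp_minus)
  finally show "flat [:1, 1:] y \<le> 1" by (simp add: flat_def)
qed

text \<open>
  A smooth function that vanishes on \<open>{-\<epsilon>..\<epsilon>}\<close> and is \<open>1\<close>-Lipschitz: composition with it turns a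
  smooth function vanishing at the end points of an interval into a test function on that interval,
  without increasing the energy.
\<close>

definition soft_threshold :: "real \<Rightarrow> real \<Rightarrow> real" where
  "soft_threshold \<epsilon> t = \<epsilon> * ramp ((t - \<epsilon>) / \<epsilon>) - \<epsilon> * ramp ((- t - \<epsilon>) / \<epsilon>)"

lemma k_times_cont_diff_ramp: "k_times_cont_diff k ramp"
proof (rule k_times_cont_diff_pred)
  show "k_times_cont_diff (Suc k) ramp"
    by (rule k_times_cont_diff_real_SucI[OF ramp_DERIV k_times_cont_diff_flat])
qed

lemma k_times_cont_diff_soft_threshold: "k_times_cont_diff k (soft_threshold \<epsilon>)"
proof -
  \<comment> \<open>The affine arguments are written as points of a line so that
    \<open>k_times_cont_diff_line\<close> covers the inner functions.\<close>
  have "k_times_cont_diff k (\<lambda>t. \<epsilon> * ramp (-1 + t *\<^sub>R (1 / \<epsilon>)) + (-\<epsilon>) * ramp (-1 + t *\<^sub>R (-1 / \<epsilon>)))"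
    if "\<epsilon> \<noteq> 0"
    by (intro k_times_cont_diff_add k_times_cont_diff_mult k_times_cont_diff_const k_times_cont_diff_line
        k_times_cont_diff_ramp)
  moreover have "soft_threshold \<epsilon> = (\<lambda>t. \<epsilon> * ramp (-1 + t *\<^sub>R (1 / \<epsilon>)) + (-\<epsilon>) * ramp (-1 + t *\<^sub>R (-1 / \<epsilon>)))"
    if "\<epsilon> \<noteq> 0"
  proof
    fix t
    have "(t - \<epsilon>) / \<epsilon> = -1 + t *\<^sub>R (1 / \<epsilon>)" "(- t - \<epsilon>) / \<epsilon> = -1 + t *\<^sub>R (-1 / \<epsilon>)"
      using that by (auto simp: divide_simps)
    then show "soft_threshold \<epsilon> t = \<epsilon> * ramp (-1 + t *\<^sub>R (1 / \<epsilon>)) + (-\<epsilon>) * ramp (-1 + t *\<^sub>R (-1 / \<epsilon>))"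
      by (simp only: soft_threshold_def)
  qed
  moreover have "soft_threshold 0 = (\<lambda>_. 0)" by (simp add: soft_threshold_def fun_eq_iff)
  ultimately show ?thesis by (cases "\<epsilon> = 0") (auto simp: k_times_cont_diff_const)
qed

lemma soft_threshold_eq_0: "0 < \<epsilon> \<Longrightarrow> \<bar>t\<bar> \<le> \<epsilon> \<Longrightarrow> soft_threshold \<epsilon> t = 0"
  by (auto simp: soft_threshold_def ramp_def divide_simps abs_le_iff)

lemma soft_threshold_lipschitz:
  assumes "0 < \<epsilon>"
  shows "\<bar>soft_threshold \<epsilon> x - soft_threshold \<epsilon> y\<bar> \<le> \<bar>x - y\<bar>"
proof -
  let ?D = "\<lambda>t. flat [:1, 1:] ((t - \<epsilon>) / \<epsilon>) + flat [:1, 1:] ((- t - \<epsilon>) / \<epsilon>)"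
  have "norm (soft_threshold \<epsilon> x - soft_threshold \<epsilon> y) \<le> 1 * norm (x - y)"
  proof (rule field_differentiable_bound[of UNIV _ ?D])
    fix t :: real
    have "(soft_threshold \<epsilon> has_real_derivative
       \<epsilon> * (flat [:1, 1:] ((t - \<epsilon>) / \<epsilon>) * (1 / \<epsilon>)) - \<epsilon> * (flat [:1, 1:] ((- t - \<epsilon>) / \<epsilon>) * (-1 / \<epsilon>))) (at t)"
      unfolding soft_threshold_def[abs_def] using assms
      by (intro DERIV_diff DERIV_cmult DERIV_chain2[OF ramp_DERIV]) (auto intro!: derivative_eq_intros)
    then show "(soft_threshold \<epsilon> has_field_derivative ?D t) (at t within UNIV)" using assms by simp
    \<comment> \<open>The two arguments sum to -2, so at most one ramp has nonzero slope and the
      slopes do not add up.\<close>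
    have "(t - \<epsilon>) / \<epsilon> \<le> 0 \<or> (- t - \<epsilon>) / \<epsilon> \<le> 0" using assms by (auto simp: divide_simps)
    then show "norm (?D t) \<le> 1"
      using flat_1_1_bounds[of "(t - \<epsilon>) / \<epsilon>"] flat_1_1_bounds[of "(- t - \<epsilon>) / \<epsilon>"]
      by (auto simp: flat_def)
  qed auto
  then show ?thesis by simp
qed

lemma soft_threshold_minus: "soft_threshold \<epsilon> (- t) = - soft_threshold \<epsilon> t"
  by (simp add: soft_threshold_def)

lemma soft_threshold_tendsto: "(\<lambda>n. soft_threshold (1 / real (Suc n)) t) \<longlonglongrightarrow> t"
proof -
  have pos: "(\<lambda>n. soft_threshold (1 / real (Suc n)) t) \<longlonglongrightarrow> t" if "0 < t" for t
  proof -
    have e0: "(\<lambda>n. 1 / real (Suc n)) \<longlonglongrightarrow> 0" by (rule LIMSEQ_Suc[OF lim_1_over_n])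
    \<comment> \<open>For \<open>0 < e < t\<close> only the positive ramp is active, and
      \<open>e * ramp ((t - e) / e)\<close> simplifies to \<open>?h e\<close>.\<close>
    let ?h = "\<lambda>e. (t - e) * exp (- (e / (t - e)))"
    have "(\<lambda>n. ?h (1 / real (Suc n))) \<longlonglongrightarrow> (t - 0) * exp (- (0 / (t - 0)))"
      by (intro tendsto_intros e0) (use that in auto)
    moreover have "\<forall>\<^sub>F n in sequentially. ?h (1 / real (Suc n)) = soft_threshold (1 / real (Suc n)) t"
      using order_tendstoD(2)[OF e0 that]
    proof eventually_elim
      case (elim n)
      define e where "e = 1 / real (Suc n)"
      have "0 < e" "e < t" using elim by (auto simp: e_def)
      then have "0 < (t - e) / e" "\<not> 0 < (- t - e) / e" "inverse ((t - e) / e) = e / (t - e)"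
        "e * ((t - e) / e) = t - e"
        by (auto simp: divide_simps)
      then show ?case
        unfolding e_def[symmetric] using \<open>0 < e\<close>
        by (simp add: soft_threshold_def ramp_def mult.assoc[symmetric])
    qed
    ultimately show ?thesis using Lim_transform_eventually by force
  qed
  consider "0 < t" | "0 < - t" | "t = 0" by linarith
  then show ?thesis
  proof cases
    case 2
    from tendsto_minus[OF pos[OF this]] show ?thesis by (simp add: soft_threshold_minus)
    next
    case 1 then show ?thesis by (rule pos)
  next
    case 3 then show ?thesis by (simp add: soft_threshold_eq_0)
  qed
qed

section \<open>The one-dimensional inequality on intervals\<close>

lemma test_functions_continuous:
  assumes "\<phi> \<in> test_functions \<Omega>"
  shows "continuous_on UNIV \<phi>" "\<phi> \<in> borel_measurable borel" "\<And>x. \<phi> x \<noteq> 0 \<Longrightarrow> x \<in> \<Omega>"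
proof -
  show "continuous_on UNIV \<phi>"
    using assms k_times_cont_diff_continuous by (auto simp: test_functions_def)
  then show "\<phi> \<in> borel_measurable borel" by (rule borel_measurable_continuous_onI)
  show "\<And>x. \<phi> x \<noteq> 0 \<Longrightarrow> x \<in> \<Omega>"
    using assms closure_subset by (fastforce simp: test_functions_def)
qed

lemma L2_norm_sq_eq:
  assumes "\<Omega> \<in> sets lebesgue"
  shows "L2_norm_sq \<Omega> u = (\<integral>\<^sup>+x. indicator \<Omega> x * ennreal ((u x)\<^sup>2) \<partial>lborel)"
  unfolding L2_norm_sq_def by (rule nn_integral_lebesgue_on[OF assms])

lemma L2_norm_sq_test_function_finite:
  assumes \<phi>: "\<phi> \<in> test_functions \<Omega>" and \<Omega>: "\<Omega> \<in> sets lebesgue"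
  shows "L2_norm_sq \<Omega> \<phi> < \<infinity>"
proof -
  define K where "K = closure {x. \<phi> x \<noteq> 0}"
  have K: "compact K" using \<phi> by (simp add: test_functions_def K_def)
  have "compact (\<phi> ` K)"
    using test_functions_continuous(1)[OF \<phi>] K by (meson compact_continuous_image continuous_on_subset subset_UNIV)
  then obtain B where B: "\<And>x. x \<in> K \<Longrightarrow> \<bar>\<phi> x\<bar> \<le> B"
    using compact_imp_bounded bounded_iff by (metis imageI real_norm_def)
  have "L2_norm_sq \<Omega> \<phi> \<le> (\<integral>\<^sup>+x. ennreal (B\<^sup>2) * indicator K x \<partial>lborel)"
    unfolding L2_norm_sq_eq[OF \<Omega>]
  proof (rule nn_integral_mono)
    fix x
    show "indicator \<Omega> x * ennreal ((\<phi> x)\<^sup>2) \<le> ennreal (B\<^sup>2) * indicator K x"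
    proof (cases "x \<in> K")
      case True
      then have "\<bar>\<phi> x\<bar>\<^sup>2 \<le> B\<^sup>2" using B[OF True] by (intro power_mono) auto
      then have "(\<phi> x)\<^sup>2 \<le> B\<^sup>2" by simp
      then have "ennreal ((\<phi> x)\<^sup>2) \<le> ennreal (B\<^sup>2)" by (rule ennreal_leI)
      then show ?thesis using True by (simp split: split_indicator)
    next
      case False
      then have "\<phi> x = 0" using closure_subset[of "{x. \<phi> x \<noteq> 0}"] by (auto simp: K_def)
      then show ?thesis by simp
    qed
  qed
  also have "\<dots> = ennreal (B\<^sup>2) * emeasure lborel K"
    using K by (simp add: nn_integral_cmult_indicator borel_compact)
  also have "\<dots> < \<infinity>"
    using emeasure_compact_finite[OF K] by (simp add: ennreal_mult_less_top)
  finally show ?thesis .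
qed

text \<open>A nonzero test function of finite energy lies in \<open>sobolev_0\<close> through the
  constant sequence. Infinite energy excludes membership, but then the inequality is
  trivial.\<close>

lemma poincare_test_function:
  assumes \<phi>: "\<phi> \<in> test_functions \<Omega>" and \<Omega>: "\<Omega> \<in> sets lebesgue"
  shows "poincare_const s \<Omega> * L2_norm_sq \<Omega> \<phi> \<le> gagliardo_sq s \<Omega> \<phi>"
proof (cases "gagliardo_sq s \<Omega> \<phi> = \<infinity> \<or> L2_norm_sq \<Omega> \<phi> = 0")
  case False
  have meas: "\<phi> \<in> borel_measurable (lebesgue_on \<Omega>)"
    using test_functions_continuous(2)[OF \<phi>] by (simp add: measurable_completion measurable_restrict_space1)
  have zero: "sobolev_norm_sq s \<Omega> (\<lambda>x. \<phi> x - \<phi> x) = 0"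
    by (simp add: sobolev_norm_sq_def L2_norm_sq_def gagliardo_sq_def)
  have fin: "L2_norm_sq \<Omega> \<phi> < \<infinity>" by (rule L2_norm_sq_test_function_finite[OF \<phi> \<Omega>])
  have "\<phi> \<in> sobolev_0 s \<Omega>"
    unfolding sobolev_0_def
  proof (intro CollectI conjI exI[of _ "\<lambda>_. \<phi>"] meas)
    show "sobolev_norm_sq s \<Omega> \<phi> < \<infinity>"
      using False fin by (simp add: sobolev_norm_sq_def less_top)
  qed (use \<phi> zero in auto)
  moreover have "\<not> (AE x in lebesgue_on \<Omega>. \<phi> x = 0)"
  proof
    assume "AE x in lebesgue_on \<Omega>. \<phi> x = 0"
    then have "L2_norm_sq \<Omega> \<phi> = (\<integral>\<^sup>+x. 0 \<partial>lebesgue_on \<Omega>)"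
      unfolding L2_norm_sq_def by (intro nn_integral_cong_AE) auto
    with False show False by simp
  qed
  ultimately have "poincare_const s \<Omega> \<le> gagliardo_sq s \<Omega> \<phi> / L2_norm_sq \<Omega> \<phi>"
    unfolding poincare_const_def by (intro INF_lower) auto
  then have "poincare_const s \<Omega> * L2_norm_sq \<Omega> \<phi> \<le> gagliardo_sq s \<Omega> \<phi> / L2_norm_sq \<Omega> \<phi> * L2_norm_sq \<Omega> \<phi>"
    by (rule mult_right_mono) simp
  also have "\<dots> = gagliardo_sq s \<Omega> \<phi>"
    using False fin by (simp add: ennreal_divide_times ennreal_divide_self)
  finally show ?thesis .
qed auto

text \<open>This is the last step after Fatou's lemma. \<open>P\<close> is an infimum that could be
  \<open>top\<close>, so dividing by it requires separating the degenerate values.\<close>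

lemma mult_le_of_le_liminf:
  fixes P L B :: ennreal
  assumes "L \<le> liminf X" "\<And>n. P * X n \<le> B"
  shows "P * L \<le> B"
proof -
  consider "P = 0" | "B = top" | "P = top" "B \<noteq> top" | "P \<noteq> 0" "P \<noteq> top" by blast
  then show ?thesis
  proof cases
    case 3
    then have "X n = 0" for n using assms(2)[of n] by (auto simp: ennreal_mult_eq_top_iff top_unique ennreal_top_mult split: if_splits)
    then have "X = (\<lambda>_. 0)" by (rule ext)
    then have "liminf X = 0" by (simp add: Liminf_const)
    then show ?thesis using assms(1) by simp
  next
    case 4
    have "X n \<le> B / P" for n
      using divide_right_mono_ennreal[OF assms(2)[of n], of P] 4
      by (simp add: mult.commute[of P] ennreal_mult_divide_eq less_top)
    then have "liminf X \<le> liminf (\<lambda>_::nat. B / P)" by (intro Liminf_mono always_eventually allI)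
    also have "\<dots> = B / P" by (simp add: Liminf_const)
    finally have "L \<le> B / P" using assms(1) by (rule order_trans[rotated])
    then have "P * L \<le> P * (B / P)" by (rule mult_left_mono) simp
    also have "\<dots> = B" using 4 by (simp add: ennreal_times_divide ennreal_mult_divide_eq less_top mult.commute[of P])
    finally show ?thesis .
  qed auto
qed

text \<open>The truncations of \<open>v\<close> are test functions on the open interval whose
  energies are at most that of \<open>v\<close>. Their \<open>L2\<close> norms are handled by
  Fatou's lemma, which needs only pointwise convergence.\<close>

lemma poincare_unit_interval:
  fixes v :: "real \<Rightarrow> real"
  assumes v: "\<And>k. k_times_cont_diff k v" and "v 0 = 0" "v 1 = 0"
  shows "poincare_const s {0<..<1::real} * (\<integral>\<^sup>+t. indicator {0<..<1} t * ennreal ((v t)\<^sup>2) \<partial>lborel)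
     \<le> ennreal (frac_const 1 s / 2) * energy s {0<..<1} v"
proof -
  have vc: "continuous_on UNIV v" using k_times_cont_diff_continuous[OF v] .
  have [measurable]: "v \<in> borel_measurable borel" using vc by (rule borel_measurable_continuous_onI)
  define u where "u n t = (if 0 < t \<and> t < 1 then soft_threshold (1 / real (Suc n)) (v t) else 0)" for n t
  have test: "u n \<in> test_functions {0<..<1}" for n
  proof -
    define e where "e = 1 / real (Suc n)"
    have e: "0 < e" by (simp add: e_def)
    define K where "K = {0..1} \<inter> {t. e \<le> \<bar>v t\<bar>}"
    have K: "compact K"
      unfolding K_def using vc
      by (intro compact_Int_closed closed_Collect_le continuous_intros) auto
    have sub: "{t. u n t \<noteq> 0} \<subseteq> K"
    proof
      fix t assume "t \<in> {t. u n t \<noteq> 0}"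
      then have t: "0 < t" "t < 1" "soft_threshold e (v t) \<noteq> 0"
        by (auto simp: u_def e_def split: if_splits)
      then have "e \<le> \<bar>v t\<bar>" using soft_threshold_eq_0[OF e, of "v t"] by linarith
      then show "t \<in> K" using t by (simp add: K_def)
    qed
    then have cl: "closure {t. u n t \<noteq> 0} \<subseteq> K" using K by (simp add: closure_minimal compact_imp_closed)
    have "K \<subseteq> {0<..<1}" using assms e by (auto simp: K_def less_le)
    moreover have "compact (closure {t. u n t \<noteq> 0})"
      using bounded_subset[OF compact_imp_bounded[OF K] sub] by (simp add: compact_closure)
    moreover have "k_times_cont_diff k (u n)" for k
    proof (rule k_times_cont_diff_local)
      fix x :: real
      \<comment> \<open>The line is covered by two open sets: on the unit interval
        \<open>u n\<close> is a composition of smooth functions, and off the compact set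
        \<open>K\<close> it vanishes. \<open>K\<close> avoids 0 and 1 because \<open>v\<close> is 0
        there.\<close>
      consider "0 < x \<and> x < 1" | "x \<notin> K" using \<open>K \<subseteq> {0<..<1}\<close> by (cases "x \<in> K") auto
      then show "\<exists>g. k_times_cont_diff k g \<and> (\<forall>\<^sub>F y in nhds x. u n y = g y)"
      proof cases
        case 1
        then have "\<forall>\<^sub>F y in nhds x. y \<in> {0<..<1}" by (intro eventually_nhds_in_open) auto
        then have "\<forall>\<^sub>F y in nhds x. u n y = soft_threshold e (v y)"
          by eventually_elim (auto simp: u_def e_def)
        moreover have "k_times_cont_diff k (\<lambda>y. soft_threshold e (v y))"
          by (rule k_times_cont_diff_compose[OF k_times_cont_diff_soft_threshold v])
        ultimately show ?thesis by blast
      next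
        case 2
        then have "\<forall>\<^sub>F y in nhds x. y \<in> - K"
          using K by (intro eventually_nhds_in_open) (auto simp: compact_imp_closed open_Compl)
        then have "\<forall>\<^sub>F y in nhds x. u n y = 0"
          by eventually_elim (use sub in auto)
        then show ?thesis using k_times_cont_diff_const[of k 0] by blast
      qed
    qed
    ultimately show ?thesis
      unfolding test_functions_def using order_trans[OF cl] by blast
  qed
  let ?X = "\<lambda>n. \<integral>\<^sup>+t. indicator {0<..<1} t * ennreal ((u n t)\<^sup>2) \<partial>lborel"
  have [measurable]: "u n \<in> borel_measurable borel" for n using test_functions_continuous(2)[OF test] .
  show ?thesis
  proof (rule mult_le_of_le_liminf)
    have "(\<integral>\<^sup>+t. indicator {0<..<1} t * ennreal ((v t)\<^sup>2) \<partial>lborel)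
       = (\<integral>\<^sup>+t. liminf (\<lambda>n. indicator {0<..<1} t * ennreal ((u n t)\<^sup>2)) \<partial>lborel)"
    proof (rule nn_integral_cong)
      fix t :: real
      have "(\<lambda>n. indicator {0<..<1} t * ennreal ((u n t)\<^sup>2)) \<longlonglongrightarrow> indicator {0<..<1} t * ennreal ((v t)\<^sup>2)"
      proof (cases "t \<in> {0<..<1}")
        case True
        then have "(\<lambda>n. u n t) \<longlonglongrightarrow> v t" using soft_threshold_tendsto[of "v t"] by (simp add: u_def)
        then have "(\<lambda>n. ennreal ((u n t)\<^sup>2)) \<longlonglongrightarrow> ennreal ((v t)\<^sup>2)" by (intro tendsto_ennrealI tendsto_power)
        then show ?thesis using True by simp
      qed simp
      from lim_imp_Liminf[OF _ this] show "indicator {0<..<1} t * ennreal ((v t)\<^sup>2) = liminf (\<lambda>n. indicator {0<..<1} t * ennreal ((u n t)\<^sup>2))"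
        by simp
    qed
    also have "\<dots> \<le> liminf ?X" by (rule nn_integral_liminf) measurable
    finally show "(\<integral>\<^sup>+t. indicator {0<..<1} t * ennreal ((v t)\<^sup>2) \<partial>lborel) \<le> liminf ?X" .
  next
    fix n
    have I: "{0<..<1::real} \<in> sets lebesgue" by simp
    have "poincare_const s {0<..<1::real} * ?X n \<le> ennreal (frac_const 1 s / 2) * energy s {0<..<1} (u n)"
      using poincare_test_function[OF test I, of s n] by (simp add: L2_norm_sq_eq[OF I] gagliardo_sq_eq_energy[OF I])
    also have "energy s {0<..<1} (u n) \<le> energy s {0<..<1} v"
      unfolding energy_def
    proof (intro nn_integral_mono)
      fix x y :: real
      show "indicator {0<..<1} x * indicator {0<..<1} y * ennreal (\<bar>u n x - u n y\<bar>\<^sup>2 / norm (x - y) powr (real DIM(real) + 2 * s))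
        \<le> indicator {0<..<1} x * indicator {0<..<1} y * ennreal (\<bar>v x - v y\<bar>\<^sup>2 / norm (x - y) powr (real DIM(real) + 2 * s))"
      proof (cases "x \<in> {0<..<1} \<and> y \<in> {0<..<1}")
        case True
        then have "\<bar>u n x - u n y\<bar> \<le> \<bar>v x - v y\<bar>"
          using soft_threshold_lipschitz[of "1 / real (Suc n)" "v x" "v y"] by (simp add: u_def)
        then show ?thesis
          by (intro mult_left_mono ennreal_leI divide_right_mono power_mono) auto
      qed auto
    qed
    finally show "poincare_const s {0<..<1::real} * ?X n \<le> ennreal (frac_const 1 s / 2) * energy s {0<..<1} v"
      by (simp add: mult_left_mono)
  qed
qed

section \<open>Scaling to intervals of arbitrary length\<close>

text \<open>With \<open>L = b - a\<close>, the two changes of variable contribute \<open>L^2\<close>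
  and the kernel \<open>L^(-1 - 2 s)\<close>; solved for the energy on the unit interval, the factor
  is \<open>L^(2 s - 1)\<close>.\<close>

lemma energy_affine:
  fixes v :: "real \<Rightarrow> real"
  assumes [measurable]: "v \<in> borel_measurable borel" and "a < b"
  shows "energy s {0<..<1} (\<lambda>t. v (a + (b - a) * t)) = ennreal ((b - a) powr (2 * s - 1)) * energy s {a<..<b} v"
proof -
  define L where "L = b - a"
  have L: "0 < L" using assms by (simp add: L_def)
  have bL: "b = a + L" by (simp add: L_def)
  define k where "k x y = indicator {a<..<b} x * indicator {a<..<b} y * ennreal (\<bar>v x - v y\<bar>\<^sup>2 / norm (x - y) powr (real DIM(real) + 2 * s))" for x y
  have [measurable]: "case_prod k \<in> borel_measurable (borel \<Otimes>\<^sub>M borel)" unfolding k_def by measurable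
  have "energy s {a<..<b} v = (\<integral>\<^sup>+y. \<integral>\<^sup>+x. k x y \<partial>lborel \<partial>lborel)"
    by (simp add: energy_def k_def)
  also have "\<dots> = (\<integral>\<^sup>+y. ennreal L * (\<integral>\<^sup>+x. k (a + L * x) y \<partial>lborel) \<partial>lborel)"
    using L by (intro nn_integral_cong, subst nn_integral_real_affine[of _ L a]) auto
  also have "\<dots> = ennreal L * (\<integral>\<^sup>+y. ennreal L * (\<integral>\<^sup>+x. k (a + L * x) (a + L * y) \<partial>lborel) \<partial>lborel)"
    using L by (subst nn_integral_real_affine[of _ L a]) auto
  also have "(\<integral>\<^sup>+y. ennreal L * (\<integral>\<^sup>+x. k (a + L * x) (a + L * y) \<partial>lborel) \<partial>lborel)
    = (\<integral>\<^sup>+y. \<integral>\<^sup>+x. ennreal L * k (a + L * x) (a + L * y) \<partial>lborel \<partial>lborel)"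
    by (intro nn_integral_cong nn_integral_cmult[symmetric]) measurable
  also have "ennreal (L powr (2 * s - 1)) * (ennreal L * \<dots>)
    = (\<integral>\<^sup>+y. \<integral>\<^sup>+x. ennreal (L powr (2 * s)) * (ennreal L * k (a + L * x) (a + L * y)) \<partial>lborel \<partial>lborel)"
  proof -
    have "ennreal (L powr (2 * s - 1)) * (ennreal L * Q) = ennreal (L powr (2 * s)) * Q" for Q
      using L by (simp add: mult.assoc[symmetric] ennreal_mult'[symmetric] powr_diff)
    then show ?thesis by (simp add: nn_integral_cmult)
  qed
  also have "\<dots> = energy s {0<..<1} (\<lambda>t. v (a + (b - a) * t))"
    unfolding energy_def
  proof (intro nn_integral_cong)
    fix x y :: real
    have i: "indicator {a<..<b} (a + L * x) = (indicator {0<..<1} x :: ennreal)" for x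
    proof -
      have "a + L * x < b \<longleftrightarrow> L * x < L * 1" by (subst bL) simp
      also have "\<dots> \<longleftrightarrow> x < 1" using L by (simp only: mult_less_cancel_left_pos)
      finally show ?thesis using L by (simp add: indicator_def zero_less_mult_iff)
    qed
    have n: "norm (a + L * x - (a + L * y)) = L * norm (x - y)"
      using L by (simp add: right_diff_distrib[symmetric] abs_mult)
    have "ennreal (L powr (2 * s)) * (ennreal L * ennreal (q / (L * norm (x - y)) powr (real DIM(real) + 2 * s)))
       = ennreal (q / norm (x - y) powr (real DIM(real) + 2 * s))" if "0 \<le> q" for q
    proof -
      have "(L * norm (x - y)) powr (real DIM(real) + 2 * s) = L powr (2 * s) * L * norm (x - y) powr (real DIM(real) + 2 * s)"
        using L by (simp add: powr_mult powr_add mult_ac)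
      then show ?thesis using L that by (simp add: ennreal_mult'[symmetric])
    qed
    then show "ennreal (L powr (2 * s)) * (ennreal L * k (a + L * x) (a + L * y)) =
       indicator {0<..<1} x * indicator {0<..<1} y * ennreal (\<bar>v (a + (b - a) * x) - v (a + (b - a) * y)\<bar>\<^sup>2 / norm (x - y) powr (real DIM(real) + 2 * s))"
      unfolding k_def i n L_def[symmetric] by (simp split: split_indicator)
  qed
  finally show ?thesis by (simp add: L_def)
qed

text \<open>The squared \<open>L2\<close> norm scales by \<open>L\<close> and the energy by
  \<open>L^(1 - 2 s)\<close>, so the quotient scales by \<open>L^(- 2 s)\<close>, which is at least
  \<open>M^(- 2 s)\<close>. This is the origin of the power of \<open>m\<close> in the
  theorem.\<close>

lemma poincare_interval:
  fixes v :: "real \<Rightarrow> real"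
  assumes v: "\<And>k. k_times_cont_diff k v" and "v a = 0" "v b = 0" and "a < b" "b - a \<le> M" "0 < s"
  shows "poincare_const s {0<..<1::real} * ennreal (M powr (- 2 * s)) * (\<integral>\<^sup>+t. indicator {a<..<b} t * ennreal ((v t)\<^sup>2) \<partial>lborel)
     \<le> ennreal (frac_const 1 s / 2) * energy s {a<..<b} v"
proof -
  define L where "L = b - a"
  have L: "0 < L" "L \<le> M" using assms by (auto simp: L_def)
  have bL: "b = a + L" by (simp add: L_def)
  let ?P = "poincare_const s {0<..<1::real}" and ?C = "ennreal (frac_const 1 s / 2)"
  let ?I = "\<integral>\<^sup>+t. indicator {a<..<b} t * ennreal ((v t)\<^sup>2) \<partial>lborel"
  have [measurable]: "v \<in> borel_measurable borel"
    using k_times_cont_diff_continuous[OF v] by (rule borel_measurable_continuous_onI)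
  have "k_times_cont_diff k (\<lambda>t. v (a + (b - a) * t))" for k
    using k_times_cont_diff_line[OF v, of k a "b - a"] by (simp add: mult.commute)
  then have "?P * (\<integral>\<^sup>+t. indicator {0<..<1} t * ennreal ((v (a + (b - a) * t))\<^sup>2) \<partial>lborel)
     \<le> ?C * energy s {0<..<1} (\<lambda>t. v (a + (b - a) * t))"
    using assms by (intro poincare_unit_interval) auto
  also have "\<dots> = ennreal (L powr (2 * s - 1)) * (?C * energy s {a<..<b} v)"
    using \<open>a < b\<close> by (subst energy_affine) (auto simp: L_def mult_ac)
  finally have main: "?P * (\<integral>\<^sup>+t. indicator {0<..<1} t * ennreal ((v (a + (b - a) * t))\<^sup>2) \<partial>lborel)
     \<le> ennreal (L powr (2 * s - 1)) * (?C * energy s {a<..<b} v)" .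
  have i: "indicator {a<..<b} (a + L * x) = (indicator {0<..<1} x :: ennreal)" for x
  proof -
    have "a + L * x < b \<longleftrightarrow> L * x < L * 1" by (subst bL) simp
    also have "\<dots> \<longleftrightarrow> x < 1" using L by (simp only: mult_less_cancel_left_pos)
    finally show ?thesis using L by (simp add: indicator_def zero_less_mult_iff)
  qed
  have "?I = ennreal L * (\<integral>\<^sup>+t. indicator {0<..<1} t * ennreal ((v (a + (b - a) * t))\<^sup>2) \<partial>lborel)"
    using L by (subst nn_integral_real_affine[of _ L a]) (auto simp: i L_def[symmetric])
  then have "?P * ennreal (M powr (- 2 * s)) * ?I \<le> ennreal (M powr (- 2 * s)) * ennreal L * (?P * (\<integral>\<^sup>+t. indicator {0<..<1} t * ennreal ((v (a + (b - a) * t))\<^sup>2) \<partial>lborel))"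
    by (simp add: mult_ac)
  also have "\<dots> \<le> ennreal (M powr (- 2 * s)) * ennreal L * (ennreal (L powr (2 * s - 1)) * (?C * energy s {a<..<b} v))"
    using main by (rule mult_left_mono) simp
  also have "\<dots> = ennreal (M powr (- 2 * s) * L powr (2 * s)) * (?C * energy s {a<..<b} v)"
    using L by (simp add: mult.assoc[symmetric] ennreal_mult'[symmetric] powr_diff)
  also have "\<dots> \<le> 1 * (?C * energy s {a<..<b} v)"
  proof (rule mult_right_mono)
    have "L powr (2 * s) \<le> M powr (2 * s)" using L \<open>0 < s\<close> by (intro powr_mono2) auto
    then have "M powr (- 2 * s) * L powr (2 * s) \<le> 1"
      using L by (simp add: powr_minus field_simps)
    then show "ennreal (M powr (- 2 * s) * L powr (2 * s)) \<le> 1" by simp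
  qed simp
  finally show ?thesis by simp
qed

section \<open>Slicing of test functions\<close>

text \<open>Padding with the empty set allows finitely many components to be summed as a series
  too.\<close>

lemma disjoint_family_enumeration:
  assumes "countable \<C>" "pairwise disjnt \<C>"
  obtains c :: "nat \<Rightarrow> 'b set" where "disjoint_family c" "\<And>i. c i \<in> insert {} \<C>" "(\<Union>i. c i) = \<Union>\<C>"
proof -
  define c where "c i = (if i \<in> to_nat_on \<C> ` \<C> then from_nat_into \<C> i else {})" for i
  have inv: "c (to_nat_on \<C> X) = X" if "X \<in> \<C>" for X
    using that assms by (simp add: c_def)
  have cases: "c i = {} \<or> (\<exists>X\<in>\<C>. i = to_nat_on \<C> X \<and> c i = X)" for i
    using inv by (auto simp: c_def)
  show thesis
  proof (rule that)
    show "\<And>i. c i \<in> insert {} \<C>" using cases by blast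
    show "(\<Union>i. c i) = \<Union>\<C>" using cases inv by blast
    show "disjoint_family c"
      unfolding disjoint_family_on_def
    proof (intro ballI impI)
      fix i j :: nat assume "i \<noteq> j"
      then show "c i \<inter> c j = {}"
        using cases[of i] cases[of j] assms(2) unfolding pairwise_def disjnt_def
        by (metis Int_empty_left Int_empty_right)
    qed
  qed
qed

text \<open>A component contains every closed segment between its points, so \<open>short\<close>
  bounds it. An end point belonging to \<open>A\<close> could be adjoined without losing
  connectedness, against maximality of the component; hence a function whose nonvanishing set is
  \<open>A\<close> is 0 there.\<close>

lemma bounded_component_is_interval:
  fixes A :: "real set"
  assumes A: "open A" and short: "\<And>a b. a \<le> b \<Longrightarrow> {a..b} \<subseteq> A \<Longrightarrow> b - a \<le> M" and c: "c \<in> components A"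
  obtains a b where "c = {a<..<b}" "a < b" "b - a \<le> M" "a \<notin> A" "b \<notin> A"
proof -
  have op: "open c" using A c by (rule open_components)
  have ne: "c \<noteq> {}" using c by (rule in_components_nonempty)
  have sub: "c \<subseteq> A" using c by (rule in_components_subset)
  have con: "connected c" using c by (rule in_components_connected)
  have seg: "{x..y} \<subseteq> c" if "x \<in> c" "y \<in> c" for x y
    using con that by (metis connected_contains_Icc)
  have dist: "y - x \<le> M" if "x \<in> c" "y \<in> c" "x \<le> y" for x y
    using short[of x y] seg[of x y] sub that by auto
  obtain p where p: "p \<in> c" using ne by blast
  have bds: "p - \<bar>M\<bar> \<le> x" "x \<le> p + \<bar>M\<bar>" if "x \<in> c" for x
    using dist[OF that p] dist[OF p that] by linarith+
  have bb: "bdd_below c" "bdd_above c" using bds by (auto simp: bdd_below_def bdd_above_def)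
  define a where "a = Inf c"
  define b where "b = Sup c"
  have ball: "\<exists>e>0. \<forall>y. \<bar>y - x\<bar> < e \<longrightarrow> y \<in> c" if "x \<in> c" for x
    using op that by (auto simp: open_dist dist_real_def)
  have in1: "a < x \<and> x < b" if "x \<in> c" for x
  proof -
    obtain e where e: "e > 0" "\<And>y. \<bar>y - x\<bar> < e \<Longrightarrow> y \<in> c" using ball[OF \<open>x \<in> c\<close>] by blast
    have "x - e/2 \<in> c" "x + e/2 \<in> c" using e by auto
    then have "a \<le> x - e/2" "x + e/2 \<le> b" using bb by (auto simp: a_def b_def cInf_lower cSup_upper)
    then show ?thesis using e by linarith
  qed
  have in2: "x \<in> c" if "a < x" "x < b" for x
  proof -
    obtain y where "y \<in> c" "y < x"
      using \<open>a < x\<close> cInf_less_iff[OF ne bb(1), of x] unfolding a_def by blast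
    moreover obtain z where "z \<in> c" "x < z"
      using \<open>x < b\<close> less_cSup_iff[OF ne bb(2), of x] unfolding b_def by blast
    ultimately show ?thesis using seg[of y z] by auto
  qed
  have ceq: "c = {a<..<b}" using in1 in2 by auto
  have ab: "a < b" using in1[OF p] by linarith
  have "b - a \<le> M"
  proof (rule field_le_epsilon)
    fix e :: real assume "0 < e"
    \<comment> \<open>The hypothesis speaks of closed intervals, so the open one is shrunk by
      \<open>h\<close> at each end; a quarter of its length keeps the new end points in order, and
      \<open>e / 2\<close> keeps the total loss below \<open>e\<close>.\<close>
    define h where "h = min (e/2) ((b - a)/4)"
    have h: "0 < h" "h \<le> e/2" "h \<le> (b-a)/4"
      using \<open>0 < e\<close> ab by (auto simp: h_def min_def field_simps)
    have "a < a + h \<and> a + h < b \<and> a < b - h \<and> b - h < b \<and> a + h \<le> b - h"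
      using h ab by argo
    then have "(b - h) - (a + h) \<le> M" by (intro dist in2) auto
    then show "b - a \<le> M + e" using h by linarith
  qed
  moreover have "a \<notin> A"
  proof
    assume "a \<in> A"
    then have "{a..<b} \<subseteq> A" using ceq sub by (auto simp: less_le)
    moreover have "connected {a..<b}" by simp
    moreover have "c \<inter> {a..<b} \<noteq> {}" using ceq ab p by auto
    ultimately have "{a..<b} \<subseteq> c" using c components_maximal by blast
    then show False using ceq ab by auto
  qed
  moreover have "b \<notin> A"
  proof
    assume "b \<in> A"
    then have "{a<..b} \<subseteq> A" using ceq sub by (auto simp: less_le)
    moreover have "connected {a<..b}" by simp
    moreover have "c \<inter> {a<..b} \<noteq> {}" using ceq ab p by auto
    ultimately have "{a<..b} \<subseteq> c" using c components_maximal by blast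
    then show False using ceq ab by auto
  qed
  ultimately show thesis using that ceq ab by blast
qed

lemma energy_Union_ge:
  fixes c :: "nat \<Rightarrow> 'a::euclidean_space set"
  assumes dis: "disjoint_family c" and c[measurable]: "\<And>i. c i \<in> sets borel" and f[measurable]: "f \<in> borel_measurable borel"
  shows "(\<Sum>i. energy s (c i) f) \<le> energy s (\<Union>i. c i) f"
proof -
  let ?A = "\<Union>i. c i"
  define k where "k x y = ennreal (\<bar>f x - f y\<bar>\<^sup>2 / norm (x - y) powr (real DIM('a) + 2 * s))" for x y
  have [measurable]: "case_prod k \<in> borel_measurable (borel \<Otimes>\<^sub>M borel)" unfolding k_def by measurable
  have "(\<Sum>i. energy s (c i) f) = (\<Sum>i. \<integral>\<^sup>+y. \<integral>\<^sup>+x. indicator (c i) x * indicator (c i) y * k x y \<partial>lborel \<partial>lborel)"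
    by (simp add: energy_def k_def)
  also have "\<dots> = (\<integral>\<^sup>+y. (\<Sum>i. \<integral>\<^sup>+x. indicator (c i) x * indicator (c i) y * k x y \<partial>lborel) \<partial>lborel)"
    by (rule nn_integral_suminf[symmetric]) measurable
  also have "\<dots> \<le> (\<integral>\<^sup>+y. \<integral>\<^sup>+x. indicator ?A x * indicator ?A y * k x y \<partial>lborel \<partial>lborel)"
  proof (rule nn_integral_mono)
    fix y
    \<comment> \<open>For \<open>y\<close> in \<open>c i\<close> the partner \<open>x\<close> may
      range over the whole union, which adds nonnegative interactions. By disjointness the
      indicators at \<open>y\<close> then sum to that of the union.\<close>
    have "(\<Sum>i. \<integral>\<^sup>+x. indicator (c i) x * indicator (c i) y * k x y \<partial>lborel)
      \<le> (\<Sum>i. indicator (c i) y * (\<integral>\<^sup>+x. indicator ?A x * k x y \<partial>lborel))"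
    proof (rule suminf_le)
      fix i
      show "(\<integral>\<^sup>+x. indicator (c i) x * indicator (c i) y * k x y \<partial>lborel)
         \<le> indicator (c i) y * (\<integral>\<^sup>+x. indicator ?A x * k x y \<partial>lborel)"
        by (cases "y \<in> c i") (auto intro!: nn_integral_mono split: split_indicator)
    qed auto
    also have "\<dots> = (\<Sum>i. indicator (c i) y) * (\<integral>\<^sup>+x. indicator ?A x * k x y \<partial>lborel)"
      by (rule ennreal_suminf_multc)
    also have "\<dots> = (\<integral>\<^sup>+x. indicator ?A x * indicator ?A y * k x y \<partial>lborel)"
      unfolding suminf_indicator[OF dis] by (cases "y \<in> ?A") auto
    finally show "(\<Sum>i. \<integral>\<^sup>+x. indicator (c i) x * indicator (c i) y * k x y \<partial>lborel) \<le> \<dots>" .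
  qed
  finally show ?thesis by (simp add: energy_def k_def)
qed

lemma poincare_open_line:
  fixes v :: "real \<Rightarrow> real"
  assumes v: "\<And>k. k_times_cont_diff k v" and "0 < s"
    and short: "\<And>a b. a \<le> b \<Longrightarrow> {a..b} \<subseteq> {t. v t \<noteq> 0} \<Longrightarrow> b - a \<le> M"
  shows "poincare_const s {0<..<1::real} * ennreal (M powr (- 2 * s)) * (\<integral>\<^sup>+t. ennreal ((v t)\<^sup>2) \<partial>lborel)
     \<le> ennreal (frac_const 1 s / 2) * energy s {t. v t \<noteq> 0} v"
proof -
  let ?A = "{t. v t \<noteq> 0}"
  let ?P = "poincare_const s {0<..<1::real} * ennreal (M powr (- 2 * s))"
  have vc: "continuous_on UNIV v" using k_times_cont_diff_continuous[OF v] .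
  have [measurable]: "v \<in> borel_measurable borel" using vc by (rule borel_measurable_continuous_onI)
  have A: "open ?A" using vc by (intro open_Collect_neq continuous_intros)
  have "countable (components ?A)"
    using A by (intro countable_disjoint_open_subsets open_components[OF A])
      (auto simp: pairwise_def disjnt_def dest: pairwiseD[OF pairwise_disjoint_components])
  moreover have "pairwise disjnt (components ?A)"
    using pairwise_disjoint_components by (auto simp: pairwise_def disjnt_def)
  ultimately obtain c :: "nat \<Rightarrow> real set" where dis: "disjoint_family c"
    and cin: "\<And>i. c i \<in> insert {} (components ?A)" and un: "(\<Union>i. c i) = \<Union>(components ?A)"
    by (rule disjoint_family_enumeration) blast
  have un': "(\<Union>i. c i) = ?A" using un by simp
  have cm[measurable]: "c i \<in> sets borel" for i
    using cin[of i] open_components[OF A] by auto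
  have step: "?P * (\<integral>\<^sup>+t. indicator (c i) t * ennreal ((v t)\<^sup>2) \<partial>lborel)
     \<le> ennreal (frac_const 1 s / 2) * energy s (c i) v" for i
  proof (cases "c i = {}")
    case False
    then have "c i \<in> components ?A" using cin[of i] by simp
    with A short obtain a b where ab: "c i = {a<..<b}" "a < b" "b - a \<le> M" "a \<notin> ?A" "b \<notin> ?A"
      by (rule bounded_component_is_interval)
    show ?thesis unfolding ab(1)
      by (rule poincare_interval) (use ab v \<open>0 < s\<close> in auto)
  qed simp
  have "(\<integral>\<^sup>+t. ennreal ((v t)\<^sup>2) \<partial>lborel) = (\<integral>\<^sup>+t. (\<Sum>i. indicator (c i) t * ennreal ((v t)\<^sup>2)) \<partial>lborel)"
  proof (rule nn_integral_cong)
    fix t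
    have "(\<Sum>i. indicator (c i) t * ennreal ((v t)\<^sup>2)) = (\<Sum>i. indicator (c i) t) * ennreal ((v t)\<^sup>2)"
      by (rule ennreal_suminf_multc)
    also have "\<dots> = ennreal ((v t)\<^sup>2)"
      unfolding suminf_indicator[OF dis] un' by (simp split: split_indicator)
    finally show "ennreal ((v t)\<^sup>2) = (\<Sum>i. indicator (c i) t * ennreal ((v t)\<^sup>2))" ..
  qed
  also have "\<dots> = (\<Sum>i. \<integral>\<^sup>+t. indicator (c i) t * ennreal ((v t)\<^sup>2) \<partial>lborel)"
    by (rule nn_integral_suminf) measurable
  also have "?P * \<dots> = (\<Sum>i. ?P * (\<integral>\<^sup>+t. indicator (c i) t * ennreal ((v t)\<^sup>2) \<partial>lborel))"
    by (rule ennreal_suminf_cmult[symmetric])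
  also have "\<dots> \<le> (\<Sum>i. ennreal (frac_const 1 s / 2) * energy s (c i) v)"
    by (intro suminf_le step) auto
  also have "\<dots> = ennreal (frac_const 1 s / 2) * (\<Sum>i. energy s (c i) v)"
    by (rule ennreal_suminf_cmult)
  also have "\<dots> \<le> ennreal (frac_const 1 s / 2) * energy s ?A v"
    using energy_Union_ge[OF dis, of v s] by (intro mult_left_mono) (simp_all add: un')
  finally show ?thesis .
qed

text \<open>
  The given set of directions need not be measurable, but it is contained in this closed set
  when \<open>U\<close> is the open set where a test function does not vanish.
\<close>

definition short_directions :: "'a::euclidean_space set \<Rightarrow> real \<Rightarrow> 'a set" where
  "short_directions U M =
     {w \<in> sphere 0 1. \<forall>x a b. a \<le> b \<longrightarrow> {a..b} \<subseteq> line_section U x w \<longrightarrow> b - a \<le> M}"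

text \<open>For fixed \<open>x\<close>, \<open>a\<close>, \<open>b\<close> the directions whose
  segment leaves \<open>U\<close> are the projection of a closed set along the compact factor
  \<open>{a..b}\<close>, hence closed. The set in question is an intersection of such sets with the
  sphere.\<close>

lemma closed_short_directions:
  fixes U :: "'a::euclidean_space set"
  assumes U: "open U"
  shows "closed (short_directions U M)"
proof -
  have cl: "closed {w. \<not> {a..b} \<subseteq> line_section U x w}" for x :: 'a and a b
  proof -
    let ?T = "(\<lambda>p::real \<times> 'a. x + fst p *\<^sub>R snd p) -` (- U)"
    have "closed ?T"
      using U by (intro continuous_closed_vimage) (auto intro!: continuous_intros)
    then have "closed {w. \<exists>t. t \<in> {a..b} \<and> (t, w) \<in> ?T}"
      by (intro closed_compact_projection) auto
    moreover have "{w. \<exists>t. t \<in> {a..b} \<and> (t, w) \<in> ?T} = {w. \<not> {a..b} \<subseteq> line_section U x w}"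
      by (auto simp: line_section_def)
    ultimately show ?thesis by simp
  qed
  have "short_directions U M = sphere 0 1 \<inter>
     (\<Inter>x a b. {w. a \<le> b \<and> M < b - a \<longrightarrow> \<not> {a..b} \<subseteq> line_section U x w})"
    unfolding short_directions_def not_le[symmetric, of M] by blast
  also have "closed \<dots>"
  proof (intro closed_Int closed_INT ballI closed_sphere)
    fix x :: 'a and a b
    show "closed {w. a \<le> b \<and> M < b - a \<longrightarrow> \<not> {a..b} \<subseteq> line_section U x w}"
    proof (cases "a \<le> b \<and> M < b - a")
      case True
      then show ?thesis using cl[of a b x] by simp
    next
      case False
      then have "{w. a \<le> b \<and> M < b - a \<longrightarrow> \<not> {a..b} \<subseteq> line_section U x w} = UNIV" by blast
      then show ?thesis by simp
    qed
  qed
  finally show ?thesis .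
qed

lemma cone_shell_borel:
  fixes A :: "'a::euclidean_space set"
  assumes [measurable]: "A \<in> sets borel"
  shows "cone_shell A \<in> sets borel"
proof -
  have "cone_shell A = {z \<in> space borel. 1 < norm z \<and> norm z < 2 \<and> z /\<^sub>R norm z \<in> A}"
    by (simp add: cone_shell_def)
  also have "\<dots> \<in> sets borel" by measurable
  finally show ?thesis .
qed

lemma shell_const_pos: "shell_const d \<noteq> 0" "shell_const d \<noteq> top"
proof -
  have "(1::real) < 2 ^ Suc d" by (rule one_less_power) auto
 then have "(2::real) ^ Suc d \<noteq> 1" by linarith
  then show "shell_const d \<noteq> 0" "shell_const d \<noteq> top"
    unfolding shell_const_eq by (simp_all del: power_Suc of_nat_Suc)
qed

lemma frac_const_pos: "0 < s \<Longrightarrow> s < 1 \<Longrightarrow> 0 < frac_const n s"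
  unfolding frac_const_def by (intro divide_pos_pos mult_pos_pos Gamma_real_pos) auto

lemma energy_line_measurable [measurable (raw)]:
  fixes f :: "'a::euclidean_space \<Rightarrow> real"
  assumes [measurable]: "U \<in> sets borel" "f \<in> borel_measurable borel" "g \<in> measurable N borel" "h \<in> measurable N borel"
  shows "(\<lambda>p. energy s (line_section U (g p) (h p)) (\<lambda>t. f (g p + t *\<^sub>R h p))) \<in> borel_measurable N"
proof -
  have "(\<lambda>p. energy s (line_section U (g p) (h p)) (\<lambda>t. f (g p + t *\<^sub>R h p))) =
    (\<lambda>p. \<integral>\<^sup>+t. \<integral>\<^sup>+x. indicator U (g p + x *\<^sub>R h p) * indicator U (g p + t *\<^sub>R h p) *
      ennreal (\<bar>f (g p + x *\<^sub>R h p) - f (g p + t *\<^sub>R h p)\<bar>\<^sup>2 / norm (x - t) powr (real DIM(real) + 2 * s)) \<partial>lborel \<partial>lborel)"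
    by (simp add: energy_def line_section_def indicator_def)
  also have "\<dots> \<in> borel_measurable N" by measurable
  finally show ?thesis .
qed

text \<open>For each admissible direction the line inequality is integrated over the slab, where its
  left side becomes \<open>P * N\<close>, independent of the direction. Integrating over
  \<open>cone_shell D\<close> multiplies this by the volume of the cone, while on the right the
  integral may be extended to the whole shell.\<close>

lemma poincare_test_function_directions:
  fixes \<phi> :: "'a::euclidean_space \<Rightarrow> real"
  assumes \<phi>: "\<phi> \<in> test_functions \<Omega>" and \<Omega>: "\<Omega> \<in> sets lebesgue" and s: "0 < s" "s < 1"
    and S: "S \<subseteq> short_directions {x. \<phi> x \<noteq> 0} M"
  shows "ennreal (frac_const DIM('a) s / (2 * frac_const 1 s)) * hausdorff_measure (DIM('a) - 1) S *
      (poincare_const s {0<..<1::real} * ennreal (M powr (- 2 * s))) * L2_norm_sq \<Omega> \<phi>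
     \<le> gagliardo_sq s \<Omega> \<phi>"
proof -
  define U where "U = {x. \<phi> x \<noteq> 0}"
  define d where "d = DIM('a) - 1"
  define D where "D = short_directions U M"
  define P where "P = poincare_const s {0<..<1::real} * ennreal (M powr (- 2 * s))"
  define N where "N = (\<integral>\<^sup>+x. ennreal ((\<phi> x)\<^sup>2) \<partial>lborel)"
  define C1 where "C1 = frac_const 1 s"
  define Cn where "Cn = frac_const DIM('a) s"
  have C: "0 < C1" "0 < Cn" using frac_const_pos s by (auto simp: C1_def Cn_def)
  have smooth: "k_times_cont_diff k \<phi>" for k using \<phi> by (simp add: test_functions_def)
  have cont: "continuous_on UNIV \<phi>" and [measurable]: "\<phi> \<in> borel_measurable borel"
    using test_functions_continuous[OF \<phi>] by auto
  have U: "open U" unfolding U_def using cont by (intro open_Collect_neq continuous_intros)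
  then have Ub[measurable]: "U \<in> sets borel" by simp
  have U\<Omega>: "U \<subseteq> \<Omega>" using test_functions_continuous(3)[OF \<phi>] by (auto simp: U_def)
  have D: "closed D" unfolding D_def using U by (rule closed_short_directions)
  have Dsph: "D \<subseteq> sphere 0 1" by (auto simp: D_def short_directions_def)
  have cone[measurable]: "cone_shell D \<in> sets borel" using D by (intro cone_shell_borel) auto
  have line: "P * (\<integral>\<^sup>+t. ennreal ((\<phi> (y + t *\<^sub>R w))\<^sup>2) \<partial>lborel)
     \<le> ennreal (C1 / 2) * energy s (line_section U y w) (\<lambda>t. \<phi> (y + t *\<^sub>R w))" if "w \<in> D" for y w
  proof -
    have e: "line_section U y w = {t. \<phi> (y + t *\<^sub>R w) \<noteq> 0}" by (simp add: line_section_def U_def)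
    have "k_times_cont_diff k (\<lambda>t. \<phi> (y + t *\<^sub>R w))" for k by (rule k_times_cont_diff_line[OF smooth])
    moreover have "b - a \<le> M" if "a \<le> b" "{a..b} \<subseteq> {t. \<phi> (y + t *\<^sub>R w) \<noteq> 0}" for a b
      using \<open>w \<in> D\<close> that unfolding D_def short_directions_def e[symmetric] by blast
    ultimately show ?thesis unfolding e P_def C1_def using s(1) by (intro poincare_open_line) blast+
  qed
  have dir: "P * N \<le> ennreal (C1 / 2) * (\<integral>\<^sup>+y. indicator {0..<1} (y \<bullet> w) *
        energy s (line_section U y w) (\<lambda>t. \<phi> (y + t *\<^sub>R w)) \<partial>lborel)" if "w \<in> D" for w
  proof -
    have w: "norm w = 1" using that Dsph by auto
    have "P * N = P * (\<integral>\<^sup>+y. indicator {0..<1} (y \<bullet> w) * (\<integral>\<^sup>+t. ennreal ((\<phi> (y + t *\<^sub>R w))\<^sup>2) \<partial>lborel) \<partial>lborel)"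
      unfolding N_def by (subst nn_integral_along_lines[OF _ w]) auto
    also have "\<dots> = (\<integral>\<^sup>+y. P * (indicator {0..<1} (y \<bullet> w) * (\<integral>\<^sup>+t. ennreal ((\<phi> (y + t *\<^sub>R w))\<^sup>2) \<partial>lborel)) \<partial>lborel)"
      by (rule nn_integral_cmult[symmetric]) measurable
    also have "\<dots> \<le> (\<integral>\<^sup>+y. ennreal (C1 / 2) * (indicator {0..<1} (y \<bullet> w) *
        energy s (line_section U y w) (\<lambda>t. \<phi> (y + t *\<^sub>R w))) \<partial>lborel)"
      using line[OF that] by (intro nn_integral_mono) (simp split: split_indicator)
    also have "\<dots> = ennreal (C1 / 2) * (\<integral>\<^sup>+y. indicator {0..<1} (y \<bullet> w) *
        energy s (line_section U y w) (\<lambda>t. \<phi> (y + t *\<^sub>R w)) \<partial>lborel)"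
      by (rule nn_integral_cmult) measurable
    finally show ?thesis .
  qed
  \<comment> \<open>The outer measure is monotone, and the cone over the closed set \<open>D\<close>
    is Borel, whereas the one over \<open>S\<close> may not be measurable.\<close>
  have "hausdorff_measure d S * shell_const d \<le> hausdorff_measure d D * shell_const d"
  proof (rule mult_right_mono)
    have "S \<subseteq> D" using S by (simp add: D_def U_def)
    then show "hausdorff_measure d S \<le> hausdorff_measure d D"
      unfolding hausdorff_measure_def hausdorff_content_def
      by (intro SUP_mono' INF_superset_mono) auto
  qed simp
  also have "\<dots> \<le> emeasure lborel (cone_shell D)"
    using hausdorff_measure_shell_le[OF Dsph] cone by (simp add: d_def)
  finally have H: "hausdorff_measure d S * shell_const d \<le> emeasure lborel (cone_shell D)" .
  have "P * N * (hausdorff_measure d S * shell_const d) \<le> P * N * emeasure lborel (cone_shell D)"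
    using H by (rule mult_left_mono) simp
  also have "\<dots> = (\<integral>\<^sup>+z. P * N * indicator (cone_shell D) z \<partial>lborel)"
    by (rule nn_integral_cmult_indicator[symmetric]) simp
  also have "\<dots> \<le> (\<integral>\<^sup>+z. ennreal (C1 / 2) * (indicator {1<..<2} (norm z) * (\<integral>\<^sup>+y. indicator {0..<1} (y \<bullet> (z /\<^sub>R norm z)) *
        energy s (line_section U y (z /\<^sub>R norm z)) (\<lambda>t. \<phi> (y + t *\<^sub>R (z /\<^sub>R norm z))) \<partial>lborel)) \<partial>lborel)"
  proof (rule nn_integral_mono)
    fix z :: 'a
    show "P * N * indicator (cone_shell D) z \<le> ennreal (C1 / 2) * (indicator {1<..<2} (norm z) * (\<integral>\<^sup>+y. indicator {0..<1} (y \<bullet> (z /\<^sub>R norm z)) *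
        energy s (line_section U y (z /\<^sub>R norm z)) (\<lambda>t. \<phi> (y + t *\<^sub>R (z /\<^sub>R norm z))) \<partial>lborel))"
    proof (cases "z \<in> cone_shell D")
      case True
      then have "norm z \<in> {1<..<2}" "z /\<^sub>R norm z \<in> D" by (auto simp: cone_shell_def)
      then show ?thesis using dir[of "z /\<^sub>R norm z"] True by (simp del: scaleR_scaleR)
    qed simp
  qed
  also have "\<dots> = ennreal (C1 / 2) * (2 * (shell_const d * energy s U \<phi>))"
    unfolding d_def energy_along_lines[OF Ub \<open>\<phi> \<in> borel_measurable borel\<close>]
    by (rule nn_integral_cmult) measurable
  finally have "shell_const d * (P * N * hausdorff_measure d S) \<le> shell_const d * (ennreal (C1 / 2) * 2 * energy s U \<phi>)"
    by (simp add: mult_ac)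
  \<comment> \<open>The factor \<open>shell_const d\<close> is neither 0 nor \<open>top\<close>, so
    it cancels although the other factors may be infinite.\<close>
  then have main: "P * N * hausdorff_measure d S \<le> ennreal (C1 / 2) * 2 * energy s U \<phi>"
    using shell_const_pos[of d] by (simp add: ennreal_mult_le_mult_iff)
  have "L2_norm_sq \<Omega> \<phi> = N"
    unfolding L2_norm_sq_eq[OF \<Omega>] N_def using U\<Omega>
    by (intro nn_integral_cong) (auto simp: U_def split: split_indicator)
  then have "ennreal (Cn / (2 * C1)) * hausdorff_measure d S * P * L2_norm_sq \<Omega> \<phi>
     = ennreal (Cn / (2 * C1)) * (P * N * hausdorff_measure d S)"
    by (simp add: mult_ac)
  also have "\<dots> \<le> ennreal (Cn / (2 * C1)) * (ennreal (C1 / 2) * 2 * energy s U \<phi>)"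
    using main by (rule mult_left_mono) simp
  also have "\<dots> = ennreal (Cn / 2) * energy s U \<phi>"
  proof -
    have "ennreal (C1 / 2) * 2 = ennreal C1"
      using C by (simp add: ennreal_mult'[symmetric] flip: ennreal_numeral)
    then show ?thesis using C by (simp add: mult.assoc[symmetric] ennreal_mult'[symmetric])
  qed
  also have "\<dots> \<le> ennreal (Cn / 2) * energy s \<Omega> \<phi>"
    using energy_mono[OF U\<Omega>] by (rule mult_left_mono) simp
  also have "\<dots> = gagliardo_sq s \<Omega> \<phi>"
    by (simp add: gagliardo_sq_eq_energy[OF \<Omega>] Cn_def)
  finally show ?thesis by (simp add: Cn_def C1_def P_def d_def)
qed

section \<open>Passage to the closure of the test functions\<close>

text \<open>Young's inequality, from \<open>(\<epsilon> a - b)^2 >= 0\<close>. It replaces the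
  triangle inequality so that all estimates concern squares in \<open>ennreal\<close>;
  \<open>\<epsilon>\<close> tends to 0 in the closure argument and is a fixed number in the dyadic
  one.\<close>

lemma power2_add_le:
  fixes a b :: real
  assumes "0 < \<epsilon>"
  shows "(a + b)\<^sup>2 \<le> (1 + \<epsilon>) * a\<^sup>2 + (1 + 1 / \<epsilon>) * b\<^sup>2"
proof -
  have "0 \<le> (\<epsilon> * a - b)\<^sup>2 / \<epsilon>" using assms by simp
  also have "\<dots> = \<epsilon> * a\<^sup>2 + b\<^sup>2 / \<epsilon> - 2 * a * b"
    using assms by (simp add: power2_diff power_mult_distrib divide_simps) (simp add: power2_eq_square algebra_simps)
  finally show ?thesis by (simp add: power2_sum algebra_simps)
qed

lemma ennreal_power2_add_le:
  fixes a b :: real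
  assumes "0 < \<epsilon>"
  shows "ennreal ((a + b)\<^sup>2 / q) \<le> ennreal (1 + \<epsilon>) * ennreal (a\<^sup>2 / q) + ennreal (1 + 1 / \<epsilon>) * ennreal (b\<^sup>2 / q)"
proof (cases "0 \<le> q")
  case True
  have "(a + b)\<^sup>2 / q \<le> ((1 + \<epsilon>) * a\<^sup>2 + (1 + 1 / \<epsilon>) * b\<^sup>2) / q"
    using power2_add_le[OF assms] True by (rule divide_right_mono)
  then have "ennreal ((a + b)\<^sup>2 / q) \<le> ennreal ((1 + \<epsilon>) * (a\<^sup>2 / q) + (1 + 1 / \<epsilon>) * (b\<^sup>2 / q))"
    by (intro ennreal_leI) (simp add: add_divide_distrib)
  also have "\<dots> = ennreal (1 + \<epsilon>) * ennreal (a\<^sup>2 / q) + ennreal (1 + 1 / \<epsilon>) * ennreal (b\<^sup>2 / q)"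
    using assms True by (subst ennreal_plus) (simp_all only: ennreal_mult' add_nonneg_nonneg zero_le_one
        mult_nonneg_nonneg divide_nonneg_nonneg zero_le_power2 less_imp_le)
  finally show ?thesis .
next
  case False
  then have "(a + b)\<^sup>2 / q \<le> 0" by (intro divide_nonneg_nonpos) auto
  then show ?thesis by (simp add: ennreal_neg)
qed

lemma sigma_finite_lebesgue_on:
  fixes \<Omega> :: "'a::euclidean_space set"
  assumes "\<Omega> \<in> sets lebesgue"
  shows "sigma_finite_measure (lebesgue_on \<Omega>)"
proof (rule sigma_finite_measure_restrict_space[OF _ assms])
  from lborel.sigma_finite_countable obtain C :: "'a set set"
    where C: "countable C" "C \<subseteq> sets lborel" "\<Union>C = space lborel" "\<forall>a\<in>C. emeasure lborel a \<noteq> \<infinity>"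
    by blast
  show "sigma_finite_measure (lebesgue :: 'a measure)"
  proof
    show "\<exists>A. countable A \<and> A \<subseteq> sets (lebesgue::'a measure) \<and> \<Union>A = space lebesgue \<and> (\<forall>a\<in>A. emeasure lebesgue a \<noteq> \<infinity>)"
      using C by (intro exI[of _ C]) (auto simp: subset_iff)
  qed
qed

lemma L2_norm_sq_add_le:
  fixes \<Omega> :: "'a::euclidean_space set"
  assumes [measurable]: "f \<in> borel_measurable (lebesgue_on \<Omega>)" "g \<in> borel_measurable (lebesgue_on \<Omega>)" and "0 < \<epsilon>"
  shows "L2_norm_sq \<Omega> (\<lambda>x. f x + g x) \<le> ennreal (1 + \<epsilon>) * L2_norm_sq \<Omega> f + ennreal (1 + 1 / \<epsilon>) * L2_norm_sq \<Omega> g"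
proof -
  have "L2_norm_sq \<Omega> (\<lambda>x. f x + g x)
    \<le> (\<integral>\<^sup>+x. ennreal (1 + \<epsilon>) * ennreal ((f x)\<^sup>2) + ennreal (1 + 1 / \<epsilon>) * ennreal ((g x)\<^sup>2) \<partial>lebesgue_on \<Omega>)"
    unfolding L2_norm_sq_def
    by (intro nn_integral_mono) (use ennreal_power2_add_le[OF \<open>0 < \<epsilon>\<close>, of _ _ 1] in simp)
  also have "\<dots> = ennreal (1 + \<epsilon>) * L2_norm_sq \<Omega> f + ennreal (1 + 1 / \<epsilon>) * L2_norm_sq \<Omega> g"
    unfolding L2_norm_sq_def by (simp add: nn_integral_add nn_integral_cmult)
  finally show ?thesis .
qed

text \<open>The functions here are measurable only for the completed measure, so the integrals stay
  over \<open>lebesgue_on \<Omega>\<close>. Additivity of the outer integral needs measurability of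
  the inner one, hence a sigma-finite measure and a jointly measurable kernel.\<close>

lemma gagliardo_sq_add_le:
  fixes \<Omega> :: "'a::euclidean_space set"
  assumes \<Omega>: "\<Omega> \<in> sets lebesgue"
    and [measurable]: "f \<in> borel_measurable (lebesgue_on \<Omega>)" "g \<in> borel_measurable (lebesgue_on \<Omega>)" and "0 < \<epsilon>"
  shows "gagliardo_sq s \<Omega> (\<lambda>x. f x + g x) \<le> ennreal (1 + \<epsilon>) * gagliardo_sq s \<Omega> f + ennreal (1 + 1 / \<epsilon>) * gagliardo_sq s \<Omega> g"
proof -
  interpret sigma_finite_measure "lebesgue_on \<Omega>" using \<Omega> by (rule sigma_finite_lebesgue_on)
  have idm[measurable]: "(\<lambda>x. x) \<in> borel_measurable (lebesgue_on \<Omega>)"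
    by (intro measurable_restrict_space1 measurable_completion) simp
  let ?p = "real DIM('a) + 2 * s"
  define k where "k f x y = ennreal (\<bar>f x - f y\<bar>\<^sup>2 / norm (x - y) powr ?p)" for f and x y :: 'a
  have km: "(\<lambda>(y, x). k f x y) \<in> borel_measurable (lebesgue_on \<Omega> \<Otimes>\<^sub>M lebesgue_on \<Omega>)"
    if [measurable]: "f \<in> borel_measurable (lebesgue_on \<Omega>)" for f
  proof -
    have [measurable]: "fst \<in> borel_measurable (lebesgue_on \<Omega> \<Otimes>\<^sub>M lebesgue_on \<Omega>)"
      by (rule measurable_compose[OF measurable_fst idm])
    have [measurable]: "snd \<in> borel_measurable (lebesgue_on \<Omega> \<Otimes>\<^sub>M lebesgue_on \<Omega>)"
      by (rule measurable_compose[OF measurable_snd idm])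
    have [measurable]: "(\<lambda>p. f (fst p)) \<in> borel_measurable (lebesgue_on \<Omega> \<Otimes>\<^sub>M lebesgue_on \<Omega>)"
      by (rule measurable_compose[OF measurable_fst that])
    have [measurable]: "(\<lambda>p. f (snd p)) \<in> borel_measurable (lebesgue_on \<Omega> \<Otimes>\<^sub>M lebesgue_on \<Omega>)"
      by (rule measurable_compose[OF measurable_snd that])
    have "(\<lambda>(y, x). k f x y) = (\<lambda>p. ennreal (\<bar>f (snd p) - f (fst p)\<bar>\<^sup>2 / norm (snd p - fst p) powr ?p))"
      by (auto simp: k_def fun_eq_iff)
    also have "\<dots> \<in> borel_measurable (lebesgue_on \<Omega> \<Otimes>\<^sub>M lebesgue_on \<Omega>)"
      by measurable
    finally show ?thesis .
  qed
  have in1: "(\<lambda>x. k f x y) \<in> borel_measurable (lebesgue_on \<Omega>)" if "y \<in> space (lebesgue_on \<Omega>)" "f \<in> borel_measurable (lebesgue_on \<Omega>)" for y f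
    using measurable_compose_Pair1[OF that(1) km[OF that(2)]] by simp
  have in2: "(\<lambda>y. \<integral>\<^sup>+x. k f x y \<partial>lebesgue_on \<Omega>) \<in> borel_measurable (lebesgue_on \<Omega>)" if "f \<in> borel_measurable (lebesgue_on \<Omega>)" for f
    using borel_measurable_nn_integral[of "\<lambda>y x. k f x y" "lebesgue_on \<Omega>"] km[OF that] by simp
  have "(\<integral>\<^sup>+y. \<integral>\<^sup>+x. k (\<lambda>x. f x + g x) x y \<partial>lebesgue_on \<Omega> \<partial>lebesgue_on \<Omega>)
     \<le> (\<integral>\<^sup>+y. \<integral>\<^sup>+x. ennreal (1 + \<epsilon>) * k f x y + ennreal (1 + 1 / \<epsilon>) * k g x y \<partial>lebesgue_on \<Omega> \<partial>lebesgue_on \<Omega>)"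
  proof (intro nn_integral_mono)
    fix x y
    show "k (\<lambda>x. f x + g x) x y \<le> ennreal (1 + \<epsilon>) * k f x y + ennreal (1 + 1 / \<epsilon>) * k g x y"
      using ennreal_power2_add_le[OF \<open>0 < \<epsilon>\<close>, of "f x - f y" "g x - g y" "norm (x - y) powr ?p"]
      by (simp add: k_def algebra_simps)
  qed
  also have "\<dots> = (\<integral>\<^sup>+y. ennreal (1 + \<epsilon>) * (\<integral>\<^sup>+x. k f x y \<partial>lebesgue_on \<Omega>) + ennreal (1 + 1 / \<epsilon>) * (\<integral>\<^sup>+x. k g x y \<partial>lebesgue_on \<Omega>) \<partial>lebesgue_on \<Omega>)"
    using in1 assms(2,3) by (intro nn_integral_cong) (simp add: nn_integral_add nn_integral_cmult)
  also have "\<dots> = ennreal (1 + \<epsilon>) * (\<integral>\<^sup>+y. \<integral>\<^sup>+x. k f x y \<partial>lebesgue_on \<Omega> \<partial>lebesgue_on \<Omega>) + ennreal (1 + 1 / \<epsilon>) * (\<integral>\<^sup>+y. \<integral>\<^sup>+x. k g x y \<partial>lebesgue_on \<Omega> \<partial>lebesgue_on \<Omega>)"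
    using in2 assms(2,3) by (simp add: nn_integral_add nn_integral_cmult)
  finally have "ennreal (frac_const DIM('a) s / 2) * (\<integral>\<^sup>+y. \<integral>\<^sup>+x. k (\<lambda>x. f x + g x) x y \<partial>lebesgue_on \<Omega> \<partial>lebesgue_on \<Omega>)
     \<le> ennreal (frac_const DIM('a) s / 2) * \<dots>"
    by (rule mult_left_mono) simp
  then show ?thesis
    unfolding gagliardo_sq_def k_def by (simp add: distrib_left mult_ac)
qed

text \<open>The quadratic triangle inequality is used twice, to pass from \<open>u\<close> to
  \<open>\<phi> k\<close> in the \<open>L2\<close> norm and from \<open>\<phi> k\<close> back to
  \<open>u\<close> in the energy. Each use costs \<open>1 + \<epsilon>\<close> and a multiple of a
  squared distance that tends to 0 for fixed \<open>\<epsilon>\<close>.\<close>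

lemma poincare_const_geI:
  fixes \<Omega> :: "'a::euclidean_space set"
  assumes \<Omega>: "\<Omega> \<in> sets lebesgue"
    and test: "\<And>\<phi>. \<phi> \<in> test_functions \<Omega> \<Longrightarrow> \<kappa> * L2_norm_sq \<Omega> \<phi> \<le> gagliardo_sq s \<Omega> \<phi>"
  shows "\<kappa> \<le> poincare_const s \<Omega>"
  unfolding poincare_const_def
proof (rule INF_greatest)
  fix u assume u: "u \<in> {u \<in> sobolev_0 s \<Omega>. \<not> (AE x in lebesgue_on \<Omega>. u x = 0)}"
  define L where "L = L2_norm_sq \<Omega> u"
  define G where "G = gagliardo_sq s \<Omega> u"
  have um[measurable]: "u \<in> borel_measurable (lebesgue_on \<Omega>)" using u by (simp add: sobolev_0_def)
  have fin: "L < \<infinity>" "G < \<infinity>" using u by (auto simp: sobolev_0_def sobolev_norm_sq_def L_def G_def)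
  obtain \<phi> where \<phi>: "\<And>k::nat. \<phi> k \<in> test_functions \<Omega>"
    and lim: "(\<lambda>k. sobolev_norm_sq s \<Omega> (\<lambda>x. u x - \<phi> k x)) \<longlonglongrightarrow> 0"
    using u by (auto simp: sobolev_0_def)
  have \<phi>m[measurable]: "\<phi> k \<in> borel_measurable (lebesgue_on \<Omega>)" for k
    using test_functions_continuous(2)[OF \<phi>] by (simp add: measurable_completion measurable_restrict_space1)
  have "L \<noteq> 0"
  proof
    assume "L = 0"
    then have "AE x in lebesgue_on \<Omega>. ennreal ((u x)\<^sup>2) = 0"
      unfolding L_def L2_norm_sq_def by (subst (asm) nn_integral_0_iff_AE) auto
    then have "AE x in lebesgue_on \<Omega>. u x = 0" by eventually_elim simp
    then show False using u by simp
  qed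
  \<comment> \<open>A finite \<open>c\<close> replaces \<open>\<kappa>\<close>, which may be
    \<open>top\<close>: the coefficient \<open>B\<close> below must be finite for
    \<open>B * N k\<close> to tend to 0.\<close>
  have key: "ennreal c * L \<le> G" if "ennreal c \<le> \<kappa>" for c
  proof -
    have step: "ennreal c * L \<le> ennreal ((1 + \<epsilon>)\<^sup>2) * G" if "0 < \<epsilon>" for \<epsilon>
    proof -
      define N where "N k = sobolev_norm_sq s \<Omega> (\<lambda>x. u x - \<phi> k x)" for k
      have a: "L2_norm_sq \<Omega> (\<lambda>x. u x - \<phi> k x) \<le> N k" "gagliardo_sq s \<Omega> (\<lambda>x. u x - \<phi> k x) \<le> N k" for k
        by (auto simp: N_def sobolev_norm_sq_def)
      define B where "B = ennreal c * ennreal (1 + 1 / \<epsilon>) + ennreal (1 + \<epsilon>) * ennreal (1 + 1 / \<epsilon>)"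
      have "ennreal c * L \<le> ennreal ((1 + \<epsilon>)\<^sup>2) * G + B * N k" for k
      proof -
        have "L \<le> ennreal (1 + \<epsilon>) * L2_norm_sq \<Omega> (\<phi> k) + ennreal (1 + 1 / \<epsilon>) * L2_norm_sq \<Omega> (\<lambda>x. u x - \<phi> k x)"
          using L2_norm_sq_add_le[of "\<phi> k" \<Omega> "\<lambda>x. u x - \<phi> k x" \<epsilon>] \<open>0 < \<epsilon>\<close> by (simp add: L_def)
        also have "\<dots> \<le> ennreal (1 + \<epsilon>) * L2_norm_sq \<Omega> (\<phi> k) + ennreal (1 + 1 / \<epsilon>) * N k"
          by (intro add_mono mult_left_mono a) auto
        finally have "ennreal c * L \<le> ennreal c * (ennreal (1 + \<epsilon>) * L2_norm_sq \<Omega> (\<phi> k) + ennreal (1 + 1 / \<epsilon>) * N k)"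
          by (rule mult_left_mono) simp
        also have "\<dots> = ennreal (1 + \<epsilon>) * (ennreal c * L2_norm_sq \<Omega> (\<phi> k)) + ennreal c * ennreal (1 + 1 / \<epsilon>) * N k"
          by (simp add: distrib_left mult_ac)
        also have "ennreal c * L2_norm_sq \<Omega> (\<phi> k) \<le> \<kappa> * L2_norm_sq \<Omega> (\<phi> k)"
          using \<open>ennreal c \<le> \<kappa>\<close> by (rule mult_right_mono) simp
        also have "\<dots> \<le> gagliardo_sq s \<Omega> (\<phi> k)" by (rule test[OF \<phi>])
        also have "\<dots> \<le> ennreal (1 + \<epsilon>) * G + ennreal (1 + 1 / \<epsilon>) * gagliardo_sq s \<Omega> (\<lambda>x. u x - \<phi> k x)"
        proof -
          have "gagliardo_sq s \<Omega> (\<lambda>x. \<phi> k x - u x) = gagliardo_sq s \<Omega> (\<lambda>x. u x - \<phi> k x)"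
          proof -
            have "\<bar>(\<phi> k x - u x) - (\<phi> k y - u y)\<bar> = \<bar>(u x - \<phi> k x) - (u y - \<phi> k y)\<bar>" for x y by linarith
            then show ?thesis unfolding gagliardo_sq_def by simp
          qed
          then show ?thesis
            using gagliardo_sq_add_le[OF \<Omega>, of u "\<lambda>x. \<phi> k x - u x" \<epsilon> s] \<open>0 < \<epsilon>\<close> by (simp add: G_def)
        qed
        also have "\<dots> \<le> ennreal (1 + \<epsilon>) * G + ennreal (1 + 1 / \<epsilon>) * N k"
          by (intro add_mono mult_left_mono a) auto
        finally have "ennreal c * L \<le> ennreal (1 + \<epsilon>) * (ennreal (1 + \<epsilon>) * G + ennreal (1 + 1 / \<epsilon>) * N k) + ennreal c * ennreal (1 + 1 / \<epsilon>) * N k"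
          by (simp add: mult_left_mono add_right_mono)
        also have "\<dots> = ennreal ((1 + \<epsilon>)\<^sup>2) * G + B * N k"
        proof -
          have "ennreal ((1 + \<epsilon>)\<^sup>2) = ennreal (1 + \<epsilon>) * ennreal (1 + \<epsilon>)"
            unfolding power2_eq_square using \<open>0 < \<epsilon>\<close> by (intro ennreal_mult) auto
          then show ?thesis
            unfolding B_def by (simp add: distrib_left distrib_right mult_ac add_ac del: ennreal_plus)
        qed
        finally show ?thesis .
      qed
      moreover have "(\<lambda>k. ennreal ((1 + \<epsilon>)\<^sup>2) * G + B * N k) \<longlonglongrightarrow> ennreal ((1 + \<epsilon>)\<^sup>2) * G + B * 0"
        using lim unfolding N_def[symmetric]
        by (intro tendsto_add tendsto_const ennreal_tendsto_cmult) (simp_all add: B_def ennreal_mult_less_top)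
      ultimately show ?thesis using LIMSEQ_le_const[of _ "ennreal ((1 + \<epsilon>)\<^sup>2) * G" "ennreal c * L"] by auto
    qed
    have "(\<lambda>n. ennreal ((1 + 1 / real (Suc n))\<^sup>2) * G) \<longlonglongrightarrow> ennreal ((1 + 0)\<^sup>2) * G"
      using fin by (intro tendsto_mult_ennreal tendsto_ennrealI tendsto_intros LIMSEQ_Suc[OF lim_1_over_n]) auto
    then have "ennreal c * L \<le> ennreal ((1 + 0)\<^sup>2) * G"
      by (rule LIMSEQ_le_const) (auto intro!: step simp del: of_nat_Suc)
    then show ?thesis by simp
  qed
  have le: "ennreal c \<le> G / L" if "ennreal c \<le> \<kappa>" for c
    using divide_right_mono_ennreal[OF key[OF that], of L] \<open>L \<noteq> 0\<close> fin by (simp add: ennreal_mult_divide_eq)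
  show "\<kappa> \<le> gagliardo_sq s \<Omega> u / L2_norm_sq \<Omega> u"
    unfolding L_def[symmetric] G_def[symmetric]
  proof (cases \<kappa>)
    case (real r)
    then show "\<kappa> \<le> G / L" using le[of r] by simp
  next
    case top
    \<comment> \<open>The finite quotient \<open>G / L\<close> would exceed every natural number. So
      for infinite \<open>\<kappa>\<close> no admissible \<open>u\<close> exists and the infimum is
      taken over the empty set.\<close>
    then have "ennreal (real n) \<le> G / L" for n by (intro le) simp
    moreover have "G / L < \<infinity>" using fin \<open>L \<noteq> 0\<close> by (auto simp: less_top[symmetric] ennreal_divide_eq_top_iff)
    ultimately obtain g where g: "0 \<le> g" "\<And>n::nat. ennreal (real n) \<le> ennreal g"
      by (cases "G / L") auto
    obtain n :: nat where "g < real n" using reals_Archimedean2 by blast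
    with g(1) g(2)[of n] show "\<kappa> \<le> G / L" by simp
  qed
qed

section \<open>Positivity of the one-dimensional constant\<close>

text \<open>
  The inequality \<open>(a + b)\<^sup>2 \<le> (1 + \<theta>) a\<^sup>2 + (1 + 1 / \<theta>) b\<^sup>2\<close> with \<open>a = v y\<close> and \<open>b = v x - v y\<close>,
  averaged over \<open>0 < x < l\<close> and \<open>0 < y < l / 2\<close>. Iterating it along \<open>l = 2\<^sup>-\<^sup>k\<close> gives a geometric series
  with ratio \<open>2 (1 + \<theta>) / 4 powr s\<close>, which can be made less than \<open>1\<close> exactly when \<open>s > 1/2\<close>.
\<close>

lemma L2_half_interval_le:
  fixes v :: "real \<Rightarrow> real"
  assumes [measurable]: "v \<in> borel_measurable borel" and l: "0 < l" "l \<le> 1" and \<theta>: "0 < \<theta>" and s: "0 < s"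
  defines "J \<equiv> \<lambda>l. \<integral>\<^sup>+t. indicator {0<..<l} t * ennreal ((v t)\<^sup>2) \<partial>lborel"
  shows "J l \<le> ennreal (2 * (1 + \<theta>)) * J (l / 2) + ennreal (2 * (1 + 1 / \<theta>) * l powr (2 * s)) * energy s {0<..<1} v"
proof -
  define k where "k x y = ennreal (\<bar>v x - v y\<bar>\<^sup>2 / norm (x - y) powr (real DIM(real) + 2 * s))" for x y
  have [measurable]: "case_prod k \<in> borel_measurable (borel \<Otimes>\<^sub>M borel)" unfolding k_def by measurable
  let ?p = "1 + 2 * s"
  let ?E = "energy s {0<..<1} v"
  have pt: "indicator {0<..<l/2} y * (indicator {0<..<l} x * ennreal ((v x)\<^sup>2))
     \<le> indicator {0<..<l} x * (ennreal (1 + \<theta>) * (indicator {0<..<l/2} y * ennreal ((v y)\<^sup>2)))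
      + ennreal ((1 + 1 / \<theta>) * l powr ?p) * (indicator {0<..<1} x * indicator {0<..<1} y * k x y)" for x y
  proof (cases "x \<in> {0<..<l} \<and> y \<in> {0<..<l/2}")
    case True
    have "(v x)\<^sup>2 \<le> (1 + \<theta>) * (v y)\<^sup>2 + (1 + 1 / \<theta>) * (l powr ?p * (\<bar>v x - v y\<bar>\<^sup>2 / norm (x - y) powr ?p))"
    proof -
      \<comment> \<open>Both points lie in \<open>(0, l)\<close>, so their distance is at most
        \<open>l\<close>; on the diagonal both sides are 0.\<close>
      have "(v x - v y)\<^sup>2 \<le> l powr ?p * (\<bar>v x - v y\<bar>\<^sup>2 / norm (x - y) powr ?p)"
      proof (cases "x = y")
        case False
        have "norm (x - y) powr ?p \<le> l powr ?p"
          using True l s by (intro powr_mono2) (auto simp: abs_if)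
        then have "(v x - v y)\<^sup>2 * norm (x - y) powr ?p \<le> (v x - v y)\<^sup>2 * l powr ?p"
          by (intro mult_left_mono) auto
        then show ?thesis using False by (simp add: field_simps)
      qed simp
      then have "(1 + 1 / \<theta>) * (v x - v y)\<^sup>2 \<le> (1 + 1 / \<theta>) * (l powr ?p * (\<bar>v x - v y\<bar>\<^sup>2 / norm (x - y) powr ?p))"
        using \<theta> by (intro mult_left_mono) auto
      moreover have "(v x)\<^sup>2 \<le> (1 + \<theta>) * (v y)\<^sup>2 + (1 + 1 / \<theta>) * (v x - v y)\<^sup>2"
        using power2_add_le[OF \<theta>, of "v y" "v x - v y"] by simp
      ultimately show ?thesis by linarith
    qed
    then have "ennreal ((v x)\<^sup>2) \<le> ennreal ((1 + \<theta>) * (v y)\<^sup>2 + (1 + 1 / \<theta>) * (l powr ?p * (\<bar>v x - v y\<bar>\<^sup>2 / norm (x - y) powr ?p)))"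
      by (rule ennreal_leI)
    also have "\<dots> = ennreal (1 + \<theta>) * ennreal ((v y)\<^sup>2) + ennreal ((1 + 1 / \<theta>) * l powr ?p) * k x y"
      using \<theta> by (subst ennreal_plus) (simp_all add: k_def ennreal_mult' mult.assoc del: ennreal_plus times_divide_eq_right)
    finally show ?thesis using True l by simp
  qed auto
  have "(\<integral>\<^sup>+y. \<integral>\<^sup>+x. indicator {0<..<l/2} y * (indicator {0<..<l} x * ennreal ((v x)\<^sup>2)) \<partial>lborel \<partial>lborel)
     \<le> (\<integral>\<^sup>+y. \<integral>\<^sup>+x. indicator {0<..<l} x * (ennreal (1 + \<theta>) * (indicator {0<..<l/2} y * ennreal ((v y)\<^sup>2)))
      + ennreal ((1 + 1 / \<theta>) * l powr ?p) * (indicator {0<..<1} x * indicator {0<..<1} y * k x y) \<partial>lborel \<partial>lborel)"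
    by (intro nn_integral_mono pt)
  also have "\<dots> = (\<integral>\<^sup>+y. ennreal l * (ennreal (1 + \<theta>) * (indicator {0<..<l/2} y * ennreal ((v y)\<^sup>2)))
      + ennreal ((1 + 1 / \<theta>) * l powr ?p) * (\<integral>\<^sup>+x. indicator {0<..<1} x * indicator {0<..<1} y * k x y \<partial>lborel) \<partial>lborel)"
    using l by (intro nn_integral_cong) (simp add: nn_integral_add nn_integral_cmult nn_integral_multc)
  also have "\<dots> = ennreal l * (ennreal (1 + \<theta>) * J (l / 2)) + ennreal ((1 + 1 / \<theta>) * l powr ?p) * ?E"
    by (simp add: nn_integral_add nn_integral_cmult J_def energy_def k_def)
  also have "(\<integral>\<^sup>+y. \<integral>\<^sup>+x. indicator {0<..<l/2} y * (indicator {0<..<l} x * ennreal ((v x)\<^sup>2)) \<partial>lborel \<partial>lborel) = ennreal (l / 2) * J l"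
    using l by (simp add: nn_integral_cmult nn_integral_multc J_def)
  \<comment> \<open>Integrating out the free variable left \<open>l / 2\<close> on the left and
    \<open>l\<close> on the right; their ratio is the 2 in \<open>2 * (1 + \<theta>)\<close>. The
    remaining power of \<open>l\<close> drops from \<open>1 + 2 s\<close> to
    \<open>2 s\<close>.\<close>
  finally have "ennreal (2 / l) * (ennreal (l / 2) * J l) \<le> ennreal (2 / l) * (ennreal l * (ennreal (1 + \<theta>) * J (l / 2)) + ennreal ((1 + 1 / \<theta>) * l powr ?p) * ?E)"
    by (rule mult_left_mono) simp
  moreover have "ennreal (2 / l) * (ennreal (l / 2) * Q) = Q" for Q
    using l by (simp add: mult.assoc[symmetric] ennreal_mult'[symmetric])
  moreover have "ennreal (2 / l) * (ennreal l * (ennreal (1 + \<theta>) * Q)) = ennreal (2 * (1 + \<theta>)) * Q" for Q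
  proof -
    have "ennreal (2 / l) * (ennreal l * (ennreal (1 + \<theta>) * Q)) = ennreal (2 / l * (l * (1 + \<theta>))) * Q"
      using l \<theta> by (simp add: ennreal_mult' mult.assoc del: ennreal_plus times_divide_eq_left times_divide_eq_right)
    also have "2 / l * (l * (1 + \<theta>)) = 2 * (1 + \<theta>)" using l by simp
    finally show ?thesis .
  qed
  moreover have "ennreal (2 / l) * (ennreal ((1 + 1 / \<theta>) * l powr ?p) * Q) = ennreal (2 * (1 + 1 / \<theta>) * l powr (2 * s)) * Q" for Q
  proof -
    have "2 / l * ((1 + 1 / \<theta>) * l powr ?p) = 2 * (1 + 1 / \<theta>) * l powr (2 * s)"
      using l by (simp add: powr_add)
    then show ?thesis using l \<theta> by (simp add: mult.assoc[symmetric] ennreal_mult'[symmetric])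
  qed
  ultimately show ?thesis by (simp add: distrib_left)
qed

lemma poincare_unit_interval_pos:
  assumes s: "1/2 < s" "s < 1"
  shows "0 < poincare_const s {0<..<1::real}"
proof -
  \<comment> \<open>The midpoint of 2 and \<open>4 powr s\<close>, an interval that is nonempty
    because \<open>1/2 < s\<close>. Then \<open>\<theta>\<close> is determined by
    \<open>2 * (1 + \<theta>) = r\<close>, and \<open>q < 1\<close> is the ratio of the energy terms
    under iteration.\<close>
  define r where "r = (2 + 4 powr s) / 2"
  define \<theta> where "\<theta> = r / 2 - 1"
  define q where "q = r * 4 powr (- s)"
  define D where "D = 2 * (1 + 1 / \<theta>)"
  have "4 powr (1/2) < (4 powr s :: real)" using s by (intro powr_less_mono) auto
  then have "2 < (4 powr s :: real)" by (simp add: powr_half_sqrt)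
  then have r: "2 < r" "r < 4 powr s" by (auto simp: r_def)
  then have \<theta>: "0 < \<theta>" "2 * (1 + \<theta>) = r" by (auto simp: \<theta>_def)
  have q: "0 < q" "q < 1" using r by (auto simp: q_def powr_minus field_simps)
  have D: "0 < D" unfolding D_def using \<theta> by (intro mult_pos_pos add_pos_pos divide_pos_pos) auto
  define K where "K = D / (1 - q)"
  have K: "0 < K" using D q by (simp add: K_def)
  have C: "0 < frac_const 1 s" using s by (intro frac_const_pos) auto
  have I: "{0<..<1::real} \<in> sets lebesgue" by simp
  define \<kappa> where "\<kappa> = ennreal (frac_const 1 s / 2 / K)"
  have "\<kappa> \<le> poincare_const s {0<..<1::real}"
  proof (rule poincare_const_geI[OF I])
    fix v :: "real \<Rightarrow> real" assume v: "v \<in> test_functions {0<..<1}"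
    have vm[measurable]: "v \<in> borel_measurable borel" using test_functions_continuous(2)[OF v] .
    define E where "E = energy s {0<..<1} v"
    define J where "J l = (\<integral>\<^sup>+t. indicator {0<..<l} t * ennreal ((v t)\<^sup>2) \<partial>lborel)" for l
    have iter: "J 1 \<le> ennreal (r ^ n) * J (1 / 2 ^ n) + ennreal (D * (\<Sum>i<n. q ^ i)) * E" for n
    proof (induction n)
      case (Suc n)
      have "J (1 / 2 ^ n) \<le> ennreal r * J (1 / 2 ^ Suc n) + ennreal (D * (1 / 2 ^ n) powr (2 * s)) * E"
        using L2_half_interval_le[OF vm, of "1 / 2 ^ n" \<theta> s, unfolded \<theta>(2)] \<theta>(1) s by (simp add: J_def E_def D_def mult.commute)
      also have "(1 / 2 ^ n) powr (2 * s) = (4 powr (- s)) ^ n"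
      proof -
        have "(1 / 2 ^ n :: real) = 2 powr (- real n)" by (simp add: powr_minus powr_realpow divide_inverse)
        then have "(1 / 2 ^ n) powr (2 * s) = 2 powr (2 * (- s * real n))" by (simp add: powr_powr mult_ac)
        also have "\<dots> = (2 powr 2) powr (- s * real n)" by (simp only: powr_powr)
        also have "(2 powr 2 :: real) = 4" by simp
        also have "4 powr (- s * real n) = (4 powr (- s)) powr real n" by (simp only: powr_powr)
        also have "\<dots> = (4 powr (- s)) ^ n" by (simp add: powr_realpow)
        finally show ?thesis .
      qed
      finally have "ennreal (r ^ n) * J (1 / 2 ^ n) \<le> ennreal (r ^ n) * (ennreal r * J (1 / 2 ^ Suc n) + ennreal (D * (4 powr (- s)) ^ n) * E)"
        by (rule mult_left_mono) simp
      also have "\<dots> = ennreal (r ^ Suc n) * J (1 / 2 ^ Suc n) + ennreal (D * q ^ n) * E"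
      proof -
        have "ennreal (r ^ n) * ennreal r = ennreal (r ^ Suc n)"
          using r by (simp add: ennreal_mult'[symmetric] mult.commute)
        moreover have "ennreal (r ^ n) * ennreal (D * (4 powr (- s)) ^ n) = ennreal (D * q ^ n)"
          using r by (simp add: ennreal_mult'[symmetric] q_def power_mult_distrib mult_ac)
        ultimately show ?thesis by (simp only: distrib_left mult.assoc[symmetric])
      qed
      finally have "J 1 \<le> ennreal (r ^ Suc n) * J (1 / 2 ^ Suc n) + ennreal (D * q ^ n) * E + ennreal (D * (\<Sum>i<n. q ^ i)) * E"
        using Suc.IH by (meson add_right_mono order_trans)
      also have "\<dots> = ennreal (r ^ Suc n) * J (1 / 2 ^ Suc n) + ennreal (D * (\<Sum>i<Suc n. q ^ i)) * E"
      proof -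
        have "ennreal (D * q ^ n) + ennreal (D * (\<Sum>i<n. q ^ i)) = ennreal (D * (\<Sum>i<Suc n. q ^ i))"
          using D q by (subst ennreal_plus[symmetric]) (auto intro!: sum_nonneg mult_nonneg_nonneg simp: distrib_left add.commute)
        then show ?thesis by (metis add.assoc distrib_right)
      qed
      finally show ?case .
    qed simp
    \<comment> \<open>The factor \<open>r ^ n\<close> grows, so the remainder is removed exactly:
      the support is closed and misses 0, hence \<open>v\<close> vanishes on a short enough dyadic
      interval.\<close>
    obtain n where n: "J (1 / 2 ^ n) = 0"
    proof -
      define F where "F = closure {x. v x \<noteq> 0}"
      have "closed F" "0 \<notin> F" using v by (auto simp: F_def test_functions_def)
      then obtain e where e: "0 < e" "ball 0 e \<subseteq> - F" by (metis ComplI open_Compl open_contains_ball)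
      obtain n where "(1/2::real) ^ n < e" using e real_arch_pow_inv[of e "1/2"] by auto
      then have n: "1 / 2 ^ n < e" by (simp add: power_divide)
      have "v t = 0" if "t \<in> {0<..<1 / 2 ^ n}" for t
      proof -
        have "t \<in> ball 0 e" using that n by (auto simp: dist_real_def)
        then have "t \<notin> F" using e by blast
        then show ?thesis using closure_subset[of "{x. v x \<noteq> 0}"] by (auto simp: F_def)
      qed
      then have "J (1 / 2 ^ n) = (\<integral>\<^sup>+t. 0 \<partial>(lborel :: real measure))"
        unfolding J_def by (intro nn_integral_cong) (simp split: split_indicator)
      then show thesis using that by simp
    qed
    have "D * (\<Sum>i<n. q ^ i) \<le> K"
    proof -
      have "(\<Sum>i<n. q ^ i) = (1 - q ^ n) / (1 - q)" using q by (simp add: sum_gp_strict)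
      also have "\<dots> \<le> 1 / (1 - q)" using q by (intro divide_right_mono) auto
      finally show ?thesis using D by (simp add: K_def mult_left_mono divide_inverse)
    qed
    have "J 1 \<le> ennreal (D * (\<Sum>i<n. q ^ i)) * E" using iter[of n] n by simp
    also have "\<dots> \<le> ennreal K * E"
      using \<open>D * (\<Sum>i<n. q ^ i) \<le> K\<close> by (intro mult_right_mono ennreal_leI) auto
    finally have "J 1 \<le> ennreal K * E" .
    then have "\<kappa> * J 1 \<le> \<kappa> * (ennreal K * E)" by (rule mult_left_mono) simp
    also have "\<dots> = ennreal (frac_const 1 s / 2) * E"
      using K C by (simp add: \<kappa>_def mult.assoc[symmetric] ennreal_mult'[symmetric])
    finally show "\<kappa> * L2_norm_sq {0<..<1} v \<le> gagliardo_sq s {0<..<1} v"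
      by (simp add: L2_norm_sq_eq[OF I] gagliardo_sq_eq_energy[OF I] J_def E_def)
  qed
  moreover have "0 < \<kappa>" using K C by (simp add: \<kappa>_def)
  ultimately show ?thesis by (rule less_le_trans[rotated])
qed

section \<open>The regional fractional Poincare inequality\<close>

text \<open>For \<open>d = 0\<close> this rests on the clause for the empty set in
  \<open>hausdorff_size\<close>, since the power there would be 1. It turns positive measure into
  the existence of a direction.\<close>

lemma hausdorff_measure_empty: "hausdorff_measure d {} = 0"
proof -
  have "hausdorff_content d \<delta> {} \<le> 0" if "0 < \<delta>" for \<delta>
    unfolding hausdorff_content_def
    by (rule INF_lower2[of "\<lambda>_. {}"]) (use that in \<open>auto simp: hausdorff_size_def\<close>)
  then have "hausdorff_measure d {} \<le> 0"
    unfolding hausdorff_measure_def by (intro SUP_least) auto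
  then show ?thesis by simp
qed

theorem theorem1p3:
  fixes \<Omega> :: "'a::euclidean_space set"
    and S :: "'a set"
    and s :: real
    and m :: ennreal
  assumes "\<Omega> \<in> sets lebesgue"
    and "1/2 < s" and "s < 1"
    and "S \<subseteq> sphere 0 1"
    and "hausdorff_measure (DIM('a) - 1) S > 0"
    and m_def: "m = Sup {emeasure lborel I | I x w.
                  is_interval I \<and> w \<in> S \<and> I \<subseteq> line_section \<Omega> x w}"
    and "m < \<infinity>"
  shows "poincare_const s \<Omega> > 0 \<and>
         poincare_const s \<Omega> \<ge>
           ennreal (frac_const DIM('a) s / (2 * frac_const 1 s)) * hausdorff_measure (DIM('a) - 1) S *
           (poincare_const s {0<..<1::real} / ennreal (enn2real m powr (2 * s)))"
proof (cases "m = 0")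
  case True
  obtain w where w: "w \<in> S"
    using assms(5) hausdorff_measure_empty by (metis ex_in_conv less_irrefl)
  \<comment> \<open>With \<open>m = 0\<close> the bound divides by 0, so the constant is shown to be
    infinite: a nonzero value of a test function would give an interval of positive length in a line
    section, so only the zero test function exists.\<close>
  have "top \<le> poincare_const s \<Omega>"
  proof (rule poincare_const_geI[OF assms(1)])
    fix \<phi> assume \<phi>: "\<phi> \<in> test_functions \<Omega>"
    have "\<phi> x = 0" for x
    proof (rule ccontr)
      assume "\<phi> x \<noteq> 0"
      have "open {t::real. \<phi> (x + t *\<^sub>R w) \<noteq> 0}"
        by (intro open_Collect_neq continuous_on_compose2[OF test_functions_continuous(1)[OF \<phi>]] continuous_intros) auto
      then obtain e where e: "0 < e" "cball 0 e \<subseteq> {t::real. \<phi> (x + t *\<^sub>R w) \<noteq> 0}"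
        using \<open>\<phi> x \<noteq> 0\<close> by (metis (mono_tags) add.right_neutral mem_Collect_eq open_contains_cball scaleR_zero_left)
      then have "{- e..e} \<subseteq> line_section \<Omega> x w"
        using test_functions_continuous(3)[OF \<phi>] by (auto simp: line_section_def cball_eq_atLeastAtMost)
      then have "emeasure lborel {- e..e} \<le> m"
        unfolding m_def using w by (intro Sup_upper CollectI exI[of _ "{- e..e}"]) (auto simp: is_interval_cc)
      then show False using e True by simp
    qed
    then show "top * L2_norm_sq \<Omega> \<phi> \<le> gagliardo_sq s \<Omega> \<phi>" by (simp add: L2_norm_sq_def)
  qed
  then have "poincare_const s \<Omega> = top" by (simp add: top_unique)
  then show ?thesis by simp
next
  case False
  define M where "M = enn2real m"
  have mM: "m = ennreal M" using \<open>m < \<infinity>\<close> by (simp add: M_def)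
  have M: "0 < M" using False \<open>m < \<infinity>\<close> by (simp add: M_def enn2real_positive_iff less_top zero_less_iff_neq_zero)
  define P where "P = poincare_const s {0<..<1::real}"
  let ?\<kappa> = "ennreal (frac_const DIM('a) s / (2 * frac_const 1 s)) * hausdorff_measure (DIM('a) - 1) S *
      (P * ennreal (M powr (- 2 * s)))"
  have le: "?\<kappa> \<le> poincare_const s \<Omega>"
  proof (rule poincare_const_geI[OF assms(1)])
    fix \<phi> assume \<phi>: "\<phi> \<in> test_functions \<Omega>"
    have "S \<subseteq> short_directions {x. \<phi> x \<noteq> 0} M"
      unfolding short_directions_def
    proof (intro subsetI CollectI conjI allI impI)
      fix w x and a b :: real assume "w \<in> S" and ab: "a \<le> b" and sub: "{a..b} \<subseteq> line_section {x. \<phi> x \<noteq> 0} x w"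
      have "{a..b} \<subseteq> line_section \<Omega> x w"
        using sub test_functions_continuous(3)[OF \<phi>] by (auto simp: line_section_def)
      then have "emeasure lborel {a..b} \<le> m"
        unfolding m_def using \<open>w \<in> S\<close> by (intro Sup_upper CollectI exI[of _ "{a..b}"]) (auto simp: is_interval_cc)
      then show "b - a \<le> M" using ab M by (simp add: mM)
    qed (use assms(4) in auto)
    then show "?\<kappa> * L2_norm_sq \<Omega> \<phi> \<le> gagliardo_sq s \<Omega> \<phi>"
      unfolding P_def using assms by (intro poincare_test_function_directions[OF \<phi>]) auto
  qed
  have "P / ennreal (M powr (2 * s)) = P * ennreal (M powr (- 2 * s))"
    using M by (simp add: divide_ennreal_def inverse_ennreal powr_minus)
  \<comment> \<open>The bound \<open>1/2 < s\<close> enters here, through positivity of the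
    one-dimensional constant; strict positivity on \<open>\<Omega>\<close> then follows from
    \<open>le\<close>.\<close>
  moreover have "0 < ?\<kappa>"
    using poincare_unit_interval_pos[OF assms(2,3)] assms(2,3,5) M frac_const_pos[of s 1] frac_const_pos[of s "DIM('a)"]
    by (simp add: P_def ennreal_zero_less_mult_iff)
  ultimately show ?thesis
    using le unfolding P_def[symmetric] M_def[symmetric] by (auto intro: less_le_trans)
qed

end
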